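(* Let $K\ge 1$ be an integer and let $Q(x)=\sum_{k=0}^Kq_kx^k$ be a polynomial with real coefficients, $q_K\neq0$. Let $v\in C^K(\mathbb{R})\cap L^\infty(\mathbb{R})$ satisfy $v(\xi)>0$ and $|v'(\xi)|\le Cv(\xi)$ for all $\xi\in\mathbb{R}$ and some constant $C$. Let $A$ be the self-adjoint operator $A=vQ(D)v$ in $L^2(\mathbb{R})$, $D=i\,d/d\xi$. Suppose additionally that $$v^{(k)}v^{-1}\in L^\infty(\mathbb{R}),\quad k=1,\ldots,K-1,$$ and that, for some $\delta>0$, $$\Big(\int_{-n(1+\delta)}^{n(1+\delta)}v(\xi)^{-2+4/K}\,d\xi\Big)\Big(\int_{-n}^{n}v(\xi)^{-2}\,d\xi\Big)^{-1}\to0$$ as $n\to\infty$. If $K$ is odd, then $\operatorname{spec}(A)=\mathbb{R}$. If $K$ is even and $q_K>0$, then $[0,\infty)\subset\operatorname{spec}(A)$.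
   Context: The symmetric operator $A_0$ in $L^2(\mathbb{R})$ is defined on the domain $C_0^K(\mathbb{R})$ ($K$ times continuously differentiable functions with compact support) by $A_0g=vQ(D)(vg)$. Under the stated conditions on $v$ it is essentially self-adjoint, and $A$ denotes its closure; $\mathcal{D}(A)$ consists of all $g\in L^2(\mathbb{R})$ such that $vQ(D)(vg)$, understood in the sense of distributions, belongs to $L^2(\mathbb{R})$, and $Ag=vQ(D)(vg)$. *)

theory Defs
  imports "HOL-Analysis.Analysis" "HOL-Computational_Algebra.Polynomial"
begin

definition nth_vderiv :: "nat \<Rightarrow> (real \<Rightarrow> 'a::real_normed_vector) \<Rightarrow> real \<Rightarrow> 'a" where
  "nth_vderiv k f = ((\<lambda>g x. vector_derivative g (at x)) ^^ k) f"

definition C_times :: "nat \<Rightarrow> (real \<Rightarrow> 'a::real_normed_vector) \<Rightarrow> bool" where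
  "C_times k f \<longleftrightarrow>
     (\<forall>j<k. \<forall>x. nth_vderiv j f differentiable (at x)) \<and> continuous_on UNIV (nth_vderiv k f)"

text \<open>
  Elements of \<open>L\<^sup>2(\<real>)\<close> are represented by Borel functions; every class of
  Lebesgue measurable functions has such a representative. Equality in \<open>L\<^sup>2(\<real>)\<close> is
  equality almost everywhere.
\<close>

definition L2 :: "(real \<Rightarrow> complex) set" where
  "L2 = {f \<in> borel_measurable lborel. integrable lborel (\<lambda>x. (cmod (f x))\<^sup>2)}"

definition L2norm :: "(real \<Rightarrow> complex) \<Rightarrow> real" where
  "L2norm f = sqrt (LBINT x. (cmod (f x))\<^sup>2)"

definition L2_lim :: "(nat \<Rightarrow> real \<Rightarrow> complex) \<Rightarrow> (real \<Rightarrow> complex) \<Rightarrow> bool" where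
  "L2_lim f g \<longleftrightarrow>
     (\<forall>n. f n \<in> L2) \<and> g \<in> L2 \<and> (\<lambda>n. L2norm (\<lambda>x. f n x - g x)) \<longlonglongrightarrow> 0"

text \<open>
  An operator \<open>T\<close> in \<open>L\<^sup>2(\<real>)\<close> with a domain is given by its graph, the set of pairs
  \<open>(g, T g)\<close> (of representatives) with \<open>g\<close> in the domain of \<open>T\<close>. The closure of an
  operator is the closure of its graph in \<open>L\<^sup>2(\<real>) \<times> L\<^sup>2(\<real>)\<close>; it contains, with
  a pair, all pairs that are equal to it almost everywhere.
\<close>

type_synonym L2_graph = "((real \<Rightarrow> complex) \<times> (real \<Rightarrow> complex)) set"

definition op_closure :: "L2_graph \<Rightarrow> L2_graph" where
  "op_closure T =
     {(g, h). \<exists>gs hs. (\<forall>n. (gs n, hs n) \<in> T) \<and> L2_lim gs g \<and> L2_lim hs h}"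

text \<open>
  \<open>z\<close> is in the resolvent set of \<open>T\<close> if \<open>T - z\<close> is a bijection of the domain of
  \<open>T\<close> onto \<open>L\<^sup>2(\<real>)\<close> with bounded inverse.
\<close>

definition resolvent_set :: "L2_graph \<Rightarrow> complex set" where
  "resolvent_set T = {z.
     (\<forall>(g, h) \<in> T. (AE x in lborel. h x - z * g x = 0) \<longrightarrow> (AE x in lborel. g x = 0)) \<and>
     (\<forall>f \<in> L2. \<exists>(g, h) \<in> T. AE x in lborel. h x - z * g x = f x) \<and>
     (\<exists>C. \<forall>(g, h) \<in> T. L2norm g \<le> C * L2norm (\<lambda>x. h x - z * g x))}"

definition op_spectrum :: "L2_graph \<Rightarrow> complex set" where
  "op_spectrum T = - resolvent_set T"

text \<open>\<open>Q(D) f\<close> for \<open>D = \<i> d/d\<xi>\<close>.\<close>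

definition poly_D :: "real poly \<Rightarrow> (real \<Rightarrow> complex) \<Rightarrow> real \<Rightarrow> complex" where
  "poly_D Q f \<xi> =
     (\<Sum>k\<le>degree Q. complex_of_real (coeff Q k) * \<i> ^ k * nth_vderiv k f \<xi>)"

definition C0_times :: "nat \<Rightarrow> (real \<Rightarrow> complex) set" where
  "C0_times k = {g. C_times k g \<and> compact (closure {x. g x \<noteq> 0})}"

definition A0_op :: "real poly \<Rightarrow> (real \<Rightarrow> real) \<Rightarrow> L2_graph" where
  "A0_op Q v =
     {(g, \<lambda>\<xi>. complex_of_real (v \<xi>) * poly_D Q (\<lambda>\<eta>. complex_of_real (v \<eta>) * g \<eta>) \<xi>) | g.
        g \<in> C0_times (degree Q)}"

definition A_op :: "real poly \<Rightarrow> (real \<Rightarrow> real) \<Rightarrow> L2_graph" where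
  "A_op Q v = op_closure (A0_op Q v)"

end

theory Submission imports Defs begin

text \<open>
  Write \<open>q\<close> for the leading coefficient of \<open>Q\<close>, and \<open>w = v g\<close>. Two things have to be shown: the real
  numbers in question belong to the spectrum, and for odd \<open>K\<close> no nonreal number does.

  Real points of the spectrum come from approximate eigenfunctions of WKB type. If \<open>\<lambda> = q c^K\<close>, put
  \<open>g = \<phi> v\<^sup>-\<^sup>1 exp (-\<i> \<theta>)\<close> with \<open>\<theta>' = c v powr (-2/K)\<close> and a cutoff \<open>\<phi>\<close> that is \<open>1\<close> on \<open>{-n..n}\<close> and \<open>0\<close> outside
  \<open>{-n(1+\<delta>)..n(1+\<delta>)}\<close>. The leading term of \<open>v Q(D) (v g)\<close> is \<open>q (\<theta>')^K v\<^sup>2 g = \<lambda> g\<close>, and the remainder is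
  bounded by \<open>v powr (-1 + 2/K)\<close> (\<open>quasimodes\<close>). The squares of these bounds are the integrands in the
  hypothesis on the quotient of integrals, so \<open>\<parallel>(A - \<lambda>) g\<parallel> / \<parallel>g\<parallel>\<close> tends to zero (\<open>in_spectrum\<close>). Every
  real \<open>\<lambda>\<close> has the form \<open>q c^K\<close> if \<open>K\<close> is odd, and every \<open>\<lambda> \<ge> 0\<close> has it if \<open>q > 0\<close>.

  That nonreal \<open>z\<close> belong to the resolvent set is the essential self-adjointness of the operator on
  compactly supported functions. Symmetry gives \<open>\<bar>Im z\<bar> \<parallel>g\<parallel> \<le> \<parallel>(A - z) g\<parallel>\<close> (\<open>A_lower_bound\<close>), and it
  remains to show that the range of \<open>A0 - z\<close> is dense. If \<open>u\<close> is orthogonal to it, then \<open>v (cnj u)\<close>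
  solves an ordinary differential equation in the sense of distributions, and therefore
  classically (\<open>weak_regularity\<close>). Its conjugate \<open>w\<close> satisfies \<open>Q(D) w = \<zeta> w / v\<^sup>2\<close> with \<open>\<zeta> = cnj z\<close> and
  \<open>\<bar>w\<bar> = v \<bar>u\<bar>\<close>. The Lagrange identity expresses \<open>2 \<i> Im \<zeta>\<close> times the integral of \<open>\<bar>u\<bar>\<^sup>2\<close> over an
  interval by a boundary form in derivatives of \<open>w\<close> at the two endpoints. An interior estimate at
  the length scale \<open>h\<close> with \<open>h^K\<close> proportional to \<open>v\<^sup>2\<close> bounds this form at \<open>x\<close> by the integral of \<open>\<bar>u\<bar>\<^sup>2\<close>
  over \<open>{x..x+1}\<close> (\<open>bform_bound\<close>). This tends to zero as \<open>x \<rightarrow> \<plusminus>\<infinity>\<close>, hence \<open>u = 0\<close> (\<open>deficiency_classical\<close>).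
\<close>

section \<open>Functions of class \<open>C\<^sup>k\<close>\<close>

lemma nth_vderiv_0 [simp]: "nth_vderiv 0 f = f"
  by (simp add: nth_vderiv_def)

lemma nth_vderiv_Suc: "nth_vderiv (Suc k) f = (\<lambda>x. vector_derivative (nth_vderiv k f) (at x))"
  by (simp add: nth_vderiv_def)

lemma nth_vderiv_Suc_shift: "nth_vderiv (Suc k) f = nth_vderiv k (\<lambda>x. vector_derivative f (at x))"
  by (simp add: nth_vderiv_def funpow_Suc_right del: funpow.simps)

lemma C_times_0 [simp]: "C_times 0 f \<longleftrightarrow> continuous_on UNIV f"
  by (simp add: C_times_def)

lemma C_times_Suc:
  "C_times (Suc k) f \<longleftrightarrow>
     (\<forall>x. f differentiable (at x)) \<and> C_times k (\<lambda>x. vector_derivative f (at x))"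
proof -
  have "(\<forall>j<Suc k. \<forall>x. nth_vderiv j f differentiable (at x)) \<longleftrightarrow>
        (\<forall>x. nth_vderiv 0 f differentiable (at x)) \<and> (\<forall>j<k. \<forall>x. nth_vderiv (Suc j) f differentiable (at x))"
    by (metis less_Suc_eq_0_disj)
  then show ?thesis
    unfolding C_times_def by (simp add: nth_vderiv_Suc_shift conj_assoc)
qed

lemma C_times_SucI:
  assumes "\<And>x. (f has_vector_derivative f' x) (at x)" "C_times k f'"
  shows "C_times (Suc k) f"
proof -
  have "(\<lambda>x. vector_derivative f (at x)) = f'"
    using assms(1) vector_derivative_at by blast
  with assms show ?thesis
    by (auto simp: C_times_Suc intro: differentiableI_vector)
qed

text \<open>
  Together with \<open>C_times_SucI\<close> this gives the recursive reading of \<open>C_times\<close>: all closure properties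
  below are proved by induction on the order with the product or chain rule for the first
  derivative only, so that no formula for higher derivatives of products or compositions is ever
  written down.
\<close>

lemma C_times_SucE:
  assumes "C_times (Suc k) f"
  obtains f' where "\<And>x. (f has_vector_derivative f' x) (at x)" "C_times k f'"
  using assms by (metis C_times_Suc vector_derivative_works)

lemma C_times_imp_continuous: "C_times k f \<Longrightarrow> continuous_on UNIV f"
  by (cases k) (auto simp: C_times_Suc differentiable_imp_continuous_within
      continuous_at_imp_continuous_on)

lemma C_times_SucD: "C_times (Suc k) f \<Longrightarrow> C_times k f"
proof (induction k arbitrary: f)
  case 0
  then show ?case using C_times_imp_continuous by fastforce
next
  case (Suc k)
  then show ?case by (metis C_times_Suc)
qed

lemma C_times_mono: "C_times k f \<Longrightarrow> j \<le> k \<Longrightarrow> C_times j f"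
  by (induction k) (auto simp: le_Suc_eq dest: C_times_SucD)

lemma C_times_const: "C_times k (\<lambda>x. c)"
proof (induction k arbitrary: c)
  case (Suc k)
  show ?case by (rule C_times_SucI[OF has_vector_derivative_const Suc])
qed simp

lemma C_times_add: "C_times k f \<Longrightarrow> C_times k g \<Longrightarrow> C_times k (\<lambda>x. f x + g x)"
proof (induction k arbitrary: f g)
  case 0
  then show ?case by (auto intro: continuous_intros)
next
  case (Suc k)
  then obtain f' g' where "\<And>x. (f has_vector_derivative f' x) (at x)" "C_times k f'"
    "\<And>x. (g has_vector_derivative g' x) (at x)" "C_times k g'"
    by (metis C_times_SucE)
  with Suc.IH show ?case
    by (intro C_times_SucI[where f'="\<lambda>x. f' x + g' x"]) (auto intro: has_vector_derivative_add)
qed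

lemma C_times_mult:
  fixes f g :: "real \<Rightarrow> 'a::real_normed_algebra"
  shows "C_times k f \<Longrightarrow> C_times k g \<Longrightarrow> C_times k (\<lambda>x. f x * g x)"
proof (induction k arbitrary: f g)
  case 0
  then show ?case by (auto intro: continuous_intros)
next
  case (Suc k)
  then obtain f' g' where *: "\<And>x. (f has_vector_derivative f' x) (at x)" "C_times k f'"
    "\<And>x. (g has_vector_derivative g' x) (at x)" "C_times k g'"
    by (metis C_times_SucE)
  have "C_times k f" "C_times k g" using Suc.prems C_times_SucD by auto
  with * Suc.IH show ?case
    by (intro C_times_SucI[where f'="\<lambda>x. f x * g' x + f' x * g x"])
      (auto intro: has_vector_derivative_mult C_times_add)
qed

lemma C_times_linear:
  assumes "bounded_linear T"
  shows "C_times k f \<Longrightarrow> C_times k (\<lambda>x. T (f x))"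
proof (induction k arbitrary: f)
  case 0
  then show ?case using assms
    by (auto intro: bounded_linear.continuous_on)
next
  case (Suc k)
  then obtain f' where "\<And>x. (f has_vector_derivative f' x) (at x)" "C_times k f'"
    by (metis C_times_SucE)
  with Suc.IH show ?case
    by (intro C_times_SucI[where f'="\<lambda>x. T (f' x)"])
      (simp_all add: bounded_linear.has_vector_derivative[OF assms])
qed

lemma C_times_of_real:
  fixes f :: "real \<Rightarrow> real"
  shows "C_times k f \<Longrightarrow> C_times k (\<lambda>x. complex_of_real (f x))"
  by (rule C_times_linear[OF bounded_linear_of_real])

lemma C_times_inverse:
  fixes f :: "real \<Rightarrow> real"
  assumes "\<And>x. f x \<noteq> 0"
  shows "C_times k f \<Longrightarrow> C_times k (\<lambda>x. inverse (f x))"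
proof (induction k)
  case 0
  then show ?case using assms by (auto intro: continuous_intros)
next
  case (Suc k)
  obtain f' where *: "\<And>x. (f has_vector_derivative f' x) (at x)" "C_times k f'"
    using Suc.prems by (metis C_times_SucE)
  have i: "C_times k (\<lambda>x. inverse (f x))" using Suc C_times_SucD by blast
  show ?case
  proof (intro C_times_SucI[where f'="\<lambda>x. (-1) * (f' x * (inverse (f x) * inverse (f x)))"])
    fix x
    show "((\<lambda>x. inverse (f x)) has_vector_derivative
        - 1 * (f' x * (inverse (f x) * inverse (f x)))) (at x)"
      using *(1)[of x] assms[of x]
      by (auto simp: has_real_derivative_iff_has_vector_derivative[symmetric] power2_eq_square
          intro!: derivative_eq_intros)
    show "C_times k (\<lambda>x. - 1 * (f' x * (inverse (f x) * inverse (f x))))"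
      using i *(2) by (intro C_times_mult C_times_const)
  qed
qed

lemma nth_vderiv_has_vector_derivative:
  assumes "C_times k f" "j < k"
  shows "(nth_vderiv j f has_vector_derivative nth_vderiv (Suc j) f x) (at x)"
  using assms unfolding C_times_def nth_vderiv_Suc
  by (simp add: vector_derivative_works)

lemma C_times_nth_vderiv: "C_times k f \<Longrightarrow> j \<le> k \<Longrightarrow> C_times (k - j) (nth_vderiv j f)"
proof (induction j arbitrary: f k)
  case (Suc j)
  then obtain m where m: "k = Suc m" by (cases k) auto
  with Suc show ?case
    by (simp add: nth_vderiv_Suc_shift C_times_Suc)
qed auto

text \<open>
  The converse of \<open>nth_vderiv_has_vector_derivative\<close>: iterated derivatives are computed by
  exhibiting a candidate for each of them.
\<close>

lemma nth_vderiv_chain: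
  assumes "\<And>j x. j < k \<Longrightarrow> (Y j has_vector_derivative Y (Suc j) x) (at x)"
  shows "j \<le> k \<Longrightarrow> nth_vderiv j (Y 0) = Y j"
proof (induction j)
  case (Suc j)
  then show ?case
    using assms[of j] by (auto simp: nth_vderiv_Suc vector_derivative_at)
qed auto

lemma nth_vderiv_linear:
  assumes "bounded_linear T" "C_times k f" "j \<le> k"
  shows "nth_vderiv j (\<lambda>x. T (f x)) = (\<lambda>x. T (nth_vderiv j f x))"
  using nth_vderiv_chain[of k "\<lambda>j x. T (nth_vderiv j f x)" j] assms
  by (auto intro: bounded_linear.has_vector_derivative nth_vderiv_has_vector_derivative)

lemma nth_vderiv_add:
  assumes "C_times k f" "C_times k g" "j \<le> k"
  shows "nth_vderiv j (\<lambda>x. f x + g x) = (\<lambda>x. nth_vderiv j f x + nth_vderiv j g x)"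
  using nth_vderiv_chain[of k "\<lambda>j x. nth_vderiv j f x + nth_vderiv j g x" j] assms
  by (auto intro: has_vector_derivative_add nth_vderiv_has_vector_derivative)

lemma nth_vderiv_eq_0_open:
  assumes "open U" "\<And>x. x \<in> U \<Longrightarrow> f x = 0"
  shows "x \<in> U \<Longrightarrow> nth_vderiv k f x = 0"
proof (induction k arbitrary: x)
  case (Suc k)
  have "((\<lambda>_. 0) has_vector_derivative 0) (at x)" by simp
  then have "(nth_vderiv k f has_vector_derivative 0) (at x)"
    by (rule has_vector_derivative_transform_within_open[OF _ assms(1)]) (use Suc in auto)
  then show ?case by (simp add: nth_vderiv_Suc vector_derivative_at)
qed (use assms in auto)

text \<open>
  The topological definition of compact support is traded for vanishing outside an interval, the
  form in which it is used.
\<close>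

lemma bounded_support_iff:
  fixes g :: "real \<Rightarrow> 'a::zero"
  shows "compact (closure {x. g x \<noteq> 0}) \<longleftrightarrow> (\<exists>R\<ge>0. \<forall>x. \<bar>x\<bar> > R \<longrightarrow> g x = 0)"
proof
  assume "compact (closure {x. g x \<noteq> 0})"
  then have "bounded {x. g x \<noteq> 0}"
    using compact_imp_bounded bounded_subset closure_subset by blast
  then obtain R where R: "\<And>x. g x \<noteq> 0 \<Longrightarrow> \<bar>x\<bar> \<le> R"
    by (auto simp: bounded_real)
  have "\<forall>x. \<bar>x\<bar> > max R 0 \<longrightarrow> g x = 0" using R by force
  then show "\<exists>R\<ge>0. \<forall>x. \<bar>x\<bar> > R \<longrightarrow> g x = 0" by (meson max.cobounded2)
next
  assume "\<exists>R\<ge>0. \<forall>x. \<bar>x\<bar> > R \<longrightarrow> g x = 0"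
  then obtain R where R: "\<And>x. \<bar>x\<bar> > R \<Longrightarrow> g x = 0" by auto
  have "bounded {x. g x \<noteq> 0}"
    unfolding bounded_real using R by (intro exI[of _ R]) (auto simp: not_less[symmetric])
  then show "compact (closure {x. g x \<noteq> 0})"
    by (simp add: compact_closure)
qed

lemma C0_times_iff: "g \<in> C0_times k \<longleftrightarrow> C_times k g \<and> (\<exists>R\<ge>0. \<forall>x. \<bar>x\<bar> > R \<longrightarrow> g x = 0)"
  unfolding C0_times_def mem_Collect_eq bounded_support_iff ..

lemma nth_vderiv_eq_0_outside:
  assumes "\<And>x. \<bar>x\<bar> > R \<Longrightarrow> f x = 0" "\<bar>x\<bar> > R"
  shows "nth_vderiv k f x = 0"
proof (rule nth_vderiv_eq_0_open[where U="{x. \<bar>x\<bar> > R}"])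
  show "open {x::real. \<bar>x\<bar> > R}"
    by (intro open_Collect_less continuous_intros)
qed (use assms in auto)

lemma poly_D_continuous:
  assumes "C_times (degree Q) f"
  shows "continuous_on UNIV (poly_D Q f)"
proof -
  have "continuous_on UNIV (nth_vderiv k f)" if "k \<le> degree Q" for k
    using C_times_nth_vderiv[OF assms that] C_times_imp_continuous by blast
  then show ?thesis unfolding poly_D_def[abs_def] by (intro continuous_intros) auto
qed

lemma poly_D_eq_0_outside:
  assumes "\<And>x. \<bar>x\<bar> > R \<Longrightarrow> f x = 0" "\<bar>x\<bar> > R"
  shows "poly_D Q f x = 0"
  unfolding poly_D_def using nth_vderiv_eq_0_outside[OF assms] by simp

lemma continuous_support_integrable:
  fixes f :: "real \<Rightarrow> 'a::{banach, second_countable_topology}"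
  assumes "continuous_on UNIV f" "\<And>x. \<bar>x\<bar> > R \<Longrightarrow> f x = 0"
  shows "integrable lborel f"
proof -
  have "integrable lborel (\<lambda>x. indicator {-R..R} x *\<^sub>R f x)"
    by (rule borel_integrable_compact) (auto intro: continuous_on_subset[OF assms(1)])
  moreover have "indicator {-R..R} x *\<^sub>R f x = f x" for x
    using assms(2)[of x] by (auto simp: indicator_def abs_if)
  ultimately show ?thesis by simp
qed

text \<open>
  Powers of the positive part are a source of functions of finite smoothness with half-line
  support. All cutoff functions are built from them, since only finitely many derivatives are ever
  taken.
\<close>

lemma C_times_truncated_power:
  "C_times k (\<lambda>x::real. max 0 x ^ Suc k)"
proof -
  have *: "((\<lambda>x::real. max 0 x ^ Suc (Suc k)) has_vector_derivative real (Suc (Suc k)) * max 0 x ^ Suc k)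
      (at x)"
    for k x
  proof (cases x "0::real" rule: linorder_cases)
    case greater
    have "((\<lambda>x::real. x ^ Suc (Suc k)) has_vector_derivative real (Suc (Suc k)) * max 0 x ^ Suc k) (at x)"
      using greater DERIV_pow[of "Suc (Suc k)" x UNIV]
      by (simp add: has_real_derivative_iff_has_vector_derivative)
    then show ?thesis
      by (rule has_vector_derivative_transform_within_open[where S="{0<..}"]) (use greater in auto)
  next
    case less
    have "((\<lambda>x::real. 0) has_vector_derivative real (Suc (Suc k)) * max 0 x ^ Suc k) (at x)"
      using less by auto
    then show ?thesis
      by (rule has_vector_derivative_transform_within_open[where S="{..<0}"]) (use less in auto)
  next
    case equal
    have "((\<lambda>x::real. max 0 x ^ Suc (Suc k)) has_field_derivative 0) (at 0)"
    proof (unfold DERIV_def, rule Lim_null_comparison)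
      show "\<forall>\<^sub>F h in at 0. norm ((max 0 (0 + h) ^ Suc (Suc k) - max 0 0 ^ Suc (Suc k)) / h :: real) \<le> \<bar>h\<bar> ^
          Suc k"
        by (intro always_eventually allI) (auto simp: max_def power_abs abs_mult mult_nonpos_nonneg)
      show "((\<lambda>h::real. \<bar>h\<bar> ^ Suc k) \<longlongrightarrow> 0) (at 0)"
        by (rule tendsto_eq_intros refl | simp)+
    qed
    then show ?thesis using equal by (simp add: has_real_derivative_iff_has_vector_derivative)
  qed
  show ?thesis
  proof (induction k)
    case 0
    show ?case by (auto intro!: continuous_intros)
  next
    case (Suc k)
    show ?case
      by (rule C_times_SucI[OF *]) (intro C_times_mult C_times_const Suc)
  qed
qed

text \<open>
  With \<open>p t = (max 0 t) ^ (k+1)\<close> the quotient \<open>p t / (p t + p (1 - t))\<close> works: its denominator never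
  vanishes, and outside \<open>{0..1}\<close> it is constant, which also bounds its derivatives.
\<close>

lemma smooth_step:
  obtains S :: "real \<Rightarrow> real" where
    "C_times k S" "\<And>t. t \<le> 0 \<Longrightarrow> S t = 0" "\<And>t. t \<ge> 1 \<Longrightarrow> S t = 1"
    "\<And>j. j \<le> k \<Longrightarrow> bounded (range (nth_vderiv j S))"
proof -
  define p where "p t = max 0 t ^ Suc k" for t :: real
  define S where "S t = p t * inverse (p t + p (1 - t))" for t
  have p: "C_times k p" using C_times_truncated_power unfolding p_def .
  have refl: "C_times j (\<lambda>t. f (1 - t))" if "C_times j f" for j and f :: "real \<Rightarrow> real"
    using that
  proof (induction j arbitrary: f)
    case 0
    then show ?case
      by (auto intro!: continuous_on_compose2[of UNIV f UNIV "\<lambda>t. 1 - t"] continuous_intros)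
  next
    case (Suc j)
    obtain f' where f: "\<And>x. (f has_vector_derivative f' x) (at x)" "C_times j f'"
      using Suc.prems C_times_SucE by blast
    have "((\<lambda>t. f (1 - t)) has_vector_derivative - 1 * f' (1 - t)) (at t)" for t
    proof -
      have "((\<lambda>t. f (1 - t)) has_field_derivative f' (1 - t) * - 1) (at t)"
        by (rule DERIV_chain2) (use f in \<open>auto simp: has_real_derivative_iff_has_vector_derivative intro!:
            derivative_eq_intros\<close>)
      then show ?thesis by (simp add: has_real_derivative_iff_has_vector_derivative)
    qed
    then show ?case by (rule C_times_SucI) (intro C_times_mult C_times_const Suc.IH f)
  qed
  have pos: "p t + p (1 - t) > 0" for t
  proof -
    have "p s \<ge> 0" for s by (simp add: p_def)
    moreover have "p s > 0" if "s > 0" for s using that by (simp add: p_def)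
    ultimately show ?thesis
      by (cases "t > 0") (auto intro: add_pos_nonneg add_nonneg_pos)
  qed
  have S: "C_times k S"
    unfolding S_def using pos by (intro C_times_mult C_times_inverse C_times_add p refl) (auto simp:
        less_imp_neq[symmetric])
  have S0: "S t = 0" if "t \<le> 0" for t using that by (simp add: S_def p_def)
  have S1: "S t = 1" if "t \<ge> 1" for t
  proof -
    have "p (1 - t) = 0" using that by (simp add: p_def)
    then show ?thesis using pos[of t] by (simp add: S_def)
  qed
  have "bounded (range (nth_vderiv j S))" if "j \<le> k" for j
  proof -
    have cont: "continuous_on UNIV (nth_vderiv j S)"
      using C_times_nth_vderiv[OF S that] C_times_imp_continuous by blast
    have "bounded (nth_vderiv j S ` {0..1})"
      by (intro compact_imp_bounded compact_continuous_image continuous_on_subset[OF cont]) auto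
    moreover have "nth_vderiv j S x \<in> {0, 1}" if "x \<notin> {0..1}" for x
    proof (cases j)
      case 0
      then show ?thesis using that S0[of x] S1[of x] by (cases "x < 0") auto
    next
      case (Suc i)
      have "vector_derivative S (at x) = 0" if "x \<in> {..<0} \<union> {1<..}" for x
      proof (cases "x < 0")
        case True
        have "((\<lambda>_. 0) has_vector_derivative 0) (at x)" by simp
        then have "(S has_vector_derivative 0) (at x)"
          by (rule has_vector_derivative_transform_within_open[where S="{..<0}"]) (use True S0 in auto)
        then show ?thesis by (rule vector_derivative_at)
      next
        case False
        have "((\<lambda>_. 1) has_vector_derivative 0) (at x)" by simp
        then have "(S has_vector_derivative 0) (at x)"
          by (rule has_vector_derivative_transform_within_open[where S="{1<..}"]) (use False that S1 in auto)
        then show ?thesis by (rule vector_derivative_at)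
      qed
      then have "nth_vderiv j S x = 0"
        unfolding Suc nth_vderiv_Suc_shift using that
        by (intro nth_vderiv_eq_0_open[where U="{..<0} \<union> {1<..}"]) auto
      then show ?thesis by simp
    qed
    then have "range (nth_vderiv j S) \<subseteq> nth_vderiv j S ` {0..1} \<union> {0, 1}" by blast
    moreover have "bounded {0, 1::real}" by simp
    ultimately show ?thesis by (meson bounded_Un bounded_subset)
  qed
  with that S S0 S1 show thesis by blast
qed

section \<open>The Hilbert space \<open>L\<^sup>2(\<real>)\<close>\<close>

lemma L2_measurable [measurable_dest]: "f \<in> L2 \<Longrightarrow> f \<in> borel_measurable borel"
  by (simp add: L2_def)

lemma L2_integrable: "f \<in> L2 \<Longrightarrow> integrable lborel (\<lambda>x. (cmod (f x))\<^sup>2)"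
  by (simp add: L2_def)

lemma L2I:
  assumes "f \<in> borel_measurable borel" "integrable lborel h" "\<And>x. (cmod (f x))\<^sup>2 \<le> h x"
  shows "f \<in> L2"
  unfolding L2_def
proof (intro CollectI conjI)
  show "f \<in> borel_measurable lborel" using assms by simp
  show "integrable lborel (\<lambda>x. (cmod (f x))\<^sup>2)"
    using assms(2)
  proof (rule Bochner_Integration.integrable_bound)
    show "AE x in lborel. norm ((cmod (f x))\<^sup>2) \<le> norm (h x)"
      using assms(3) by (auto intro!: AE_I2 order_trans[OF _ abs_ge_self])
  qed (use assms in measurable)
qed

lemma L2_scale: "f \<in> L2 \<Longrightarrow> (\<lambda>x. c * f x) \<in> L2"
  by (rule L2I[where h="\<lambda>x. (cmod c)\<^sup>2 * (cmod (f x))\<^sup>2"])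
    (auto simp: L2_integrable norm_mult power_mult_distrib intro: borel_measurable_times L2_measurable)

lemma cmod_add_sq: "(cmod (a + b))\<^sup>2 \<le> 2 * (cmod a)\<^sup>2 + 2 * (cmod b)\<^sup>2"
proof -
  have "(cmod (a + b))\<^sup>2 \<le> (cmod a + cmod b)\<^sup>2"
    by (intro power_mono norm_triangle_ineq) auto
  also have "\<dots> \<le> 2 * (cmod a)\<^sup>2 + 2 * (cmod b)\<^sup>2"
    using sum_squares_bound[of "cmod a" "cmod b"] by (simp add: power2_sum)
  finally show ?thesis .
qed

lemma L2_add: "f \<in> L2 \<Longrightarrow> g \<in> L2 \<Longrightarrow> (\<lambda>x. f x + g x) \<in> L2"
  by (rule L2I[where h="\<lambda>x. 2 * (cmod (f x))\<^sup>2 + 2 * (cmod (g x))\<^sup>2"])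
    (auto simp: L2_integrable cmod_add_sq intro: borel_measurable_add L2_measurable)

lemma L2_diff: "f \<in> L2 \<Longrightarrow> g \<in> L2 \<Longrightarrow> (\<lambda>x. f x - g x) \<in> L2"
  using L2_add[OF _ L2_scale[of g "-1"]] by simp

lemma continuous_support_L2:
  fixes f :: "real \<Rightarrow> complex"
  assumes "continuous_on UNIV f" "\<And>x. \<bar>x\<bar> > R \<Longrightarrow> f x = 0"
  shows "f \<in> L2"
  unfolding L2_def
proof (intro CollectI conjI)
  show "f \<in> borel_measurable lborel"
    using borel_measurable_continuous_onI[OF assms(1)] by simp
  show "integrable lborel (\<lambda>x. (cmod (f x))\<^sup>2)"
    by (rule continuous_support_integrable[where R=R]) (use assms in \<open>auto intro!: continuous_intros\<close>)
qed

lemma L2norm_nonneg [simp]: "0 \<le> L2norm f"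
  by (simp add: L2norm_def)

lemma L2norm_sq: "(L2norm f)\<^sup>2 = (LBINT x. (cmod (f x))\<^sup>2)"
  by (simp add: L2norm_def)

lemma L2norm_scale: "L2norm (\<lambda>x. c * f x) = cmod c * L2norm f"
  by (simp add: L2norm_def norm_mult power_mult_distrib real_sqrt_mult)

lemma L2norm_minus_commute: "L2norm (\<lambda>x. f x - g x) = L2norm (\<lambda>x. g x - f x)"
  by (simp add: L2norm_def norm_minus_commute)

lemma L2norm_cong_AE:
  assumes "AE x in lborel. f x = g x" "f \<in> borel_measurable lborel" "g \<in> borel_measurable lborel"
  shows "L2norm f = L2norm g"
  unfolding L2norm_def using assms by (intro arg_cong[where f=sqrt] integral_cong_AE) auto

lemma L2norm_eq_0_iff:
  assumes "f \<in> L2"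
  shows "L2norm f = 0 \<longleftrightarrow> (AE x in lborel. f x = 0)"
  using integral_nonneg_eq_0_iff_AE[OF L2_integrable[OF assms]] by (simp add: L2norm_def)

text \<open>
  Linear in the first argument. It is defined on all functions; outside \<open>L2\<close> the value is that of a
  possibly divergent integral and carries no information.
\<close>

definition L2ip :: "(real \<Rightarrow> complex) \<Rightarrow> (real \<Rightarrow> complex) \<Rightarrow> complex" where
  "L2ip f g = (LBINT x. f x * cnj (g x))"

lemma L2ip_integrable:
  assumes "f \<in> L2" "g \<in> L2"
  shows "integrable lborel (\<lambda>x. f x * cnj (g x))"
proof (rule Bochner_Integration.integrable_bound)
  show "integrable lborel (\<lambda>x. (cmod (f x))\<^sup>2 + (cmod (g x))\<^sup>2)"
    using assms by (simp add: L2_integrable)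
  show "(\<lambda>x. f x * cnj (g x)) \<in> borel_measurable lborel"
    using assms[THEN L2_measurable]
    by (intro borel_measurable_times borel_measurable_continuous_on[OF continuous_on_cnj[OF
        continuous_on_id]]) auto
  have "norm (f x * cnj (g x)) \<le> norm ((cmod (f x))\<^sup>2 + (cmod (g x))\<^sup>2)" for x
  proof -
    have "0 \<le> cmod (f x) * cmod (g x)" by simp
    then have "cmod (f x) * cmod (g x) \<le> (cmod (f x))\<^sup>2 + (cmod (g x))\<^sup>2"
      using sum_squares_bound[of "cmod (f x)" "cmod (g x)"] by linarith
    then show ?thesis by (simp add: norm_mult)
  qed
  then show "AE x in lborel. norm (f x * cnj (g x)) \<le> norm ((cmod (f x))\<^sup>2 + (cmod (g x))\<^sup>2)"
    by simp
qed

lemma L2ip_self: "L2ip f f = of_real ((L2norm f)\<^sup>2)"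
  unfolding L2ip_def L2norm_sq complex_norm_square[symmetric] by (rule integral_complex_of_real)

lemma L2ip_add_left:
  "f \<in> L2 \<Longrightarrow> g \<in> L2 \<Longrightarrow> h \<in> L2 \<Longrightarrow> L2ip (\<lambda>x. f x + g x) h = L2ip f h + L2ip g h"
  unfolding L2ip_def by (simp add: distrib_right L2ip_integrable)

lemma L2ip_scale_left: "L2ip (\<lambda>x. c * f x) h = c * L2ip f h"
  unfolding L2ip_def by (simp add: mult.assoc)

lemma L2ip_cnj: "L2ip f g = cnj (L2ip g f)"
proof -
  have "cnj (L2ip g f) = (LBINT x. cnj (g x * cnj (f x)))"
    unfolding L2ip_def by (rule Bochner_Integration.integral_cnj[symmetric])
  then show ?thesis unfolding L2ip_def by (simp add: mult.commute)
qed

lemma L2norm_add_sq: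
  assumes "f \<in> L2" "g \<in> L2"
  shows "(L2norm (\<lambda>x. f x + g x))\<^sup>2 = (L2norm f)\<^sup>2 + 2 * Re (L2ip f g) + (L2norm g)\<^sup>2"
proof -
  have "(LBINT x. (cmod (f x + g x))\<^sup>2) =
      (LBINT x. (cmod (f x))\<^sup>2 + 2 * Re (f x * cnj (g x)) + (cmod (g x))\<^sup>2)"
    unfolding cmod_power2
    by (intro Bochner_Integration.integral_cong refl) (simp add: power2_eq_square algebra_simps)
  also have "\<dots> = (LBINT x. (cmod (f x))\<^sup>2) + 2 * (LBINT x. Re (f x * cnj (g x))) + (LBINT x. (cmod (g x))\<^sup>2)"
    using assms[THEN L2_integrable] integrable_Re[OF L2ip_integrable[OF assms]]
    by (simp del: times_complex.sel)
  finally show ?thesis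
    unfolding L2norm_sq L2ip_def integral_Re[OF L2ip_integrable[OF assms]] .
qed

text \<open>
  After rotating \<open>f\<close> by the phase of the inner product, \<open>\<parallel>t f + g\<parallel>\<^sup>2\<close> is a nonnegative real quadratic
  polynomial in \<open>t\<close> with linear coefficient \<open>2 \<bar>\<langle>f, g\<rangle>\<bar>\<close>; it is evaluated at its minimum.
\<close>

lemma L2_Cauchy_Schwarz:
  assumes "f \<in> L2" "g \<in> L2"
  shows "cmod (L2ip f g) \<le> L2norm f * L2norm g"
proof (cases "L2ip f g = 0")
  case False
  define s where "s = sgn (L2ip f g)"
  have s: "cmod s = 1" "cnj s * L2ip f g = of_real (cmod (L2ip f g))"
  proof -
    show "cmod s = 1" using False by (simp add: s_def norm_sgn)
    show "cnj s * L2ip f g = of_real (cmod (L2ip f g))"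
      using False complex_norm_square[of "L2ip f g"]
      by (simp add: s_def sgn_div_norm scaleR_conv_of_real power2_eq_square field_simps)
  qed
  have q: "0 \<le> (L2norm f)\<^sup>2 * t\<^sup>2 + 2 * cmod (L2ip f g) * t + (L2norm g)\<^sup>2" for t :: real
  proof -
    have "(L2norm (\<lambda>x. of_real t * cnj s * f x + g x))\<^sup>2 =
        (\<bar>t\<bar> * L2norm f)\<^sup>2 + 2 * Re (of_real t * (cnj s * L2ip f g)) + (L2norm g)\<^sup>2"
      using assms by (simp add: L2norm_add_sq L2_scale L2norm_scale L2ip_scale_left norm_mult s mult.assoc)
    then show ?thesis unfolding s(2)
      using zero_le_power2[of "L2norm (\<lambda>x. of_real t * cnj s * f x + g x)"]
      by (simp add: power_mult_distrib algebra_simps)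
  qed
  have "(cmod (L2ip f g))\<^sup>2 \<le> (L2norm f * L2norm g)\<^sup>2"
  proof (cases "L2norm f = 0")
    case True
    have "0 < cmod (L2ip f g)" using False by simp
    moreover have "0 \<le> 2 * cmod (L2ip f g) * (- ((L2norm g)\<^sup>2 + 1) / (2 * cmod (L2ip f g))) + (L2norm g)\<^sup>2"
      using q[of "- ((L2norm g)\<^sup>2 + 1) / (2 * cmod (L2ip f g))"] True by simp
    ultimately show ?thesis by simp
  next
    case fpos: False
    define n where "n = (L2norm f)\<^sup>2"
    have n: "n > 0" using fpos by (simp add: n_def)
    have "0 \<le> n * (- cmod (L2ip f g) / n)\<^sup>2 + 2 * cmod (L2ip f g) * (- cmod (L2ip f g) / n) + (L2norm g)\<^sup>2"
      using q[of "- cmod (L2ip f g) / n"] by (simp add: n_def)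
    also have "\<dots> = (L2norm g)\<^sup>2 - (cmod (L2ip f g))\<^sup>2 / n"
      using n by (simp add: field_simps power2_eq_square)
    finally show ?thesis using n by (simp add: power_mult_distrib n_def[symmetric] field_simps)
  qed
  then show ?thesis by (rule power2_le_imp_le) simp
qed simp

lemma L2norm_triangle:
  assumes "f \<in> L2" "g \<in> L2"
  shows "L2norm (\<lambda>x. f x + g x) \<le> L2norm f + L2norm g"
proof (rule power2_le_imp_le)
  have "Re (L2ip f g) \<le> L2norm f * L2norm g"
    using L2_Cauchy_Schwarz[OF assms] complex_Re_le_cmod order_trans by blast
  then show "(L2norm (\<lambda>x. f x + g x))\<^sup>2 \<le> (L2norm f + L2norm g)\<^sup>2"
    by (simp add: L2norm_add_sq[OF assms] power2_sum)
qed simp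

lemma L2norm_diff_triangle:
  assumes "f \<in> L2" "g \<in> L2" "h \<in> L2"
  shows "L2norm (\<lambda>x. f x - h x) \<le> L2norm (\<lambda>x. f x - g x) + L2norm (\<lambda>x. g x - h x)"
  using L2norm_triangle[OF L2_diff[OF assms(1,2)] L2_diff[OF assms(2,3)]] by simp

lemma L2norm_parallelogram:
  assumes "f \<in> L2" "g \<in> L2"
  shows "(L2norm (\<lambda>x. f x + g x))\<^sup>2 + (L2norm (\<lambda>x. f x - g x))\<^sup>2 = 2 * (L2norm f)\<^sup>2 + 2 * (L2norm g)\<^sup>2"
proof -
  have "Re (L2ip f (\<lambda>x. - 1 * g x)) = - Re (L2ip f g)"
    by (subst L2ip_cnj, subst L2ip_scale_left, subst (2) L2ip_cnj) simp
  then show ?thesis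
    using L2norm_add_sq[OF assms] L2norm_add_sq[OF assms(1) L2_scale[OF assms(2), of "-1"]]
      L2norm_scale[of "-1" g] by simp
qed

lemma L2_lim_const: "f \<in> L2 \<Longrightarrow> L2_lim (\<lambda>n. f) f"
  by (simp add: L2_lim_def L2norm_def)

lemma L2_lim_add:
  assumes "L2_lim f f'" "L2_lim g g'"
  shows "L2_lim (\<lambda>n x. f n x + g n x) (\<lambda>x. f' x + g' x)"
  unfolding L2_lim_def
proof (intro conjI allI)
  have L: "f n \<in> L2" "g n \<in> L2" "f' \<in> L2" "g' \<in> L2" for n
    using assms by (auto simp: L2_lim_def)
  then show "(\<lambda>x. f n x + g n x) \<in> L2" "(\<lambda>x. f' x + g' x) \<in> L2" for n
    by (auto intro: L2_add)
  have le: "L2norm (\<lambda>x. f n x + g n x - (f' x + g' x))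
      \<le> L2norm (\<lambda>x. f n x - f' x) + L2norm (\<lambda>x. g n x - g' x)" for n
    using L2norm_triangle[OF L2_diff[OF L(1,3)] L2_diff[OF L(2,4)], of n n]
    by (simp add: algebra_simps)
  show "(\<lambda>n. L2norm (\<lambda>x. f n x + g n x - (f' x + g' x))) \<longlonglongrightarrow> 0"
  proof (rule tendsto_sandwich[OF _ _ tendsto_const])
    show "(\<lambda>n. L2norm (\<lambda>x. f n x - f' x) + L2norm (\<lambda>x. g n x - g' x)) \<longlonglongrightarrow> 0"
      using assms by (auto intro!: tendsto_eq_intros simp: L2_lim_def)
  qed (use le in auto)
qed

lemma L2_lim_scale:
  assumes "L2_lim f f'"
  shows "L2_lim (\<lambda>n x. c * f n x) (\<lambda>x. c * f' x)"
proof -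
  have "L2norm (\<lambda>x. c * f n x - c * f' x) = cmod c * L2norm (\<lambda>x. f n x - f' x)" for n
    by (simp add: L2norm_scale[symmetric] right_diff_distrib)
  then show ?thesis using assms
    by (auto simp: L2_lim_def intro: L2_scale tendsto_mult_right_zero)
qed

lemma L2_lim_diff:
  assumes "L2_lim f f'" "L2_lim g g'"
  shows "L2_lim (\<lambda>n x. f n x - g n x) (\<lambda>x. f' x - g' x)"
  using L2_lim_add[OF assms(1) L2_lim_scale[OF assms(2), of "-1"]] by simp

lemma L2_lim_norm:
  assumes "L2_lim f g"
  shows "(\<lambda>n. L2norm (f n)) \<longlonglongrightarrow> L2norm g"
proof (rule LIMSEQ_I)
  fix r :: real assume "0 < r"
  have L: "f n \<in> L2" "g \<in> L2" for n
    using assms by (auto simp: L2_lim_def)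
  obtain N where N: "\<And>n. n \<ge> N \<Longrightarrow> L2norm (\<lambda>x. f n x - g x) < r"
    using assms \<open>0 < r\<close> LIMSEQ_D[of "\<lambda>n. L2norm (\<lambda>x. f n x - g x)" 0 r]
    unfolding L2_lim_def by auto
  have "norm (L2norm (f n) - L2norm g) \<le> L2norm (\<lambda>x. f n x - g x)" for n
    using L2norm_triangle[OF L(2) L2_diff[OF L], of n] L2norm_triangle[OF L(1) L2_diff[OF L(2,1)], of n n]
      L2norm_minus_commute[of g "f n"] by (auto simp: abs_le_iff)
  then show "\<exists>no. \<forall>n\<ge>no. norm (L2norm (f n) - L2norm g) < r"
    using N order_le_less_trans by blast
qed

text \<open>
  Riesz and Fischer. Along a rapidly Cauchy subsequence the increments \<open>d k\<close> satisfy
  \<open>\<Sum> 2^k \<parallel>d k\<parallel>\<^sup>2 < \<infinity>\<close>, so \<open>\<Sum> 2^k (d k x)\<^sup>2\<close> is finite for almost every \<open>x\<close>; by \<open>d k \<le> 2^-k + 2^k (d k)\<^sup>2\<close> the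
  subsequence then converges at \<open>x\<close>. Fatou's lemma turns this pointwise limit into a limit of the
  whole sequence in norm.
\<close>

lemma L2_complete:
  assumes L2: "\<And>n. f n \<in> L2"
    and Cauchy: "\<And>e. e > 0 \<Longrightarrow> \<exists>N. \<forall>m\<ge>N. \<forall>n\<ge>N. L2norm (\<lambda>x. f m x - f n x) < e"
  obtains g where "L2_lim f g"
proof -
  have meas[measurable]: "f n \<in> borel_measurable borel" for n
    using L2[of n] by (simp add: L2_def)
  obtain N where N: "\<And>k m n. m \<ge> N k \<Longrightarrow> n \<ge> N k \<Longrightarrow> L2norm (\<lambda>x. f m x - f n x) < (1/2)^k"
    using Cauchy[of "(1/2)^k" for k] by (metis zero_less_divide_1_iff zero_less_numeral zero_less_power)
  \<comment> \<open>The sum makes \<open>r k\<close> at least as large as all of \<open>N 0, ..., N k\<close>, and the summand \<open>k\<close> makes it unbounded.\<close>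
  define r where "r k = (\<Sum>i\<le>k. N i) + k" for k
  have rN: "r k \<ge> N k" "r (Suc k) \<ge> N k" "r k \<ge> k" for k
  proof -
    have *: "N k \<le> (\<Sum>i\<le>k. N i)" by (rule member_le_sum) auto
    then show "r k \<ge> N k" "r (Suc k) \<ge> N k" "r k \<ge> k" by (auto simp: r_def)
  qed
  define d where "d k x = cmod (f (r (Suc k)) x - f (r k) x)" for k x
  have [measurable]: "d k \<in> borel_measurable borel" for k unfolding d_def by measurable
  have nn: "(\<integral>\<^sup>+x. ennreal ((cmod (h x))\<^sup>2) \<partial>lborel) = ennreal ((L2norm h)\<^sup>2)" if "h \<in> L2" for h
    unfolding L2norm_sq by (rule nn_integral_eq_integral) (use that in \<open>auto simp: L2_integrable\<close>)
  have d2: "(\<integral>\<^sup>+x. ennreal (2^k * (d k x)\<^sup>2) \<partial>lborel) \<le> ennreal ((1/2)^k)" for k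
  proof -
    have "L2norm (\<lambda>x. f (r (Suc k)) x - f (r k) x) \<le> (1/2)^k"
      using N[OF rN(2,1)] less_imp_le by blast
    then have "(L2norm (\<lambda>x. f (r (Suc k)) x - f (r k) x))\<^sup>2 \<le> ((1/2)^k)\<^sup>2"
      by (intro power_mono) auto
    then have *: "2^k * (L2norm (\<lambda>x. f (r (Suc k)) x - f (r k) x))\<^sup>2 \<le> (1/2)^k"
      by (simp add: power2_eq_square field_simps)
    have "(\<integral>\<^sup>+x. ennreal (2^k * (d k x)\<^sup>2) \<partial>lborel) = ennreal (2^k) * (\<integral>\<^sup>+x. ennreal ((d k x)\<^sup>2) \<partial>lborel)"
      by (subst nn_integral_cmult[symmetric]) (auto simp: ennreal_mult)
    also have "\<dots> = ennreal (2^k * (L2norm (\<lambda>x. f (r (Suc k)) x - f (r k) x))\<^sup>2)"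
      unfolding d_def by (subst nn[OF L2_diff[OF L2 L2]]) (simp add: ennreal_mult)
    finally show ?thesis using * by (simp add: ennreal_leI)
  qed
  have "(\<integral>\<^sup>+x. (\<Sum>k. ennreal (2^k * (d k x)\<^sup>2)) \<partial>lborel) = (\<Sum>k. \<integral>\<^sup>+x. ennreal (2^k * (d k x)\<^sup>2) \<partial>lborel)"
    by (rule nn_integral_suminf) auto
  also have "\<dots> \<le> (\<Sum>k. ennreal ((1/2)^k))"
    by (intro suminf_le d2) auto
  also have "\<dots> = ennreal (\<Sum>k. (1/2)^k)"
    by (rule suminf_ennreal2) (auto intro: summable_geometric)
  finally have "(\<integral>\<^sup>+x. (\<Sum>k. ennreal (2^k * (d k x)\<^sup>2)) \<partial>lborel) \<noteq> \<infinity>"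
    by (auto simp: top_unique)
  then have "AE x in lborel. (\<Sum>k. ennreal (2^k * (d k x)\<^sup>2)) \<noteq> \<infinity>"
    by (intro nn_integral_PInf_AE) auto
  then have conv: "AE x in lborel. convergent (\<lambda>k. f (r k) x)"
  proof eventually_elim
    case (elim x)
    then have "summable (\<lambda>k. 2^k * (d k x)\<^sup>2)"
      by (intro summable_suminf_not_top) (auto simp: d_def)
    then have S: "summable (\<lambda>k. (1/2)^k + 2^k * (d k x)\<^sup>2)"
      by (intro summable_add) (auto intro: summable_geometric)
    have "summable (\<lambda>k. f (r (Suc k)) x - f (r k) x)"
    proof (rule summable_comparison_test'[OF S, where N=0])
      fix k
      have "0 \<le> (1 - 2^k * d k x)\<^sup>2 * (1/2)^k" by (intro mult_nonneg_nonneg) auto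
      also have "\<dots> = (1/2)^k - 2 * d k x + 2^k * (d k x)\<^sup>2"
        by (simp add: power2_eq_square field_simps)
      moreover have "d k x \<ge> 0" by (simp add: d_def)
      ultimately have "d k x \<le> (1/2)^k + 2^k * (d k x)\<^sup>2" by linarith
      then show "norm (f (r (Suc k)) x - f (r k) x) \<le> (1/2)^k + 2^k * (d k x)\<^sup>2"
        by (simp add: d_def)
    qed
    then have "convergent (\<lambda>n. \<Sum>k<n. f (r (Suc k)) x - f (r k) x)"
      by (simp add: summable_iff_convergent)
    then have "convergent (\<lambda>n. f (r n) x - f (r 0) x)"
      by (simp add: sum_lessThan_telescope[of "\<lambda>k. f (r k) x"])
    then show ?case using convergent_add[OF _ convergent_const[of "f (r 0) x"]] by fastforce
  qed
  define g where "g x = lim (\<lambda>k. f (r k) x)" for x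
  have [measurable]: "g \<in> borel_measurable borel"
    unfolding g_def by measurable
  have fatou: "(\<integral>\<^sup>+x. ennreal ((cmod (f m x - g x))\<^sup>2) \<partial>lborel) \<le> ennreal (e\<^sup>2)"
    if M: "\<And>n. n \<ge> M \<Longrightarrow> L2norm (\<lambda>x. f m x - f n x) < e" for m M e
  proof -
    have "(\<integral>\<^sup>+x. ennreal ((cmod (f m x - g x))\<^sup>2) \<partial>lborel) =
        (\<integral>\<^sup>+x. liminf (\<lambda>k. ennreal ((cmod (f m x - f (r k) x))\<^sup>2)) \<partial>lborel)"
    proof (rule nn_integral_cong_AE)
      show "AE x in lborel. ennreal ((cmod (f m x - g x))\<^sup>2) = liminf (\<lambda>k. ennreal ((cmod (f m x - f (r k)
          x))\<^sup>2))"
        using conv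
      proof eventually_elim
        case (elim x)
        then have "(\<lambda>k. f (r k) x) \<longlonglongrightarrow> g x"
          unfolding g_def by (simp add: convergent_LIMSEQ_iff)
        then have "(\<lambda>k. ennreal ((cmod (f m x - f (r k) x))\<^sup>2)) \<longlonglongrightarrow> ennreal ((cmod (f m x - g x))\<^sup>2)"
          by (intro tendsto_intros)
        then show ?case by (rule lim_imp_Liminf[OF trivial_limit_sequentially, symmetric])
      qed
    qed
    also have "\<dots> \<le> liminf (\<lambda>k. \<integral>\<^sup>+x. ennreal ((cmod (f m x - f (r k) x))\<^sup>2) \<partial>lborel)"
      by (rule nn_integral_liminf) auto
    also have "\<dots> \<le> ennreal (e\<^sup>2)"
    proof -
      have "\<forall>\<^sub>F k in sequentially. (\<integral>\<^sup>+x. ennreal ((cmod (f m x - f (r k) x))\<^sup>2) \<partial>lborel) \<le> ennreal (e\<^sup>2)"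
        using eventually_ge_at_top[of M]
      proof eventually_elim
        case (elim k)
        then have "L2norm (\<lambda>x. f m x - f (r k) x) < e" using M rN(3)[of k] by simp
        then have "(L2norm (\<lambda>x. f m x - f (r k) x))\<^sup>2 \<le> e\<^sup>2" by (intro power_mono) auto
        then show ?case by (subst nn[OF L2_diff[OF L2 L2]]) (simp add: ennreal_leI)
      qed
      then have "liminf (\<lambda>k. \<integral>\<^sup>+x. ennreal ((cmod (f m x - f (r k) x))\<^sup>2) \<partial>lborel) \<le> liminf (\<lambda>k::nat.
          ennreal (e\<^sup>2))"
        by (rule Liminf_mono)
      then show ?thesis by (simp add: Liminf_const)
    qed
    finally show ?thesis .
  qed
  have fg: "(\<lambda>x. f m x - g x) \<in> L2"
    if M: "\<And>n. n \<ge> M \<Longrightarrow> L2norm (\<lambda>x. f m x - f n x) < e" for m M e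
    unfolding L2_def
  proof (intro CollectI conjI integrableI_nonneg)
    show "(\<integral>\<^sup>+x. ennreal ((cmod (f m x - g x))\<^sup>2) \<partial>lborel) < \<infinity>"
      using fatou[OF M] order_le_less_trans by fastforce
  qed auto
  have g: "g \<in> L2"
  proof -
    obtain M where M: "\<And>m n. m \<ge> M \<Longrightarrow> n \<ge> M \<Longrightarrow> L2norm (\<lambda>x. f m x - f n x) < 1"
      using Cauchy[of 1] by auto
    have "(\<lambda>x. f M x - (f M x - g x)) \<in> L2"
      by (intro L2_diff[OF L2 fg[of M M 1]] M) auto
    then show ?thesis by simp
  qed
  have "(\<lambda>m. L2norm (\<lambda>x. f m x - g x)) \<longlonglongrightarrow> 0"
  proof (rule LIMSEQ_I)
    fix e :: real assume e: "e > 0"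
    obtain M where M: "\<And>m n. m \<ge> M \<Longrightarrow> n \<ge> M \<Longrightarrow> L2norm (\<lambda>x. f m x - f n x) < e/2"
      using Cauchy[of "e/2"] e by auto
    have le: "L2norm (\<lambda>x. f m x - g x) \<le> e/2" if "m \<ge> M" for m
    proof (rule power2_le_imp_le)
      have "ennreal ((L2norm (\<lambda>x. f m x - g x))\<^sup>2) \<le> ennreal ((e/2)\<^sup>2)"
        using fatou[of M m "e/2"] M that nn[OF L2_diff[OF L2 g], of m] by simp
      then show "(L2norm (\<lambda>x. f m x - g x))\<^sup>2 \<le> (e/2)\<^sup>2"
        by (subst (asm) ennreal_le_iff) auto
    qed (use e in simp)
    have "norm (L2norm (\<lambda>x. f n x - g x) - 0) < e" if "n \<ge> M" for n
      using le[OF that] e by simp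
    then show "\<exists>no. \<forall>n\<ge>no. norm (L2norm (\<lambda>x. f n x - g x) - 0) < e" by blast
  qed
  then show thesis using that L2 g by (auto simp: L2_lim_def)
qed

text \<open>
  The projection theorem in the form of a density criterion. A minimizing sequence for the
  distance from \<open>f\<close> to \<open>R\<close> is Cauchy by the parallelogram law, and the difference of \<open>f\<close> and its limit
  is orthogonal to \<open>R\<close>, hence zero.
\<close>

lemma L2_dense_subspace:
  assumes sub: "R \<subseteq> L2" and zero: "(\<lambda>x. 0) \<in> R"
    and add: "\<And>f g. f \<in> R \<Longrightarrow> g \<in> R \<Longrightarrow> (\<lambda>x. f x + g x) \<in> R"
    and scale: "\<And>c f. f \<in> R \<Longrightarrow> (\<lambda>x. c * f x) \<in> R"
    and orth: "\<And>u. u \<in> L2 \<Longrightarrow> (\<And>f. f \<in> R \<Longrightarrow> L2ip f u = 0) \<Longrightarrow> AE x in lborel. u x = 0"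
    and f: "f \<in> L2"
  obtains rs where "\<And>n. rs n \<in> R" "L2_lim rs f"
proof -
  define m where "m = (INF r\<in>R. (L2norm (\<lambda>x. f x - r x))\<^sup>2)"
  have bdd: "bdd_below ((\<lambda>r. (L2norm (\<lambda>x. f x - r x))\<^sup>2) ` R)"
    by (auto intro!: bdd_belowI[of _ 0])
  have mle: "m \<le> (L2norm (\<lambda>x. f x - r x))\<^sup>2" if "r \<in> R" for r
    unfolding m_def using bdd that by (rule cINF_lower)
  have "\<exists>r\<in>R. (L2norm (\<lambda>x. f x - r x))\<^sup>2 < m + 1 / Suc n" for n
  proof -
    have "\<exists>y\<in>(\<lambda>r. (L2norm (\<lambda>x. f x - r x))\<^sup>2) ` R. y < m + 1 / Suc n"
      using zero by (intro cInf_lessD) (auto simp: m_def)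
    then show ?thesis by auto
  qed
  then obtain rs where rs: "\<And>n. rs n \<in> R" "\<And>n. (L2norm (\<lambda>x. f x - rs n x))\<^sup>2 < m + 1 / Suc n"
    by metis
  have L: "rs n \<in> L2" for n using rs sub by auto
  \<comment> \<open>Parallelogram law for \<open>f - rs k\<close> and \<open>f - rs n\<close>; the midpoint of \<open>rs k\<close> and \<open>rs n\<close> lies in \<open>R\<close>.\<close>
  have close: "(L2norm (\<lambda>x. rs k x - rs n x))\<^sup>2 \<le> 2 * (1 / Suc k) + 2 * (1 / Suc n)" for k n
  proof -
    have "(\<lambda>x. 1/2 * (rs k x + rs n x)) \<in> R" by (intro scale add rs)
    from mle[OF this] have "4 * m \<le> 4 * (L2norm (\<lambda>x. f x - 1/2 * (rs k x + rs n x)))\<^sup>2" by simp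
    also have "\<dots> = (L2norm (\<lambda>x. 2 * (f x - 1/2 * (rs k x + rs n x))))\<^sup>2"
      by (subst L2norm_scale) (simp add: power_mult_distrib)
    also have "(\<lambda>x. 2 * (f x - 1/2 * (rs k x + rs n x))) = (\<lambda>x. (f x - rs k x) + (f x - rs n x))"
      by (simp add: algebra_simps)
    finally have 1: "4 * m \<le> (L2norm (\<lambda>x. (f x - rs k x) + (f x - rs n x)))\<^sup>2" .
    have "L2norm (\<lambda>x. rs k x - rs n x) = L2norm (\<lambda>x. (f x - rs k x) - (f x - rs n x))"
      by (subst L2norm_minus_commute) simp
    then show ?thesis
      using 1 L2norm_parallelogram[OF L2_diff[OF f L] L2_diff[OF f L], of k n] rs(2)[of k] rs(2)[of n]
      by (simp only: divide_inverse mult_1)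
  qed
  obtain g where g: "L2_lim rs g"
  proof (rule L2_complete[of rs])
    fix e :: real assume e: "e > 0"
    obtain N where N: "1 / real (Suc N) < e\<^sup>2 / 4"
      using e nat_approx_posE[of "e\<^sup>2/4"] by auto
    have "L2norm (\<lambda>x. rs k x - rs n x) < e" if "k \<ge> N" "n \<ge> N" for k n
    proof (rule power2_less_imp_less)
      have "1 / real (Suc k) \<le> 1 / Suc N" "1 / real (Suc n) \<le> 1 / Suc N"
        using that by (auto intro!: divide_left_mono)
      then show "(L2norm (\<lambda>x. rs k x - rs n x))\<^sup>2 < e\<^sup>2"
        using close[of k n] N by linarith
    qed (use e in simp)
    then show "\<exists>N. \<forall>m\<ge>N. \<forall>n\<ge>N. L2norm (\<lambda>x. rs m x - rs n x) < e" by blast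
  qed (use L in auto)
  have gL: "g \<in> L2" using g by (simp add: L2_lim_def)
  have lim: "(\<lambda>n. (L2norm (\<lambda>x. f x - rs n x + c * r x))\<^sup>2) \<longlonglongrightarrow> (L2norm (\<lambda>x. f x - g x + c * r x))\<^sup>2"
    if "r \<in> R" for c r
    using that sub by (intro tendsto_power L2_lim_norm L2_lim_add L2_lim_diff L2_lim_const f g L2_scale) auto
  have m_eq: "(L2norm (\<lambda>x. f x - g x))\<^sup>2 \<le> m"
  proof (rule LIMSEQ_le)
    show "(\<lambda>n. (L2norm (\<lambda>x. f x - rs n x))\<^sup>2) \<longlonglongrightarrow> (L2norm (\<lambda>x. f x - g x))\<^sup>2"
      using lim[OF zero, of 0] by simp
    show "(\<lambda>n. m + 1 / Suc n) \<longlonglongrightarrow> m"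
      using tendsto_add[OF tendsto_const[of m] LIMSEQ_inverse_real_of_nat] by (simp add: inverse_eq_divide)
  qed (use rs less_imp_le in blast)
  have min: "(L2norm (\<lambda>x. f x - g x))\<^sup>2 \<le> (L2norm (\<lambda>x. f x - g x + c * r x))\<^sup>2" if "r \<in> R" for c r
  proof -
    have "m \<le> (L2norm (\<lambda>x. f x - g x + c * r x))\<^sup>2"
    proof (rule LIMSEQ_le_const[OF lim[OF that]], intro exI allI impI)
      fix n
      have "(\<lambda>x. rs n x + (-c) * r x) \<in> R" by (intro add scale rs that)
      from mle[OF this] show "m \<le> (L2norm (\<lambda>x. f x - rs n x + c * r x))\<^sup>2"
        by (simp add: algebra_simps)
    qed
    then show ?thesis using m_eq by linarith
  qed
  have "AE x in lborel. f x - g x = 0"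
  proof (rule orth)
    show u: "(\<lambda>x. f x - g x) \<in> L2" by (intro L2_diff f gL)
    fix r assume r: "r \<in> R"
    then have rL: "r \<in> L2" using sub by auto
    define z where "z = L2ip r (\<lambda>x. f x - g x)"
    have 1: "0 \<le> 2 * Re (c * z) + (cmod c * L2norm r)\<^sup>2" for c
    proof -
      have "Re (L2ip (\<lambda>x. f x - g x) (\<lambda>x. c * r x)) = Re (c * z)"
        by (subst L2ip_cnj, subst L2ip_scale_left) (simp add: z_def)
      then show ?thesis
        using min[OF r, of c] L2norm_add_sq[OF u L2_scale[OF rL, of c]] by (simp add: L2norm_scale)
    qed
    \<comment> \<open>Moving along \<open>c r\<close> with \<open>c = - cnj z / q\<close> would decrease the distance unless \<open>z = 0\<close>; \<open>q > \<parallel>r\<parallel>\<^sup>2\<close> also covers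
        \<open>\<parallel>r\<parallel> = 0\<close>.\<close>
    define q where "q = (L2norm r)\<^sup>2 + 1"
    have q: "q > 0" by (simp add: q_def add_nonneg_pos)
    have "0 \<le> 2 * Re (- of_real (1/q) * cnj z * z) + (cmod (- of_real (1/q) * cnj z) * L2norm r)\<^sup>2"
      by (rule 1)
    also have "- of_real (1/q) * cnj z * z = of_real (- (1/q) * (cmod z)\<^sup>2)"
      using complex_norm_square[of z] by (simp add: mult.commute)
    also have "(cmod (- of_real (1/q) * cnj z) * L2norm r)\<^sup>2 = (cmod z)\<^sup>2 * (q - 1) / q\<^sup>2"
    proof -
      have "cmod (- of_real (1/q) * cnj z) = 1/q * cmod z"
        using q by (simp add: norm_mult norm_divide)
      moreover have "(L2norm r)\<^sup>2 = q - 1" by (simp add: q_def)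
      ultimately show ?thesis by (simp only: power_mult_distrib) (simp add: power_divide)
    qed
    finally have "0 \<le> (- 2 * (cmod z)\<^sup>2 / q + (cmod z)\<^sup>2 * (q - 1) / q\<^sup>2) * q\<^sup>2"
      using q by (intro mult_nonneg_nonneg) auto
    also have "\<dots> = - (cmod z)\<^sup>2 * (q + 1)"
      using q by (simp add: field_simps power2_eq_square)
    finally have "(cmod z)\<^sup>2 * (q + 1) \<le> 0" by simp
    then have "(cmod z)\<^sup>2 \<le> 0" using q by (simp add: mult_le_0_iff)
    then show "L2ip r (\<lambda>x. f x - g x) = 0" by (simp add: z_def)
  qed
  moreover have "f \<in> borel_measurable lborel" "g \<in> borel_measurable lborel"
    using f gL by (auto simp: L2_def)
  ultimately have "L2norm (\<lambda>x. rs n x - f x) = L2norm (\<lambda>x. rs n x - g x)" for n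
    using L2_measurable[OF L[of n]] by (intro L2norm_cong_AE) (auto elim!: AE_mp)
  then have "L2_lim rs f" using g f by (simp add: L2_lim_def)
  then show thesis using that rs by blast
qed

section \<open>Primitives of locally integrable functions\<close>

text \<open>
  Local integrability; Borel measurability is included so that products and set integrals need no
  further side conditions.
\<close>

definition loc_int :: "(real \<Rightarrow> complex) \<Rightarrow> bool" where
  "loc_int G \<longleftrightarrow> G \<in> borel_measurable borel \<and> (\<forall>a b. set_integrable lborel {a..b} G)"

text \<open>
  The primitive that vanishes at \<open>0\<close>. It depends only on the almost-everywhere class of the function
  (\<open>prim_cong_AE\<close>), is always continuous, and raises smoothness by one order; these three facts
  drive the regularity argument.
\<close>

definition prim :: "(real \<Rightarrow> complex) \<Rightarrow> real \<Rightarrow> complex" where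
  "prim G x = (if x \<ge> 0 then (LBINT t:{0..x}. G t) else - (LBINT t:{x..0}. G t))"

lemma loc_int_HK: 
  assumes "loc_int G"
  shows "G integrable_on {a..b}" "(LBINT t:{a..b}. G t) = integral {a..b} G"
  using assms set_borel_integral_eq_integral[of "{a..b}" G] by (auto simp: loc_int_def)

lemma loc_int_continuous: "continuous_on UNIV G \<Longrightarrow> loc_int G"
  unfolding loc_int_def
  by (auto intro: borel_measurable_continuous_onI borel_integrable_atLeastAtMost' continuous_on_subset)

lemma loc_int_diff: "loc_int F \<Longrightarrow> loc_int G \<Longrightarrow> loc_int (\<lambda>x. F x - G x)"
  unfolding loc_int_def by (auto intro: set_integral_diff)

lemma loc_int_mult_continuous:
  assumes p: "continuous_on UNIV p" and G: "loc_int G"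
  shows "loc_int (\<lambda>x. p x * G x)"
  unfolding loc_int_def
proof (intro conjI allI)
  have [measurable]: "p \<in> borel_measurable borel" "G \<in> borel_measurable borel"
    using p G by (auto simp: loc_int_def intro: borel_measurable_continuous_onI)
  show "(\<lambda>x. p x * G x) \<in> borel_measurable borel" by measurable
  fix a b :: real
  have "bounded (p ` {a..b})"
    by (intro compact_imp_bounded compact_continuous_image continuous_on_subset[OF p]) auto
  then obtain B where "\<forall>y\<in>p ` {a..b}. cmod y \<le> B" unfolding bounded_iff by blast
  then have B: "\<And>x. x \<in> {a..b} \<Longrightarrow> cmod (p x) \<le> B" by blast
  have "set_integrable lborel {a..b} G" using G by (simp add: loc_int_def)
  then have "integrable lborel (\<lambda>x. B * cmod (indicator {a..b} x *\<^sub>R G x))"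
    unfolding set_integrable_def by (intro integrable_mult_right integrable_norm)
  then show "set_integrable lborel {a..b} (\<lambda>x. p x * G x)"
    unfolding set_integrable_def
  proof (rule Bochner_Integration.integrable_bound)
    show "(\<lambda>x. indicat_real {a..b} x *\<^sub>R (p x * G x)) \<in> borel_measurable lborel" by measurable
    show "AE x in lborel. norm (indicat_real {a..b} x *\<^sub>R (p x * G x)) \<le> norm (B * cmod (indicator {a..b} x
        *\<^sub>R G x))"
    proof (rule AE_I2)
      fix x
      show "norm (indicat_real {a..b} x *\<^sub>R (p x * G x)) \<le> norm (B * cmod (indicator {a..b} x *\<^sub>R G x))"
      proof (cases "x \<in> {a..b}")
        case True
        then have "cmod (p x) \<le> \<bar>B\<bar>" using B[OF True] by simp
        then show ?thesis using True by (simp add: norm_mult mult_right_mono abs_mult)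
      qed simp
    qed
  qed
qed

lemma prim_diff:
  assumes G: "loc_int G" and "a \<le> b"
  shows "prim G b - prim G a = integral {a..b} G"
proof -
  have p: "prim G x = (if x \<ge> 0 then integral {0..x} G else - integral {x..0} G)" for x
    by (simp add: prim_def loc_int_HK(2)[OF G])
  note c = Henstock_Kurzweil_Integration.integral_combine[OF _ _ loc_int_HK(1)[OF G]]
  consider "0 \<le> a" | "a < 0" "0 \<le> b" | "b < 0" by linarith
  then show ?thesis
  proof cases
    case 1 then show ?thesis using assms(2) c[of 0 a b] by (simp add: p algebra_simps)
  next
    case 2 then show ?thesis using c[of a 0 b] by (simp add: p algebra_simps)
  next
    case 3 then show ?thesis using assms(2) c[of a b 0] by (simp add: p algebra_simps)
  qed
qed

lemma prim_eq_indefinite: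
  assumes "loc_int G" "- R \<le> x"
  shows "prim G x = prim G (- R) + integral {- R..x} G"
  using prim_diff[OF assms] by (simp add: algebra_simps)

lemma prim_continuous:
  assumes G: "loc_int G"
  shows "continuous_on UNIV (prim G)"
proof (rule continuous_at_imp_continuous_on, intro ballI)
  fix x :: real
  define R where "R = \<bar>x\<bar> + 1"
  have "continuous_on {-R..R} (\<lambda>x. prim G (-R) + integral {-R..x} G)"
    by (intro continuous_intros indefinite_integral_continuous_1 loc_int_HK(1) G)
  then have "continuous_on {-R..R} (prim G)"
    by (rule continuous_on_cong[THEN iffD1, rotated -1]) (auto simp: prim_eq_indefinite[OF G])
  moreover have "x \<in> interior {-R..R}" by (auto simp: R_def abs_if)
  ultimately show "isCont (prim G) x" using continuous_on_interior by blast
qed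

lemma prim_has_vector_derivative:
  assumes "continuous_on UNIV G"
  shows "(prim G has_vector_derivative G x) (at x)"
proof -
  have G: "loc_int G" using assms by (rule loc_int_continuous)
  define R where "R = \<bar>x\<bar> + 1"
  have "((\<lambda>x. integral {-R..x} G) has_vector_derivative G x) (at x within {-R..R})"
    by (rule integral_has_vector_derivative) (use assms continuous_on_subset R_def in auto)
  then have "((\<lambda>x. integral {-R..x} G) has_vector_derivative G x) (at x within {-R<..<R})"
    by (rule has_vector_derivative_within_subset) auto
  then have "((\<lambda>x. integral {-R..x} G) has_vector_derivative G x) (at x)"
    by (subst (asm) at_within_open) (auto simp: R_def)
  then have "((\<lambda>x. prim G (-R) + integral {-R..x} G) has_vector_derivative G x) (at x)"
    by (auto intro!: derivative_eq_intros)
  then show ?thesis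
  proof (rule has_vector_derivative_transform_within_open[where S="{-R<..<R}"])
    show "x \<in> {-R<..<R}" by (auto simp: R_def)
    show "prim G (-R) + integral {-R..y} G = prim G y" if "y \<in> {-R<..<R}" for y
      using that by (intro prim_eq_indefinite[OF G, symmetric]) simp
  qed simp
qed

lemma prim_cong_AE:
  assumes "AE x in lborel. F x = G x" "loc_int F" "loc_int G"
  shows "prim F = prim G"
proof -
  have eq: "(LBINT t:{a..b}. F t) = (LBINT t:{a..b}. G t)" for a b
    using assms by (intro set_lebesgue_integral_cong_AE) (auto simp: loc_int_def)
  show ?thesis by (rule ext) (simp only: prim_def eq)
qed

lemma C_times_prim: "C_times k G \<Longrightarrow> C_times (Suc k) (prim G)"
  by (rule C_times_SucI[OF prim_has_vector_derivative]) (auto dest: C_times_imp_continuous)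

lemma test_function_times_loc_int_integrable:
  assumes "continuous_on UNIV \<psi>" "\<And>x. \<bar>x\<bar> > R \<Longrightarrow> \<psi> x = 0" "loc_int G"
  shows "integrable lborel (\<lambda>x. \<psi> x * G x)"
proof -
  have "integrable lborel (\<lambda>x. indicator {-R..R} x *\<^sub>R (\<psi> x * G x))"
    using loc_int_mult_continuous[OF assms(1,3)] by (auto simp: loc_int_def set_integrable_def)
  moreover have "indicator {-R..R} x *\<^sub>R (\<psi> x * G x) = \<psi> x * G x" for x
    using assms(2)[of x] by (auto simp: indicator_def abs_if)
  ultimately show ?thesis by simp
qed

text \<open>
  The primitive of \<open>G\<close> need not be differentiable everywhere, so the product rule is not available.
  Instead \<open>\<psi> t\<close> is written as \<open>- \<integral>\<close> of \<open>\<psi>'\<close> over \<open>{t..S}\<close>, and the order of integration is exchanged over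
  the triangle \<open>t \<le> s\<close>.
\<close>

lemma integral_by_parts_prim:
  assumes G: "loc_int G" and d: "\<And>x. (\<psi> has_vector_derivative \<psi>' x) (at x)"
    and c: "continuous_on UNIV \<psi>'" and R: "R \<ge> 0" "\<And>x. \<bar>x\<bar> > R \<Longrightarrow> \<psi> x = 0"
  shows "(LBINT x. \<psi> x * G x) = - (LBINT x. \<psi>' x * prim G x)"
proof -
  \<comment> \<open>At \<open>\<plusminus>S\<close>, unlike possibly at \<open>\<plusminus>R\<close>, the function \<open>\<psi>\<close> vanishes by hypothesis.\<close>
  define S where "S = R + 1"
  have S: "S > R" "S > 0" using R by (auto simp: S_def)
  have \<psi>0: "\<psi> S = 0" "\<psi> (-S) = 0" using R S by auto
  have \<psi>'0: "\<psi>' x = 0" if "\<bar>x\<bar> > R" for x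
  proof -
    have "nth_vderiv 1 \<psi> x = \<psi>' x" using d by (simp add: nth_vderiv_Suc vector_derivative_at)
    then show ?thesis using nth_vderiv_eq_0_outside[OF R(2) that, where k=1] by simp
  qed
  have \<psi>c: "continuous_on UNIV \<psi>"
    by (intro continuous_at_imp_continuous_on ballI has_vector_derivative_continuous[OF d])
  have ftc: "(LBINT s. indicator {t..S} s *\<^sub>R \<psi>' s) = \<psi> S - \<psi> t" if "t \<le> S" for t
    by (rule integral_FTC_Icc[OF that]) (use d c in \<open>auto intro: has_vector_derivative_at_within
        continuous_on_subset\<close>)
  define a where "a t = indicator {-S..S} t *\<^sub>R G t" for t
  define b where "b s = indicator {-S..S} s *\<^sub>R \<psi>' s" for s
  have a: "integrable lborel a" unfolding a_def[abs_def] using G by (auto simp: loc_int_def set_integrable_def)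
  have b: "integrable lborel b" unfolding b_def[abs_def]
    using loc_int_continuous[OF c] by (auto simp: loc_int_def set_integrable_def)
  have [measurable]: "a \<in> borel_measurable borel" "b \<in> borel_measurable borel"
    using borel_measurable_integrable[OF a] borel_measurable_integrable[OF b] by auto
  have ab: "integrable (lborel \<Otimes>\<^sub>M lborel) (\<lambda>(t, s). a t * b s)"
  proof (rule lborel_pair.Fubini_integrable)
    show "(\<lambda>(t, s). a t * b s) \<in> borel_measurable (lborel \<Otimes>\<^sub>M lborel)" by measurable
    show "integrable lborel (\<lambda>x. LBINT y. norm (case (x, y) of (t, s) \<Rightarrow> a t * b s))"
      using a by (simp add: norm_mult)
    show "AE x in lborel. integrable lborel (\<lambda>y. case (x, y) of (t, s) \<Rightarrow> a t * b s)"
      using b by simp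
  qed
  have "integrable (lborel \<Otimes>\<^sub>M lborel) (\<lambda>p. indicator {p. fst p \<le> snd p} p *\<^sub>R (case p of (t, s) \<Rightarrow> a t * b s))"
  proof (rule integrable_mult_indicator[OF _ ab])
    have "{p. fst p \<le> snd p} \<in> sets (borel :: (real \<times> real) measure)"
      by (intro borel_closed closed_Collect_le continuous_intros)
    then show "{p::real \<times> real. fst p \<le> snd p} \<in> sets (lborel \<Otimes>\<^sub>M lborel)"
      by (metis lborel_prod sets_lborel)
  qed
  then have F: "integrable (lborel \<Otimes>\<^sub>M lborel) (\<lambda>(t, s). indicator {t..} s *\<^sub>R (a t * b s))"
    by (rule back_subst[where P="integrable _"]) (auto simp: fun_eq_iff indicator_def)
  have "(LBINT x. \<psi> x * G x) = (LBINT t. - (LBINT s. indicator {t..} s *\<^sub>R (a t * b s)))"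
  proof (intro Bochner_Integration.integral_cong refl)
    fix t
    show "\<psi> t * G t = - (LBINT s. indicator {t..} s *\<^sub>R (a t * b s))"
    proof (cases "t \<in> {-S..S}")
      case True
      have "(LBINT s. indicator {t..} s *\<^sub>R (a t * b s)) = (LBINT s. G t * (indicator {t..S} s *\<^sub>R \<psi>' s))"
        using True by (intro Bochner_Integration.integral_cong refl) (auto simp: indicator_def a_def b_def)
      also have "\<dots> = G t * (LBINT s. indicator {t..S} s *\<^sub>R \<psi>' s)"
        by (rule integral_mult_right_zero)
      also have "\<dots> = G t * (\<psi> S - \<psi> t)" using True by (simp add: ftc)
      finally show ?thesis using \<psi>0 by simp
    next
      case False
      then have "\<psi> t = 0" using S R(2)[of t] by (auto simp: abs_if)
      then show ?thesis using False by (simp add: a_def)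
    qed
  qed
  also have "\<dots> = - (LBINT t. LBINT s. indicator {t..} s *\<^sub>R (a t * b s))" by simp
  also have "(LBINT t. LBINT s. indicator {t..} s *\<^sub>R (a t * b s)) = (LBINT s. LBINT t. indicator {t..} s
      *\<^sub>R (a t * b s))"
    by (rule lborel_pair.Fubini_integral[symmetric]) (use F in simp)
  also have "\<dots> = (LBINT s. \<psi>' s * (prim G s - prim G (-S)))"
  proof (intro Bochner_Integration.integral_cong refl)
    fix s
    show "(LBINT t. indicator {t..} s *\<^sub>R (a t * b s)) = \<psi>' s * (prim G s - prim G (-S))"
    proof (cases "s \<in> {-S..S}")
      case True
      have "(LBINT t. indicator {t..} s *\<^sub>R (a t * b s)) = (LBINT t. \<psi>' s * (indicator {-S..s} t *\<^sub>R G t))"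
        using True by (intro Bochner_Integration.integral_cong refl) (auto simp: indicator_def a_def b_def)
      also have "\<dots> = \<psi>' s * (LBINT t:{-S..s}. G t)"
        unfolding set_lebesgue_integral_def by (rule integral_mult_right_zero)
      finally show ?thesis using True prim_diff[OF G, of "-S" s] by (simp add: loc_int_HK(2)[OF G])
    next
      case False
      then have "\<psi>' s = 0" using S \<psi>'0[of s] by (auto simp: abs_if)
      then show ?thesis using False by (simp add: b_def)
    qed
  qed
  also have "\<dots> = (LBINT s. \<psi>' s * prim G s) - (LBINT s. \<psi>' s) * prim G (-S)"
    using test_function_times_loc_int_integrable[OF c \<psi>'0 loc_int_continuous[OF prim_continuous[OF G]]]
      continuous_support_integrable[OF c \<psi>'0]
    by (simp add: right_diff_distrib)
  also have "(LBINT s. \<psi>' s) = (LBINT s. indicator {-S..S} s *\<^sub>R \<psi>' s)"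
    using S \<psi>'0 by (intro Bochner_Integration.integral_cong refl) (force simp: indicator_def abs_if)
  also have "\<dots> = 0" using ftc[of "-S"] S \<psi>0 by simp
  finally show ?thesis by simp
qed

text \<open>
  Half-lines form an intersection-stable generator of the Borel sets, and the sets over which \<open>f\<close>
  has integral zero form a Dynkin system.
\<close>

lemma AE_zero_if_integrals_zero:
  assumes f: "integrable lborel (f :: real \<Rightarrow> complex)" and 0: "\<And>a. (LBINT x:{..a}. f x) = 0" and tot:
      "(LBINT x. f x) = 0"
  shows "AE x in lborel. f x = 0"
proof -
  have set_int: "set_integrable lborel A f" if "A \<in> sets borel" for A
    unfolding set_integrable_def using f that by (intro integrable_mult_indicator) auto
  have "(LBINT x:A. f x) = 0" if "A \<in> sets borel" for A
  proof -
    have *: "sets borel = sigma_sets UNIV (range (\<lambda>a::real. {..a}))"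
      by (subst borel_eq_atMost) simp
    have "Int_stable (range (\<lambda>a::real. {..a}))"
      by (auto simp: Int_stable_def)
    then show ?thesis
    proof (rule sigma_sets_induct_disjoint[of _ UNIV A])
      show "A \<in> sigma_sets UNIV (range (\<lambda>a::real. {..a}))" using that * by simp
      show "(LBINT x:B. f x) = 0" if "B \<in> range (\<lambda>a::real. {..a})" for B using 0 that by auto
      show "(LBINT x:{}. f x) = 0" by (simp add: set_lebesgue_integral_def)
      show "(LBINT x:UNIV - B. f x) = 0"
        if "B \<in> sigma_sets UNIV (range (\<lambda>a::real. {..a}))" "(LBINT x:B. f x) = 0" for B
      proof -
        have B: "B \<in> sets borel" using that * by simp
        have "(LBINT x. f x) = (LBINT x. indicator B x *\<^sub>R f x + indicator (UNIV - B) x *\<^sub>R f x)"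
          by (intro Bochner_Integration.integral_cong refl) (auto simp: indicator_def)
        also have "\<dots> = (LBINT x:B. f x) + (LBINT x:UNIV - B. f x)"
          unfolding set_lebesgue_integral_def
          using set_int[OF B] set_int[of "UNIV - B"] B by (intro Bochner_Integration.integral_add) (auto
              simp: set_integrable_def)
        finally show ?thesis using tot that by simp
      qed
      show "(LBINT x:(\<Union>i. A i). f x) = 0"
        if "disjoint_family A" "range A \<subseteq> sigma_sets UNIV (range (\<lambda>a::real. {..a}))" "\<And>i. (LBINT x:A i. f
            x) = 0" for A :: "nat \<Rightarrow> real set"
      proof -
        have A: "A i \<in> sets borel" for i using that(2) * by auto
        have "(LBINT x:(\<Union>i. A i). f x) = (\<Sum>i. (LBINT x:(A i). f x))"
          using A that(1) by (intro lebesgue_integral_countable_add set_int sets.countable_UN) (auto simp: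
              disjoint_family_on_def)
        then show ?thesis using that(3) by simp
      qed
    qed simp
  qed
  then show ?thesis
    using sigma_finite_measure.density_unique_banach[OF lborel.sigma_finite_measure_axioms f
        integrable_zero] by simp
qed

text \<open>
  Piecewise linear functions that are \<open>1\<close> on \<open>{a..b}\<close> and have slopes \<open>n\<close> outside converge to the
  indicator of \<open>{a..b}\<close>, so \<open>H\<close> has integral zero over every interval.
\<close>

lemma fundamental_lemma:
  assumes H: "loc_int H" and 0: "\<And>\<phi>. \<phi> \<in> C0_times 0 \<Longrightarrow> (LBINT x. \<phi> x * H x) = 0"
  shows "AE x in lborel. H x = 0"
proof -
  have [measurable]: "H \<in> borel_measurable borel" using H by (simp add: loc_int_def)
  have int: "(LBINT x:{a..b}. H x) = 0" if ab: "a \<le> b" for a b :: real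
  proof -
    define \<phi> where "\<phi> n x = complex_of_real (max 0 (1 - real n * (max 0 (a - x) + max 0 (x - b))))" for n x
    have cont: "continuous_on UNIV (\<phi> n)" for n unfolding \<phi>_def by (intro continuous_intros)
    have [measurable]: "\<phi> n \<in> borel_measurable borel" for n
      using cont by (rule borel_measurable_continuous_onI)
    have supp: "\<phi> n x = 0" if "x \<notin> {a-1..b+1}" "n \<ge> 1" for n x
    proof -
      have "1 * 1 \<le> real n * (max 0 (a - x) + max 0 (x - b))"
        using that ab by (intro mult_mono) (auto simp: max_def)
      then show ?thesis by (simp add: \<phi>_def)
    qed
    have "\<phi> (Suc n) \<in> C0_times 0" for n
      unfolding C0_times_iff
    proof (intro conjI exI[of _ "\<bar>a\<bar> + \<bar>b\<bar> + 1"] allI impI)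
      fix x assume "\<bar>x\<bar> > \<bar>a\<bar> + \<bar>b\<bar> + 1"
      then show "\<phi> (Suc n) x = 0" by (intro supp) auto
    qed (use cont in auto)
    then have z: "(LBINT x. \<phi> (Suc n) x * H x) = 0" for n by (rule 0)
    have "(\<lambda>n. LBINT x. \<phi> (Suc n) x * H x) \<longlonglongrightarrow> (LBINT x. indicator {a..b} x *\<^sub>R H x)"
    proof (rule integral_dominated_convergence[where w="\<lambda>x. cmod (indicator {a-1..b+1} x *\<^sub>R H x)"])
      show "integrable lborel (\<lambda>x. cmod (indicator {a-1..b+1} x *\<^sub>R H x))"
        using H by (intro integrable_norm) (auto simp: loc_int_def set_integrable_def)
      show "AE x in lborel. norm (\<phi> (Suc n) x * H x) \<le> cmod (indicator {a-1..b+1} x *\<^sub>R H x)" for n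
      proof (rule AE_I2)
        fix x
        show "norm (\<phi> (Suc n) x * H x) \<le> cmod (indicator {a-1..b+1} x *\<^sub>R H x)"
        proof (cases "x \<in> {a-1..b+1}")
          case True
          have "0 \<le> real (Suc n) * (max 0 (a - x) + max 0 (x - b))" by (intro mult_nonneg_nonneg) auto
          then have "cmod (\<phi> (Suc n) x) \<le> 1" by (simp add: \<phi>_def)
          then show ?thesis using True mult_right_mono[of "cmod (\<phi> (Suc n) x)" 1 "cmod (H x)"]
            by (simp add: norm_mult)
        qed (simp add: supp)
      qed
      show "AE x in lborel. (\<lambda>n. \<phi> (Suc n) x * H x) \<longlonglongrightarrow> indicator {a..b} x *\<^sub>R H x"
      proof (rule AE_I2)
        fix x :: real
        show "(\<lambda>n. \<phi> (Suc n) x * H x) \<longlonglongrightarrow> indicator {a..b} x *\<^sub>R H x"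
        proof (cases "x \<in> {a..b}")
          case True
          then have "\<phi> (Suc n) x = 1" for n by (simp add: \<phi>_def)
          then show ?thesis using True by simp
        next
          case False
          define d where "d = max 0 (a - x) + max 0 (x - b)"
          have d: "d > 0" using False by (auto simp: d_def max_def)
          then obtain N where N: "1 / d < real N" using reals_Archimedean2 by blast
          have "\<forall>\<^sub>F n in sequentially. \<phi> (Suc n) x * H x = 0"
            using eventually_ge_at_top[of N]
          proof eventually_elim
            case (elim n)
            have "1 < real N * d" using N d by (simp add: field_simps)
            also have "\<dots> \<le> real (Suc n) * d" using elim d by (intro mult_right_mono) auto
            finally show ?case by (simp add: \<phi>_def d_def)
          qed
          then show ?thesis using False by (auto intro: tendsto_eventually)
        qed
      qed
    qed measurable
    then show ?thesis unfolding set_lebesgue_integral_def z using LIMSEQ_unique tendsto_const by blast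
  qed
  have "AE x in lborel. indicator {-real n..real n} x *\<^sub>R H x = 0" for n :: nat
  proof (rule AE_zero_if_integrals_zero)
    show "integrable lborel (\<lambda>x. indicator {-real n..real n} x *\<^sub>R H x)"
      using H by (auto simp: loc_int_def set_integrable_def)
    show "(LBINT x. indicator {-real n..real n} x *\<^sub>R H x) = 0"
      using int[of "-real n" "real n"] by (simp add: set_lebesgue_integral_def)
    fix a
    show "(LBINT x:{..a}. indicator {-real n..real n} x *\<^sub>R H x) = 0"
    proof (cases "- real n \<le> min a (real n)")
      case True
      have "(LBINT x:{..a}. indicator {-real n..real n} x *\<^sub>R H x) = (LBINT x:{-real n..min a (real n)}. H x)"
        unfolding set_lebesgue_integral_def
        by (intro Bochner_Integration.integral_cong refl) (auto simp: indicator_def)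
      then show ?thesis using int[OF True] by simp
    next
      case False
      have "(LBINT x:{..a}. indicator {-real n..real n} x *\<^sub>R H x) = integral\<^sup>L lborel (\<lambda>x::real. 0)"
        unfolding set_lebesgue_integral_def
        using False by (intro Bochner_Integration.integral_cong refl) (auto simp: indicator_def)
      then show ?thesis by simp
    qed
  qed
  then have "AE x in lborel. \<forall>n. indicator {-real n..real n} x *\<^sub>R H x = 0"
    unfolding AE_all_countable by blast
  then show ?thesis
  proof eventually_elim
    case (elim x)
    obtain n where "\<bar>x\<bar> \<le> real n" using real_arch_simple by blast
    then have "x \<in> {-real n..real n}" by auto
    then show ?case using elim[rule_format, of n] by simp
  qed
qed

section \<open>Distributional solutions of ordinary differential equations\<close>

text \<open>
  The sum of the distributional derivatives \<open>(-1)^k (d/dx)^k (G k)\<close> vanishes. The order \<open>n\<close> of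
  differentiability of the test functions is kept as a parameter, because each step of the
  reduction below lowers it by one together with the order \<open>m\<close> of the relation.
\<close>

definition weak_rel :: "nat \<Rightarrow> nat \<Rightarrow> (nat \<Rightarrow> real \<Rightarrow> complex) \<Rightarrow> bool" where
  "weak_rel n m G \<longleftrightarrow> (\<forall>\<psi>\<in>C0_times n. (\<Sum>k\<le>m. LBINT x. nth_vderiv k \<psi> x * G k x) = 0)"

lemma normalized_bump:
  obtains \<eta> where "\<eta> \<in> C0_times n" "(LBINT x. \<eta> x) = 1"
proof -
  obtain S :: "real \<Rightarrow> real" where S: "C_times (Suc n) S" "\<And>t. t \<le> 0 \<Longrightarrow> S t = 0" "\<And>t. t \<ge> 1 \<Longrightarrow> S t = 1"
    using smooth_step[of "Suc n"] by metis
  \<comment> \<open>The derivative of a smooth step is a bump of integral \<open>1\<close>.\<close>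
  define T where "T t = complex_of_real (S t)" for t
  have T: "C_times (Suc n) T" unfolding T_def[abs_def] using S(1) by (rule C_times_of_real)
  then obtain \<eta> where \<eta>: "\<And>x. (T has_vector_derivative \<eta> x) (at x)" "C_times n \<eta>"
    by (rule C_times_SucE) blast
  have \<eta>c: "continuous_on UNIV \<eta>" using \<eta>(2) by (rule C_times_imp_continuous)
  have z: "\<eta> x = 0" if "\<bar>x\<bar> > 1" for x
  proof -
    have "((\<lambda>_. if x > 0 then 1 else 0 :: complex) has_vector_derivative 0) (at x)" by simp
    then have "(T has_vector_derivative 0) (at x)"
      by (rule has_vector_derivative_transform_within_open[where S="if x > 0 then {1<..} else {..<0}"])
        (use that S(2,3) in \<open>auto simp: T_def\<close>)
    then show ?thesis using \<eta>(1)[of x] vector_derivative_unique_at by blast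
  qed
  have "(LBINT x. \<eta> x) = (LBINT x. indicator {-1..1} x *\<^sub>R \<eta> x)"
    using z by (intro Bochner_Integration.integral_cong refl) (force simp: indicator_def abs_if)
  also have "\<dots> = T 1 - T (-1)"
    by (rule integral_FTC_Icc) (use \<eta> \<eta>c in \<open>auto intro: has_vector_derivative_at_within continuous_on_subset\<close>)
  also have "\<dots> = 1" using S by (simp add: T_def)
  finally have "(LBINT x. \<eta> x) = 1" .
  moreover have "\<eta> \<in> C0_times n" using \<eta>(2) z by (auto simp: C0_times_iff intro!: exI[of _ 1])
  ultimately show thesis using that by blast
qed

text \<open>
  Order reduction for weak relations, the lemma of du Bois-Reymond. Integrating the zeroth order
  term by parts makes every term contain \<open>\<kappa> = \<psi>'\<close>, so that the relation, now of order one less in \<open>\<kappa>\<close>,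
  holds for all test functions \<open>\<kappa>\<close> of integral zero. A general \<open>\<phi>\<close> differs from such a \<open>\<kappa>\<close> by a multiple
  of a fixed bump \<open>\<eta>\<close>; this multiple is proportional to \<open>\<integral> \<phi>\<close>, which accounts for the additional
  constant \<open>c\<close>.
\<close>

lemma weak_rel_step:
  assumes rel: "weak_rel (Suc n) (Suc m) G" and m: "m \<le> n" and G: "\<And>k. loc_int (G k)"
  shows "\<exists>c. weak_rel n m (\<lambda>k x. if k = 0 then G 1 x - prim (G 0) x - c else G (Suc k) x)"
proof -
  have lp: "loc_int (prim (G 0))" by (intro loc_int_continuous prim_continuous G)
  define H where "H k x = (if k = 0 then G 1 x - prim (G 0) x else G (Suc k) x)" for k x
  have H: "loc_int (H k)" for k
    unfolding H_def[abs_def] using G lp by (cases "k = 0") (auto intro: loc_int_diff)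
  define \<Lambda> where "\<Lambda> \<phi> = (\<Sum>k\<le>m. LBINT x. nth_vderiv k \<phi> x * H k x)" for \<phi>
  have test: "integrable lborel (\<lambda>x. nth_vderiv k \<phi> x * F x)" if \<phi>: "\<phi> \<in> C0_times n" and kn: "k \<le> n" and
      F: "loc_int F" for k \<phi> F
  proof -
    obtain R where R: "\<And>x. \<bar>x\<bar> > R \<Longrightarrow> \<phi> x = 0" and c: "C_times n \<phi>" using \<phi> by (auto simp: C0_times_iff)
    have "continuous_on UNIV (nth_vderiv k \<phi>)" using C_times_nth_vderiv[OF c kn] C_times_imp_continuous by blast
    then show ?thesis using nth_vderiv_eq_0_outside[of R \<phi>, OF R] F by (rule
        test_function_times_loc_int_integrable)
  qed
  have zero: "\<Lambda> \<kappa> = 0" if \<kappa>: "\<kappa> \<in> C0_times n" "(LBINT x. \<kappa> x) = 0" for \<kappa>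
  proof -
    obtain R where R: "R \<ge> 0" "\<And>x. \<bar>x\<bar> > R \<Longrightarrow> \<kappa> x = 0" and \<kappa>C: "C_times n \<kappa>" using \<kappa> by (auto simp: C0_times_iff)
    have \<kappa>c: "continuous_on UNIV \<kappa>" using \<kappa>C by (rule C_times_imp_continuous)
    define \<psi> where "\<psi> x = prim \<kappa> x - prim \<kappa> (-R)" for x
    have d: "(\<psi> has_vector_derivative \<kappa> x) (at x)" for x
      unfolding \<psi>_def[abs_def] using prim_has_vector_derivative[OF \<kappa>c, of x] by (auto intro!:
          derivative_eq_intros)
    have int0: "integral {-R..R} \<kappa> = 0"
    proof -
      have "(LBINT x. \<kappa> x) = (LBINT x:{-R..R}. \<kappa> x)"
        unfolding set_lebesgue_integral_def
        using R by (intro Bochner_Integration.integral_cong refl) (force simp: indicator_def abs_if)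
      then show ?thesis using \<kappa>(2) loc_int_HK(2)[OF loc_int_continuous[OF \<kappa>c]] by simp
    qed
    have supp: "\<psi> x = 0" if "\<bar>x\<bar> > R" for x
    proof (cases "x > 0")
      case True
      then have x: "R \<le> x" using that by simp
      have "prim \<kappa> x - prim \<kappa> R = integral {R..x} \<kappa>" "prim \<kappa> R - prim \<kappa> (-R) = 0"
        using prim_diff[OF loc_int_continuous[OF \<kappa>c]] x R int0 by auto
      moreover have "integral {R..x} \<kappa> = integral {R..x} (\<lambda>_. 0)"
        by (rule integral_spike[of "{R}"]) (use R in auto)
      ultimately show ?thesis by (simp add: \<psi>_def)
    next
      case False
      then have x: "x \<le> -R" using that by simp
      have "prim \<kappa> (-R) - prim \<kappa> x = integral {x..-R} \<kappa>"
        using prim_diff[OF loc_int_continuous[OF \<kappa>c]] x by auto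
      moreover have "integral {x..-R} \<kappa> = integral {x..-R} (\<lambda>_. 0)"
        by (rule integral_spike[of "{-R}"]) (use R in auto)
      ultimately show ?thesis by (simp add: \<psi>_def)
    qed
    have "\<psi> \<in> C0_times (Suc n)"
      unfolding C0_times_iff using C_times_SucI[OF d \<kappa>C] supp R(1) by blast
    then have "0 = (\<Sum>k\<le>Suc m. LBINT x. nth_vderiv k \<psi> x * G k x)"
      using rel by (simp add: weak_rel_def)
    also have "\<dots> = (LBINT x. \<psi> x * G 0 x) + (\<Sum>k\<le>m. LBINT x. nth_vderiv (Suc k) \<psi> x * G (Suc k) x)"
      by (simp only: sum.atMost_Suc_shift nth_vderiv_0)
    also have "(LBINT x. \<psi> x * G 0 x) = - (LBINT x. \<kappa> x * prim (G 0) x)"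
      by (rule integral_by_parts_prim[OF G d \<kappa>c R(1) supp])
    also have "(\<lambda>x. vector_derivative \<psi> (at x)) = \<kappa>" using d vector_derivative_at by blast
    then have "nth_vderiv (Suc k) \<psi> = nth_vderiv k \<kappa>" for k by (simp add: nth_vderiv_Suc_shift)
    then have "(\<Sum>k\<le>m. LBINT x. nth_vderiv (Suc k) \<psi> x * G (Suc k) x) = (\<Sum>k\<le>m. LBINT x. nth_vderiv k \<kappa> x *
        G (Suc k) x)"
      by simp
    also have "\<dots> = (\<Sum>k\<le>m. (LBINT x. nth_vderiv k \<kappa> x * H k x) + (if k = 0 then (LBINT x. \<kappa> x * prim (G 0)
        x) else 0))"
    proof (intro sum.cong refl)
      fix k assume "k \<in> {..m}"
      show "(LBINT x. nth_vderiv k \<kappa> x * G (Suc k) x) = (LBINT x. nth_vderiv k \<kappa> x * H k x) + (if k = 0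
          then (LBINT x. \<kappa> x * prim (G 0) x) else 0)"
        using test[OF \<kappa>(1), of 0, OF _ lp] test[OF \<kappa>(1), of 0, OF _ G[of 1]]
        by (cases "k = 0") (simp_all add: H_def right_diff_distrib)
    qed
    also have "\<dots> = \<Lambda> \<kappa> + (LBINT x. \<kappa> x * prim (G 0) x)"
      by (simp add: sum.distrib \<Lambda>_def)
    finally show ?thesis by simp
  qed
  obtain \<eta> where \<eta>: "\<eta> \<in> C0_times n" "(LBINT x. \<eta> x) = 1" using normalized_bump by blast
  have "weak_rel n m (\<lambda>k x. if k = 0 then G 1 x - prim (G 0) x - \<Lambda> \<eta> else G (Suc k) x)"
    unfolding weak_rel_def
  proof
    fix \<phi> assume \<phi>: "\<phi> \<in> C0_times n"
    define a where "a = (LBINT x. \<phi> x)"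
    obtain R1 R2 where R: "R1 \<ge> 0" "\<And>x. \<bar>x\<bar> > R1 \<Longrightarrow> \<phi> x = 0" "R2 \<ge> 0" "\<And>x. \<bar>x\<bar> > R2 \<Longrightarrow> \<eta> x = 0"
      and C: "C_times n \<phi>" "C_times n \<eta>" using \<phi> \<eta> by (auto simp: C0_times_iff)
    have aC: "C_times n (\<lambda>x. - a * \<eta> x)" by (intro C_times_mult C_times_const C)
    have \<kappa>: "(\<lambda>x. \<phi> x + - a * \<eta> x) \<in> C0_times n"
      unfolding C0_times_iff
      using C_times_add[OF C(1) aC] R by (auto intro!: exI[of _ "max R1 R2"])
    have ints: "integrable lborel \<phi>" "integrable lborel \<eta>"
      using continuous_support_integrable C_times_imp_continuous C R by blast+
    then have "(LBINT x. \<phi> x + - a * \<eta> x) = 0" using \<eta>(2) by (simp add: a_def)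
    then have "0 = \<Lambda> (\<lambda>x. \<phi> x + - a * \<eta> x)" using zero[OF \<kappa>] by simp
    also have "\<dots> = (\<Sum>k\<le>m. (LBINT x. nth_vderiv k \<phi> x * H k x) + - a * (LBINT x. nth_vderiv k \<eta> x * H k x))"
      unfolding \<Lambda>_def
    proof (intro sum.cong refl)
      fix k assume "k \<in> {..m}"
      then have k: "k \<le> n" using m by simp
      have "nth_vderiv k (\<lambda>x. \<phi> x + - a * \<eta> x) = (\<lambda>x. nth_vderiv k \<phi> x + - a * nth_vderiv k \<eta> x)"
        using nth_vderiv_add[OF C(1) aC k] nth_vderiv_linear[OF bounded_linear_mult_right C(2) k, of "-a"]
            by simp
      then show "(LBINT x. nth_vderiv k (\<lambda>x. \<phi> x + - a * \<eta> x) x * H k x) =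
          (LBINT x. nth_vderiv k \<phi> x * H k x) + - a * (LBINT x. nth_vderiv k \<eta> x * H k x)"
        using test[OF \<phi> k H[of k]] test[OF \<eta>(1) k H[of k]] by (simp add: distrib_right left_diff_distrib
            mult.assoc)
    qed
    also have "\<dots> = \<Lambda> \<phi> - a * \<Lambda> \<eta>"
      by (simp add: sum.distrib \<Lambda>_def sum_distrib_left sum_negf sum_subtractf)
    finally have \<Lambda>\<phi>: "\<Lambda> \<phi> = a * \<Lambda> \<eta>" by simp
    have "(\<Sum>k\<le>m. LBINT x. nth_vderiv k \<phi> x * (if k = 0 then G 1 x - prim (G 0) x - \<Lambda> \<eta> else G (Suc k) x)) =
       (\<Sum>k\<le>m. (LBINT x. nth_vderiv k \<phi> x * H k x) - (if k = 0 then a * \<Lambda> \<eta> else 0))"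
    proof (intro sum.cong refl)
      fix k assume "k \<in> {..m}"
      show "(LBINT x. nth_vderiv k \<phi> x * (if k = 0 then G 1 x - prim (G 0) x - \<Lambda> \<eta> else G (Suc k) x)) =
        (LBINT x. nth_vderiv k \<phi> x * H k x) - (if k = 0 then a * \<Lambda> \<eta> else 0)"
      proof (cases "k = 0")
        case True
        have "(LBINT x. \<phi> x * H 0 x - \<phi> x * \<Lambda> \<eta>) = (LBINT x. \<phi> x * H 0 x) - a * \<Lambda> \<eta>"
          using test[OF \<phi>, of 0, OF _ H[of 0]] ints(1) by (simp add: a_def)
        then show ?thesis using True by (simp add: H_def right_diff_distrib)
      qed (simp add: H_def)
    qed
    also have "\<dots> = \<Lambda> \<phi> - a * \<Lambda> \<eta>" by (simp add: sum_subtractf \<Lambda>_def)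
    finally show "(\<Sum>k\<le>m. LBINT x. nth_vderiv k \<phi> x * (if k = 0 then G 1 x - prim (G 0) x - \<Lambda> \<eta> else G (Suc
        k) x)) = 0"
      using \<Lambda>\<phi> by simp
  qed
  then show ?thesis by blast
qed

text \<open>
  A locally integrable distributional solution of an ordinary differential equation whose leading
  coefficient is a nonzero constant is a classical solution. Repeating the order reduction \<open>K\<close> times
  produces functions \<open>R i\<close> with \<open>R (i+1) = G (i+1) - prim (R i) - d i\<close> and \<open>R K = 0\<close> almost everywhere.
  The last equation says that \<open>c K * W\<close> is, up to a constant, the primitive of \<open>R (K-1)\<close>, so \<open>W\<close> has a
  continuous representative, and inserting this into the recursion raises its smoothness step by
  step. Differentiating \<open>R K = 0\<close> \<open>K\<close> times gives back the differential equation.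
\<close>

lemma weak_regularity:
  fixes c :: "nat \<Rightarrow> complex"
  assumes K: "K \<ge> 1" and cK: "c K \<noteq> 0" and p: "C_times K p" and W: "loc_int W"
    and weak: "\<And>\<psi>. \<psi> \<in> C0_times K \<Longrightarrow>
      (\<Sum>k\<le>K. LBINT x. nth_vderiv k \<psi> x * (c k * W x)) = (LBINT x. \<psi> x * (p x * W x))"
  obtains W' where "C_times K W'" "AE x in lborel. W x = W' x"
    "\<And>x. (\<Sum>k\<le>K. (-1) ^ k * c k * nth_vderiv k W' x) = p x * W' x"
proof -
  have pc: "continuous_on UNIV p" using p by (rule C_times_imp_continuous)
  \<comment> \<open>The potential is merged into the zeroth order coefficient.\<close>
  define q where "q k x = (if k = 0 then c 0 - p x else c k)" for k x
  have qC: "C_times K (q k)" for k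
  proof (cases "k = 0")
    case True
    have "C_times K (\<lambda>x. c 0 + (-1) * p x)" by (intro C_times_add C_times_mult C_times_const p)
    then show ?thesis using True by (simp add: q_def[abs_def])
  qed (simp add: q_def[abs_def] C_times_const)
  have qc: "continuous_on UNIV (q k)" for k using qC by (rule C_times_imp_continuous)
  define G where "G k x = q k x * W x" for k x
  have G: "loc_int (G k)" for k unfolding G_def[abs_def] by (rule loc_int_mult_continuous[OF qc W])
  have rel0: "weak_rel K K G"
    unfolding weak_rel_def
  proof
    fix \<psi> assume \<psi>: "\<psi> \<in> C0_times K"
    obtain R where R: "\<And>x. \<bar>x\<bar> > R \<Longrightarrow> \<psi> x = 0" and C: "C_times K \<psi>" using \<psi> by (auto simp: C0_times_iff)
    have t: "integrable lborel (\<lambda>x. \<psi> x * F x)" if "loc_int F" for F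
      using C_times_imp_continuous[OF C] R that by (rule test_function_times_loc_int_integrable)
    have "(\<Sum>k\<le>K. LBINT x. nth_vderiv k \<psi> x * G k x) =
       (\<Sum>k\<le>K. (LBINT x. nth_vderiv k \<psi> x * (c k * W x)) - (if k = 0 then (LBINT x. \<psi> x * (p x * W x)) else 0))"
    proof (intro sum.cong refl)
      fix k
      show "(LBINT x. nth_vderiv k \<psi> x * G k x) = (LBINT x. nth_vderiv k \<psi> x * (c k * W x)) - (if k = 0
          then (LBINT x. \<psi> x * (p x * W x)) else 0)"
      proof (cases "k = 0")
        case True
        have "(LBINT x. \<psi> x * (c 0 * W x) - \<psi> x * (p x * W x)) = (LBINT x. \<psi> x * (c 0 * W x)) - (LBINT x.
            \<psi> x * (p x * W x))"
          by (intro Bochner_Integration.integral_diff t loc_int_mult_continuous continuous_on_const pc W)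
        then show ?thesis using True by (simp add: G_def q_def left_diff_distrib right_diff_distrib)
      qed (simp add: G_def q_def)
    qed
    also have "\<dots> = (\<Sum>k\<le>K. (LBINT x. nth_vderiv k \<psi> x * (c k * W x))) - (LBINT x. \<psi> x * (p x * W x))"
      by (simp add: sum_subtractf)
    finally show "(\<Sum>k\<le>K. LBINT x. nth_vderiv k \<psi> x * G k x) = 0" using weak[OF \<psi>] by simp
  qed
  have chain: "\<exists>R d. R 0 = G 0 \<and> (\<forall>i. loc_int (R i)) \<and> (\<forall>i<j. R (Suc i) = (\<lambda>x. G (Suc i) x - prim (R i) x
      - d i)) \<and>
      weak_rel (K - j) (K - j) (\<lambda>k x. if k = 0 then R j x else G (j + k) x)" if "j \<le> K" for j
    using that
  proof (induction j)
    case 0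
    have "(\<lambda>k x. if k = 0 then G 0 x else G (0 + k) x) = G" by (auto simp: fun_eq_iff)
    then show ?case using rel0 G by (intro exI[of _ "\<lambda>_. G 0"]) simp
  next
    case (Suc j)
    then obtain R d where R: "R 0 = G 0" "\<And>i. loc_int (R i)" "\<And>i. i < j \<Longrightarrow> R (Suc i) = (\<lambda>x. G (Suc i) x -
        prim (R i) x - d i)"
      "weak_rel (K - j) (K - j) (\<lambda>k x. if k = 0 then R j x else G (j + k) x)" by auto
    let ?H = "\<lambda>k x. if k = 0 then R j x else G (j + k) x"
    have "weak_rel (Suc (K - Suc j)) (Suc (K - Suc j)) ?H" using R(4) Suc.prems by (simp add: Suc_diff_Suc)
    moreover have "loc_int (?H k)" for k using R(2) G by (cases "k = 0") simp_all
    ultimately have "\<exists>e. weak_rel (K - Suc j) (K - Suc j) (\<lambda>k x. if k = 0 then ?H 1 x - prim (?H 0) x - e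
        else ?H (Suc k) x)"
      by (intro weak_rel_step) auto
    then obtain e where e: "weak_rel (K - Suc j) (K - Suc j) (\<lambda>k x. if k = 0 then ?H 1 x - prim (?H 0) x -
        e else ?H (Suc k) x)" ..
    define S where "S = (\<lambda>x. G (Suc j) x - prim (R j) x - e)"
    have "loc_int S"
      unfolding S_def by (intro loc_int_diff G loc_int_continuous[OF prim_continuous[OF R(2)]]
          loc_int_continuous continuous_on_const)
    moreover have "(\<lambda>k x. if k = 0 then ?H 1 x - prim (?H 0) x - e else ?H (Suc k) x) =
       (\<lambda>k x. if k = 0 then S x else G (Suc j + k) x)"
      by (auto simp: fun_eq_iff S_def)
    ultimately have S: "loc_int S" "weak_rel (K - Suc j) (K - Suc j) (\<lambda>k x. if k = 0 then S x else G (Suc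
        j + k) x)"
      using e by simp_all
    define R2 where "R2 = R(Suc j := S)"
    define d2 where "d2 = d(j := e)"
    have R2: "R2 (Suc j) = S" "\<And>i. i \<le> j \<Longrightarrow> R2 i = R i" "\<And>i. loc_int (R2 i)" and d2: "d2 j = e" "\<And>i. i < j
        \<Longrightarrow> d2 i = d i"
      using S(1) R(2) by (auto simp: R2_def d2_def)
    have "R2 (Suc i) = (\<lambda>x. G (Suc i) x - prim (R2 i) x - d2 i)" if "i < Suc j" for i
    proof (cases "i = j")
      case True
      then show ?thesis by (simp add: R2 d2 S_def)
    next
      case False
      then have i: "i < j" using that by simp
      then show ?thesis using R(3)[OF i] by (simp add: R2(2) d2(2))
    qed
    moreover have "R2 0 = G 0" using R(1) R2(2) by simp
    moreover have "weak_rel (K - Suc j) (K - Suc j) (\<lambda>k x. if k = 0 then R2 (Suc j) x else G (Suc j + k) x)"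
      unfolding R2(1) by (rule S(2))
    ultimately show ?case
      using R2(3) by (intro exI[of _ R2] exI[of _ d2] conjI) blast+
  qed
  obtain R d where R: "R 0 = G 0" "\<And>i. loc_int (R i)" "\<And>i. i < K \<Longrightarrow> R (Suc i) = (\<lambda>x. G (Suc i) x - prim (R
      i) x - d i)"
      "weak_rel 0 0 (\<lambda>k x. if k = 0 then R K x else G (K + k) x)"
    using chain[OF order_refl] by auto
  have RK: "AE x in lborel. R K x = 0"
    by (rule fundamental_lemma[OF R(2)]) (use R(4) in \<open>simp add: weak_rel_def\<close>)
  obtain K' where K': "K = Suc K'" using K by (cases K) auto
  define W' where "W' x = (prim (R K') x + d K') / c K" for x
  have W'c: "continuous_on UNIV W'" unfolding W'_def[abs_def] using cK
    by (intro continuous_intros prim_continuous R) auto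
  have WW': "AE x in lborel. W x = W' x"
    using RK
  proof eventually_elim
    case (elim x)
    then have "c K * W x = prim (R K') x + d K'" using R(3)[of K'] K' by (simp add: G_def q_def algebra_simps)
    then show ?case using cK by (simp add: W'_def field_simps)
  qed
  \<comment> \<open>The same recursion for the continuous representative \<open>W'\<close>, so that its relations hold everywhere.\<close>
  define R' where "R' = rec_nat (\<lambda>x. q 0 x * W' x) (\<lambda>i r x. q (Suc i) x * W' x - prim r x - d i)"
  have R'0: "R' 0 = (\<lambda>x. q 0 x * W' x)" and R'S: "R' (Suc i) = (\<lambda>x. q (Suc i) x * W' x - prim (R' i) x - d
      i)" for i
    by (simp_all add: R'_def)
  have R'c: "continuous_on UNIV (R' i)" for i
    by (induction i) (auto simp: R'0 R'S intro!: continuous_intros qc W'c prim_continuous loc_int_continuous)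
  have RR': "AE x in lborel. R i x = R' i x" if "i \<le> K" for i
    using that
  proof (induction i)
    case 0
    show ?case using WW' by eventually_elim (simp add: R(1) R'0 G_def)
  next
    case (Suc i)
    then have pr: "prim (R i) = prim (R' i)" by (intro prim_cong_AE[OF _ R(2) loc_int_continuous[OF R'c]]) simp
    have i: "i < K" using Suc.prems by simp
    show ?case using WW' by eventually_elim (simp add: R(3)[OF i] R'S G_def pr)
  qed
  have R'K: "R' K x = 0" for x
  proof -
    have "prim (R K') = prim (R' K')"
      using K' by (intro prim_cong_AE[OF _ R(2) loc_int_continuous[OF R'c]] RR') simp
    then show ?thesis using cK by (simp add: K' R'S q_def W'_def)
  qed
  have R'C: "C_times j (R' i)" if "C_times j W'" "j \<le> K" for i j
  proof (induction i)
    case 0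
    show ?case unfolding R'0 by (intro C_times_mult that C_times_mono[OF qC])
  next
    case (Suc i)
    have "C_times j (\<lambda>x. q (Suc i) x * W' x + ((-1) * prim (R' i) x + - d i))"
      using C_times_SucD[OF C_times_prim[OF Suc]]
      by (intro C_times_add C_times_mult C_times_const that C_times_mono[OF qC])
    then show ?case by (simp add: R'S algebra_simps)
  qed
  have W'C: "C_times j W'" if "j \<le> K" for j
    using that
  proof (induction j)
    case 0
    show ?case using W'c by simp
  next
    case (Suc j)
    then have "C_times (Suc j) (prim (R' K'))" by (intro C_times_prim R'C) auto
    then have "C_times (Suc j) (\<lambda>x. inverse (c K) * (prim (R' K') x + d K'))"
      by (intro C_times_mult C_times_add C_times_const)
    moreover have "W' = (\<lambda>x. inverse (c K) * (prim (R' K') x + d K'))"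
    proof
      fix x
      have "c K * W' x = prim (R' K') x + d K'" using R'K[of x] by (simp add: K' R'S q_def algebra_simps)
      then show "W' x = inverse (c K) * (prim (R' K') x + d K')" using cK by (simp add: field_simps)
    qed
    ultimately show ?case by simp
  qed
  \<comment> \<open>The \<open>i\<close>-th derivative of the identity \<open>R' K = 0\<close>.\<close>
  have der: "(\<Sum>l<i. (-1) ^ l * c (K - l) * nth_vderiv (i - l) W' x) + (-1) ^ i * R' (K - i) x = 0" if "i \<le>
      K" for i x
    using that
  proof (induction i arbitrary: x)
    case 0
    show ?case by (simp add: R'K)
  next
    case (Suc i)
    define j where "j = K - Suc i"
    have j: "K - i = Suc j" using Suc.prems by (simp add: j_def)
    let ?S = "\<lambda>x. (\<Sum>l<i. (-1) ^ l * c (K - l) * nth_vderiv (i - l) W' x) + (-1) ^ i * R' (K - i) x"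
    have S0: "?S = (\<lambda>x. 0)" using Suc by auto
    have d1: "(nth_vderiv k W' has_vector_derivative nth_vderiv (Suc k) W' x) (at x)" if "k < K" for k
      by (rule nth_vderiv_has_vector_derivative[OF W'C[OF order_refl] that])
    have "((\<lambda>x. c (Suc j) * W' x - prim (R' j) x - d j) has_vector_derivative c (Suc j) * nth_vderiv 1 W'
        x - R' j x - 0) (at x)"
      using d1[of 0] K by (intro has_vector_derivative_diff has_vector_derivative_mult_right
          prim_has_vector_derivative R'c has_vector_derivative_const) simp
    then have d2: "(R' (Suc j) has_vector_derivative c (Suc j) * nth_vderiv 1 W' x - R' j x) (at x)"
      by (simp add: R'S[abs_def] q_def[abs_def])
    have "(?S has_vector_derivative (\<Sum>l<i. (-1) ^ l * c (K - l) * nth_vderiv (Suc (i - l)) W' x) +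
        (-1) ^ i * (c (Suc j) * nth_vderiv 1 W' x - R' j x)) (at x)"
      unfolding j using Suc.prems
      by (intro has_vector_derivative_add has_vector_derivative_sum has_vector_derivative_mult_right d1 d2) auto
    moreover have "(?S has_vector_derivative 0) (at x)" unfolding S0 by simp
    ultimately have "(\<Sum>l<i. (-1) ^ l * c (K - l) * nth_vderiv (Suc (i - l)) W' x) +
        (-1) ^ i * (c (Suc j) * nth_vderiv 1 W' x - R' j x) = 0"
      using vector_derivative_unique_at by blast
    moreover have "(\<Sum>l<i. (-1) ^ l * c (K - l) * nth_vderiv (Suc (i - l)) W' x) = (\<Sum>l<i. (-1) ^ l * c (K -
        l) * nth_vderiv (Suc i - l) W' x)"
      by (intro sum.cong refl) (simp add: Suc_diff_le)
    ultimately show ?case by (simp add: j j_def[symmetric] algebra_simps)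
  qed
  have "(\<Sum>k\<le>K. (-1) ^ k * c k * nth_vderiv k W' x) = p x * W' x" for x
  proof -
    have "(\<Sum>k\<le>K. (-1) ^ k * c k * nth_vderiv k W' x) = (\<Sum>l\<le>K. (-1) ^ (K - l) * c (K - l) * nth_vderiv (K -
        l) W' x)"
      using sum.nat_diff_reindex[of "\<lambda>k. (-1) ^ k * c k * nth_vderiv k W' x" "Suc K"]
      by (simp only: lessThan_Suc_atMost diff_Suc_Suc)
    also have "\<dots> = (\<Sum>l<K. (-1) ^ (K - l) * c (K - l) * nth_vderiv (K - l) W' x) + c 0 * W' x"
      by (simp add: lessThan_Suc_atMost[symmetric])
    also have "(\<Sum>l<K. (-1) ^ (K - l) * c (K - l) * nth_vderiv (K - l) W' x) =
       (-1) ^ K * (\<Sum>l<K. (-1) ^ l * c (K - l) * nth_vderiv (K - l) W' x)"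
      unfolding sum_distrib_left
    proof (intro sum.cong refl)
      fix l assume "l \<in> {..<K}"
      then have "(-1) ^ K * (-1) ^ l = ((-1) ^ (K - l) :: complex)"
        by (auto simp: minus_one_power_iff)
      then show "(-1) ^ (K - l) * c (K - l) * nth_vderiv (K - l) W' x = (-1) ^ K * ((-1) ^ l * c (K - l) *
          nth_vderiv (K - l) W' x)"
        by (simp add: mult.assoc[symmetric])
    qed
    also have "(\<Sum>l<K. (-1) ^ l * c (K - l) * nth_vderiv (K - l) W' x) = - ((-1) ^ K * R' 0 x)"
      using der[of K x] by (simp add: eq_neg_iff_add_eq_0)
    also have "(-1) ^ K * - ((-1) ^ K * R' 0 x) = - R' 0 x"
      by (simp add: mult.assoc[symmetric] power_mult_distrib[symmetric])
    finally show ?thesis by (simp add: R'0 q_def algebra_simps)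
  qed
  with that W'C[OF order_refl] WW' show thesis by blast
qed

section \<open>Symbol classes\<close>

definition dominated :: "(real \<Rightarrow> real) \<Rightarrow> ('i \<Rightarrow> real \<Rightarrow> complex) \<Rightarrow> bool" where
  "dominated w a \<longleftrightarrow> (\<exists>C. \<forall>i x. cmod (a i x) \<le> C * w x)"

lemma dominatedI: "(\<And>i x. cmod (a i x) \<le> C * w x) \<Longrightarrow> dominated w a"
  unfolding dominated_def by blast

lemma dominatedE:
  assumes "dominated w a"
  obtains C where "\<And>i x. cmod (a i x) \<le> C * w x"
  using assms unfolding dominated_def by blast

lemma dominated_add:
  assumes "dominated w a" "dominated w b"
  shows "dominated w (\<lambda>i x. a i x + b i x)"
proof -
  obtain C where C: "\<And>i x. cmod (a i x) \<le> C * w x" using assms(1) by (rule dominatedE) blast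
  obtain D where D: "\<And>i x. cmod (b i x) \<le> D * w x" using assms(2) by (rule dominatedE) blast
  show ?thesis
    using C D by (intro dominatedI[where C="C + D"] norm_triangle_le) (auto simp: distrib_right add_mono)
qed

lemma dominated_mult:
  assumes "dominated w a" "dominated w' b"
  shows "dominated (\<lambda>x. w x * w' x) (\<lambda>i x. a i x * b i x)"
proof -
  obtain C where C: "\<And>i x. cmod (a i x) \<le> C * w x" using assms(1) by (rule dominatedE) blast
  obtain D where D: "\<And>i x. cmod (b i x) \<le> D * w' x" using assms(2) by (rule dominatedE) blast
  show ?thesis
  proof (rule dominatedI[where C="C * D"])
    fix i x
    have "cmod (a i x) * cmod (b i x) \<le> (C * w x) * (D * w' x)"
      by (rule mult_mono[OF C D order_trans[OF norm_ge_zero C] norm_ge_zero])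
    then show "cmod (a i x * b i x) \<le> C * D * (w x * w' x)" by (simp add: norm_mult mult_ac)
  qed
qed

lemma dominated_weight_mono:
  assumes "\<And>x. w x \<le> B * w' x" "\<And>x. 0 \<le> w x" "dominated w a"
  shows "dominated w' a"
proof -
  obtain C where C: "\<And>i x. cmod (a i x) \<le> C * w x" using assms(3) by (rule dominatedE) blast
  show ?thesis
  proof (rule dominatedI[where C="max C 0 * B"])
    fix i x
    have "cmod (a i x) \<le> max C 0 * w x"
      using C[of i x] mult_right_mono[of C "max C 0" "w x"] assms(2)[of x] by simp
    also have "\<dots> \<le> max C 0 * (B * w' x)" by (intro mult_left_mono assms) auto
    finally show "cmod (a i x) \<le> max C 0 * B * w' x" by (simp add: mult.assoc)
  qed
qed

text \<open>
  A symbol class: families (the index \<open>i\<close> will be the number of a cutoff function) all of whose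
  derivatives up to order \<open>m\<close> are bounded by one and the same weight \<open>w\<close>, uniformly in the index. It
  is the right class here because differentiating a power of \<open>v\<close> reproduces its size. The recursive
  form makes the class a graded algebra without any Leibniz or Faa di Bruno formula.
\<close>

fun symb :: "nat \<Rightarrow> (real \<Rightarrow> real) \<Rightarrow> ('i \<Rightarrow> real \<Rightarrow> complex) \<Rightarrow> bool" where
  "symb 0 w a \<longleftrightarrow> dominated w a \<and> (\<forall>i. continuous_on UNIV (a i))"
| "symb (Suc m) w a \<longleftrightarrow> dominated w a \<and>
     (\<exists>b. (\<forall>i x. (a i has_vector_derivative b i x) (at x)) \<and> symb m w b)"

lemma symb_dominated: "symb m w a \<Longrightarrow> dominated w a"
  by (cases m) auto

lemma symb_SucI:
  "dominated w a \<Longrightarrow> (\<And>i x. (a i has_vector_derivative b i x) (at x)) \<Longrightarrow> symb m w b \<Longrightarrow> symb (Suc m) w a"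
  by auto

lemma symb_SucE:
  assumes "symb (Suc m) w a"
  obtains b where "\<And>i x. (a i has_vector_derivative b i x) (at x)" "symb m w b"
  using assms by auto

lemma symb_continuous: "symb m w a \<Longrightarrow> continuous_on UNIV (a i)"
proof (cases m)
  case (Suc k)
  assume "symb m w a"
  then obtain b where "\<And>i x. (a i has_vector_derivative b i x) (at x)" using Suc by auto
  then have "isCont (a i) x" for x by (rule has_vector_derivative_continuous)
  then show ?thesis by (simp add: continuous_at_imp_continuous_on)
qed auto

lemma symb_Suc_imp: "symb (Suc m) w a \<Longrightarrow> symb m w a"
proof (induction m arbitrary: a)
  case 0
  then show ?case using symb_continuous[OF 0] by auto
next
  case (Suc m)
  then show ?case by (metis symb.simps(2))
qed

lemma symb_le: "symb m w a \<Longrightarrow> k \<le> m \<Longrightarrow> symb k w a"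
proof (induction m)
  case (Suc m)
  then show ?case by (metis le_Suc_eq symb_Suc_imp)
qed simp

lemma symb_weight_mono:
  assumes "\<And>x. w x \<le> B * w' x" "\<And>x. 0 \<le> w x"
  shows "symb m w a \<Longrightarrow> symb m w' a"
proof (induction m arbitrary: a)
  case 0
  then show ?case using dominated_weight_mono[of w B w', OF assms] by auto
next
  case (Suc m)
  then show ?case using dominated_weight_mono[of w B w', OF assms] unfolding symb.simps by blast
qed

lemma symb_add:
  "symb m w a \<Longrightarrow> symb m w b \<Longrightarrow> symb m w (\<lambda>i x. a i x + b i x)"
proof (induction m arbitrary: a b)
  case (0 a b)
  then show ?case by (auto intro: continuous_on_add dominated_add)
next
  case (Suc m a b)
  obtain a' b' where "\<And>i x. (a i has_vector_derivative a' i x) (at x)" "symb m w a'"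
     "\<And>i x. (b i has_vector_derivative b' i x) (at x)" "symb m w b'"
    using Suc.prems by auto
  then show ?case using Suc.IH[of a' b'] Suc.prems
    by (intro symb_SucI[where b="\<lambda>i x. a' i x + b' i x"] has_vector_derivative_add dominated_add symb_dominated)
qed

lemma symb_mult:
  "symb m w a \<Longrightarrow> symb m w' b \<Longrightarrow> symb m (\<lambda>x. w x * w' x) (\<lambda>i x. a i x * b i x)"
proof (induction m arbitrary: a b)
  case (0 a b)
  then show ?case by (auto intro: continuous_on_mult dominated_mult)
next
  case (Suc m a b)
  obtain a' where a': "\<And>i x. (a i has_vector_derivative a' i x) (at x)" "symb m w a'"
    using Suc.prems(1) by (rule symb_SucE) blast
  obtain b' where b': "\<And>i x. (b i has_vector_derivative b' i x) (at x)" "symb m w' b'"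
    using Suc.prems(2) by (rule symb_SucE) blast
  show ?case
  proof (rule symb_SucI)
    show "dominated (\<lambda>x. w x * w' x) (\<lambda>i x. a i x * b i x)"
      by (intro dominated_mult symb_dominated[OF Suc.prems(1)] symb_dominated[OF Suc.prems(2)])
    show "((\<lambda>x. a i x * b i x) has_vector_derivative a i x * b' i x + a' i x * b i x) (at x)" for i x
      by (intro has_vector_derivative_mult a' b')
    show "symb m (\<lambda>x. w x * w' x) (\<lambda>i x. a i x * b' i x + a' i x * b i x)"
      by (intro symb_add Suc.IH[OF symb_Suc_imp[OF Suc.prems(1)] b'(2)]
          Suc.IH[OF a'(2) symb_Suc_imp[OF Suc.prems(2)]])
  qed
qed

lemma symb_chain:
  assumes "\<And>j i x. j < m \<Longrightarrow> (Y j i has_vector_derivative Y (Suc j) i x) (at x)"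
    and "\<And>i. continuous_on UNIV (Y m i)"
    and "\<And>j. j \<le> m \<Longrightarrow> dominated w (Y j)"
  shows "symb m w (Y 0)"
  using assms
proof (induction m arbitrary: Y)
  case 0
  then show ?case by auto
next
  case (Suc m)
  have "symb m w (\<lambda>i. Y (Suc 0) i)"
    using Suc.prems by (intro Suc.IH[of "\<lambda>j. Y (Suc j)"]) auto
  then show ?case using Suc.prems(1)[of 0] Suc.prems(3)[of 0] by auto
qed

lemma symb_zero: "symb m w (\<lambda>(i::'i) x. 0)"
proof -
  have "dominated w (\<lambda>(i::'i) x. 0)" by (rule dominatedI[where C=0]) simp
  then show ?thesis using symb_chain[of m "\<lambda>j (i::'i) x. 0" w] by simp
qed

lemma symb_const: "symb m (\<lambda>x. 1) (\<lambda>(i::'i) x. c)"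
proof -
  have "dominated (\<lambda>x. 1) (\<lambda>(i::'i) x. if j = 0 then c else 0)" for j :: nat
    by (rule dominatedI[where C="cmod c"]) auto
  then show ?thesis
    using symb_chain[of m "\<lambda>j (i::'i) x. if j = 0 then c else 0" "\<lambda>x. 1"] by simp
qed

lemma symb_scale: 
  assumes "symb m w a" shows "symb m w (\<lambda>i x. c * a i x)"
  using symb_mult[OF symb_const[of m c] assms] by simp

lemma symb_power:
  assumes "symb m w a"
  shows "symb m (\<lambda>x. w x ^ k) (\<lambda>i x. a i x ^ k)"
proof (induction k)
  case 0
  show ?case using symb_const[of m 1] by simp
next
  case (Suc k)
  show ?case using symb_mult[OF assms Suc] by simp
qed

text \<open>
  The derivative of \<open>v powr p\<close> is \<open>p * v powr (p - 1) * v'\<close>, where \<open>v'\<close> is of size \<open>v\<close> by hypothesis;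
  hence the induction on \<open>m\<close> has to be carried out for all exponents \<open>p\<close> at once.
\<close>

lemma symb_powr:
  fixes v :: "real \<Rightarrow> real"
  assumes pos: "\<And>x. v x > 0" and C: "C_times m v"
    and bd: "\<And>k. 1 \<le> k \<Longrightarrow> k \<le> m \<Longrightarrow> bounded (range (\<lambda>x. nth_vderiv k v x / v x))"
  shows "symb m (\<lambda>x. v x powr p) (\<lambda>i::'i. \<lambda>x. complex_of_real (v x powr p))"
  using C bd
proof (induction m arbitrary: p)
  case 0
  have "continuous_on UNIV (\<lambda>x. complex_of_real (v x powr p))"
    using 0 pos by (intro continuous_intros) (auto simp: less_imp_neq[symmetric])
  then show ?case by (auto intro!: dominatedI[where C=1])
next
  case (Suc m)
  have bnd: "dominated v (\<lambda>(i::'i) x. complex_of_real (nth_vderiv (Suc j) v x))" if "j \<le> m" for j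
  proof -
    obtain B where B: "\<And>x. \<bar>nth_vderiv (Suc j) v x / v x\<bar> \<le> B"
      using Suc.prems(2)[of "Suc j"] \<open>j \<le> m\<close> by (auto simp: bounded_real)
    then have "\<bar>nth_vderiv (Suc j) v x\<bar> \<le> B * v x" for x
      using pos[of x] B[of x] by (simp add: abs_divide divide_le_eq)
    then show ?thesis by (intro dominatedI[where C=B]) simp
  qed
  have v': "symb m v (\<lambda>i::'i. \<lambda>x. complex_of_real (nth_vderiv (Suc 0) v x))"
  proof (intro symb_chain[where Y="\<lambda>j i x. complex_of_real (nth_vderiv (Suc j) v x)"]
      has_vector_derivative_of_real continuous_on_of_real)
    fix j x assume "j < m"
    then show "(nth_vderiv (Suc j) v has_field_derivative nth_vderiv (Suc (Suc j)) v x) (at x)"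
      unfolding has_real_derivative_iff_has_vector_derivative
      by (intro nth_vderiv_has_vector_derivative[OF Suc.prems(1)]) simp
  qed (use Suc.prems(1) bnd in \<open>auto simp: C_times_def\<close>)
  have "symb m (\<lambda>x. v x powr (p - 1)) (\<lambda>i::'i. \<lambda>x. complex_of_real (v x powr (p - 1)))"
    using Suc.prems C_times_SucD by (intro Suc.IH) auto
  from symb_mult[OF symb_scale[OF this] v']
  have "symb m (\<lambda>x. v x powr (p - 1) * v x)
     (\<lambda>i::'i. \<lambda>x. complex_of_real p * complex_of_real (v x powr (p - 1)) * complex_of_real (nth_vderiv
         (Suc 0) v x))" .
  moreover have "v x powr (p - 1) * v x = v x powr p" for x
    using pos[of x] by (simp add: powr_diff)
  moreover have "((\<lambda>x. complex_of_real (v x powr p)) has_vector_derivative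
      complex_of_real p * complex_of_real (v x powr (p - 1)) * complex_of_real (nth_vderiv (Suc 0) v x))
          (at x)" for x
  proof -
    have "(v has_vector_derivative nth_vderiv (Suc 0) v x) (at x)"
      using nth_vderiv_has_vector_derivative[OF Suc.prems(1), of 0] by simp
    then have "((\<lambda>x. v x powr p) has_vector_derivative p * v x powr (p - 1) * nth_vderiv (Suc 0) v x) (at x)"
      using pos[of x] unfolding has_real_derivative_iff_has_vector_derivative[symmetric]
      by (intro DERIV_chain2[OF has_real_derivative_powr])
    then show ?thesis
      unfolding has_real_derivative_iff_has_vector_derivative[symmetric]
      by (auto dest: has_vector_derivative_of_real)
  qed
  moreover have "dominated (\<lambda>x. v x powr p) (\<lambda>(i::'i) x. complex_of_real (v x powr p))"
    by (rule dominatedI[where C=1]) simp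
  ultimately show ?case
    by (intro symb_SucI[where b="\<lambda>i x. complex_of_real p * complex_of_real (v x powr (p - 1)) *
        complex_of_real (nth_vderiv (Suc 0) v x)"])
      simp_all
qed

lemma symb_affine:
  assumes "C_times k S" "\<And>j. j \<le> k \<Longrightarrow> bounded (range (nth_vderiv j S))" "\<And>n. \<bar>c n\<bar> \<le> B"
  shows "symb k (\<lambda>x. 1) (\<lambda>n x. complex_of_real (S (c n * x + d n)))"
proof -
  let ?Y = "\<lambda>j n x. complex_of_real (c n ^ j * nth_vderiv j S (c n * x + d n))"
  have "symb k (\<lambda>x. 1) (?Y 0)"
  proof (rule symb_chain)
    fix j n x assume j: "j < k"
    have "((\<lambda>x. c n ^ j * nth_vderiv j S (c n * x + d n)) has_field_derivative
        c n ^ j * (nth_vderiv (Suc j) S (c n * x + d n) * c n)) (at x)"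
      using nth_vderiv_has_vector_derivative[OF assms(1) j]
      by (intro DERIV_cmult DERIV_chain2[where f="nth_vderiv j S"])
        (auto simp: has_real_derivative_iff_has_vector_derivative[symmetric] intro!: derivative_eq_intros)
    then show "(?Y j n has_vector_derivative ?Y (Suc j) n x) (at x)"
      by (intro has_vector_derivative_of_real) (simp add: has_real_derivative_iff_has_vector_derivative mult_ac)
  next
    fix n
    have "continuous_on UNIV (nth_vderiv k S)" using assms(1) by (simp add: C_times_def)
    then have "continuous_on UNIV (\<lambda>x. nth_vderiv k S (c n * x + d n))"
      by (rule continuous_on_compose2) (auto intro!: continuous_intros)
    then show "continuous_on UNIV (?Y k n)"
      by (intro continuous_on_of_real continuous_on_mult continuous_on_const)
  next
    fix j assume "j \<le> k"
    then obtain D where D: "\<And>x. \<bar>nth_vderiv j S x\<bar> \<le> D" using assms(2) by (force simp: bounded_real)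
    have "cmod (?Y j n x) \<le> (B ^ j * D) * 1" for n x
      using assms(3)[of n] D[of "c n * x + d n"]
      by (simp only: norm_of_real abs_mult power_abs mult_1_right)
        (intro mult_mono power_mono, auto intro: order_trans[OF abs_ge_zero])
    then show "dominated (\<lambda>x. 1) (?Y j)" by (rule dominatedI)
  qed
  then show ?thesis by simp
qed

section \<open>The operator on compactly supported functions\<close>

locale weight =
  fixes K :: nat and Q :: "real poly" and v :: "real \<Rightarrow> real"
  assumes K1: "K \<ge> 1" and deg: "degree Q = K" and vC: "C_times K v"
    and v_bdd: "bounded (range v)" and v_pos: "\<And>x. v x > 0"

begin

lemma K_pos: "K > 0" using K1 by simp

lemma coeff_K_nonzero: "coeff Q K \<noteq> 0"
  using deg K1 by auto

lemma inverse_v_C_times: "C_times K (\<lambda>x. inverse (v x))"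
  using v_pos by (intro C_times_inverse vC) (auto simp: less_imp_neq[symmetric])

lemma v_continuous: "continuous_on UNIV v"
  using vC C_times_imp_continuous by blast

text \<open>
  The substitution \<open>w = v g\<close> is a bijection of the domain, since \<open>v\<close> is \<open>K\<close> times continuously
  differentiable and positive. It moves the weight out of the differential operator.
\<close>

lemma A0_memI:
  assumes "w \<in> C0_times K"
  shows "((\<lambda>x. w x / of_real (v x)), (\<lambda>x. of_real (v x) * poly_D Q w x)) \<in> A0_op Q v"
proof -
  have "C_times K (\<lambda>x. complex_of_real (inverse (v x)) * w x)"
    using assms by (intro C_times_mult C_times_of_real inverse_v_C_times) (auto simp: C0_times_iff)
  then have C: "C_times K (\<lambda>x. w x / complex_of_real (v x))"
    by (simp add: divide_inverse mult.commute)
  have "(\<lambda>x. w x / complex_of_real (v x)) \<in> C0_times K"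
    unfolding C0_times_iff using C assms by (auto simp: C0_times_iff)
  moreover have "(\<lambda>x. complex_of_real (v x) * (w x / complex_of_real (v x))) = w"
    using v_pos by (auto simp: fun_eq_iff less_imp_neq[symmetric])
  ultimately show ?thesis
    unfolding A0_op_def mem_Collect_eq deg by (intro exI[of _ "\<lambda>x. w x / complex_of_real (v x)"]) simp
qed

lemma A0_memE:
  assumes "(g, h) \<in> A0_op Q v"
  obtains w where "w \<in> C0_times K" "g = (\<lambda>x. w x / of_real (v x))" "h = (\<lambda>x. of_real (v x) * poly_D Q w x)"
proof -
  from assms have g: "g \<in> C0_times K" and h: "h = (\<lambda>x. of_real (v x) * poly_D Q (\<lambda>y. of_real (v y) * g y) x)"
    by (auto simp: A0_op_def deg)
  have "C_times K (\<lambda>y. complex_of_real (v y) * g y)"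
    using g by (intro C_times_mult C_times_of_real vC) (auto simp: C0_times_iff)
  then have "(\<lambda>y. complex_of_real (v y) * g y) \<in> C0_times K"
    using g by (auto simp: C0_times_iff)
  moreover have "g = (\<lambda>x. of_real (v x) * g x / of_real (v x))"
    using v_pos by (auto simp: fun_eq_iff less_imp_neq[symmetric])
  ultimately show thesis using that h by blast
qed

lemma A0_L2:
  assumes "(g, h) \<in> A0_op Q v"
  shows "g \<in> L2" "h \<in> L2"
proof -
  obtain w where w: "w \<in> C0_times K" and gh: "g = (\<lambda>x. w x / of_real (v x))" "h = (\<lambda>x. of_real (v x) *
      poly_D Q w x)"
    using A0_memE[OF assms] by metis
  obtain R where R: "\<And>x. \<bar>x\<bar> > R \<Longrightarrow> w x = 0" using w by (auto simp: C0_times_iff)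
  have wC: "C_times K w" using w by (simp add: C0_times_iff)
  show "g \<in> L2" unfolding gh
    using v_continuous v_pos C_times_imp_continuous[OF wC] R
    by (intro continuous_support_L2[where R=R] continuous_intros) (auto simp: less_imp_neq[symmetric])
  show "h \<in> L2" unfolding gh
    using v_continuous poly_D_continuous[of Q w] wC poly_D_eq_0_outside[of R w, OF R] deg
    by (intro continuous_support_L2[where R=R] continuous_intros) auto
qed

lemma A0_subset_A: "A0_op Q v \<subseteq> A_op Q v"
  unfolding A_op_def op_closure_def using A0_L2 L2_lim_const by fast

lemma A0_zero: "(\<lambda>x. 0, \<lambda>x. 0) \<in> A0_op Q v"
proof -
  have w: "(\<lambda>x. 0) \<in> C0_times K" by (auto simp: C0_times_iff C_times_const)
  have "poly_D Q (\<lambda>x. 0) x = 0" for x by (rule poly_D_eq_0_outside[of "-1"]) auto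
  then show ?thesis using A0_memI[OF w] by simp
qed

lemma A0_linear:
  assumes "(g, h) \<in> A0_op Q v" "(g', h') \<in> A0_op Q v"
  shows "(\<lambda>x. a * g x + g' x, \<lambda>x. a * h x + h' x) \<in> A0_op Q v"
proof -
  obtain w where w: "w \<in> C0_times K" "g = (\<lambda>x. w x / of_real (v x))" "h = (\<lambda>x. of_real (v x) * poly_D Q w x)"
    using A0_memE[OF assms(1)] by metis
  obtain w' where w': "w' \<in> C0_times K" "g' = (\<lambda>x. w' x / of_real (v x))" "h' = (\<lambda>x. of_real (v x) *
      poly_D Q w' x)"
    using A0_memE[OF assms(2)] by metis
  obtain R R' where R: "R \<ge> 0" "\<And>x. \<bar>x\<bar> > R \<Longrightarrow> w x = 0" "R' \<ge> 0" "\<And>x. \<bar>x\<bar> > R' \<Longrightarrow> w' x = 0"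
      and C: "C_times K w" "C_times K w'" using w w' by (auto simp: C0_times_iff)
  have aC: "C_times K (\<lambda>x. a * w x)" by (intro C_times_mult C_times_const C)
  have mem: "(\<lambda>x. a * w x + w' x) \<in> C0_times K"
    unfolding C0_times_iff using C_times_add[OF aC C(2)] R by (auto intro!: exI[of _ "max R R'"])
  have "poly_D Q (\<lambda>x. a * w x + w' x) x = a * poly_D Q w x + poly_D Q w' x" for x
  proof -
    have "nth_vderiv k (\<lambda>x. a * w x + w' x) x = a * nth_vderiv k w x + nth_vderiv k w' x" if "k \<le> K" for k
      using nth_vderiv_add[OF aC C(2) that] nth_vderiv_linear[OF bounded_linear_mult_right C(1) that, of
          a] by simp
    then show ?thesis
      unfolding poly_D_def deg sum_distrib_left sum.distrib[symmetric]
      by (intro sum.cong refl) (simp add: algebra_simps)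
  qed
  then show ?thesis using A0_memI[OF mem] by (simp add: w w' add_divide_distrib algebra_simps)
qed

section \<open>Approximate eigenfunctions\<close>

lemma v_powr_mono:
  assumes "s \<le> t"
  obtains B where "\<And>x. v x powr t \<le> B * v x powr s"
proof -
  obtain b where b: "\<And>x. \<bar>v x\<bar> \<le> b" using v_bdd by (auto simp: bounded_real)
  have "v x powr t \<le> b powr (t - s) * v x powr s" for x
  proof -
    have "v x powr t = v x powr (t - s) * v x powr s" by (simp add: powr_add[symmetric])
    also have "\<dots> \<le> b powr (t - s) * v x powr s"
      using b[of x] v_pos[of x] assms by (intro mult_right_mono powr_mono2) auto
    finally show ?thesis .
  qed
  then show thesis using that by blast
qed

text \<open>
  Approximate solutions of \<open>v Q(D) w = \<lambda> w / v\<close>, where \<open>\<lambda> = q c^K\<close> with \<open>q\<close> the leading coefficient. In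
  the WKB form \<open>w = \<phi> exp (-\<i> \<theta>)\<close> the derivative \<open>D\<close> acts as multiplication by \<open>\<theta>'\<close> to leading order, so
  \<open>\<theta>' = c v powr (-2/K)\<close> solves the leading order equation \<open>q (\<theta>')^K = \<lambda> / v\<^sup>2\<close>. Every term in which a
  derivative does not fall on the exponential contains one factor of size \<open>v powr (-2/K)\<close> fewer;
  because \<open>v\<close> is bounded, all these terms and those from the lower order coefficients of \<open>Q\<close> are
  controlled by \<open>v powr (-2 (K-1)/K)\<close>.
\<close>

lemma quasimodes:
  fixes c :: real
  assumes bd: "\<And>k. 1 \<le> k \<Longrightarrow> k \<le> K - 1 \<Longrightarrow> bounded (range (\<lambda>\<xi>. nth_vderiv k v \<xi> / v \<xi>))"
    and \<phi>: "symb K (\<lambda>x. 1) \<phi>"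
  obtains w :: "'i \<Rightarrow> real \<Rightarrow> complex" and C where
    "\<And>n. C_times K (w n)" "\<And>n x. cmod (w n x) = cmod (\<phi> n x)"
    "\<And>n x. cmod (of_real (v x) * poly_D Q (w n) x - of_real (coeff Q K * c ^ K) * (w n x / of_real (v x)))
       \<le> C * v x powr (-1 + 2 / K)"
proof -
  \<comment> \<open>The weight \<open>wt s\<close> is the size of \<open>s\<close> factors \<open>\<theta>'\<close>; \<open>s\<close> is real because the remainder in step \<open>0\<close> is assigned the
      weight \<open>wt (-1)\<close>.\<close>
  define wt where "wt s x = v x powr (-2 * s / K)" for s x
  have wt_pos: "wt s x > 0" for s x using v_pos[of x] by (simp add: wt_def)
  have wt0: "wt 0 = (\<lambda>x. 1)"
    using v_pos by (simp add: wt_def[abs_def] less_imp_neq[symmetric])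
  have wt_nn: "0 \<le> wt s x" for s x using wt_pos less_imp_le by blast
  have wt_mult: "wt s x * wt t x = wt (s + t) x" for s t x
    unfolding wt_def powr_add[symmetric] by (simp add: distrib_left add_divide_distrib diff_divide_distrib)
  have wt_power: "wt s x ^ n = wt (real n * s) x" for s x n
    using v_pos[of x] by (simp add: wt_def powr_powr[symmetric] powr_realpow[symmetric] powr_powr algebra_simps)
  have up: "symb m (wt t) a" if sa: "symb m (wt s) a" and st: "s \<le> t" for m s t and a :: "'i \<Rightarrow> real \<Rightarrow> complex"
  proof -
    obtain B where "\<And>x. wt s x \<le> B * wt t x"
      using v_powr_mono[of "-2 * t / K" "-2 * s / K"] st
      unfolding wt_def by (auto simp: divide_right_mono)
    then show ?thesis by (rule symb_weight_mono[OF _ wt_nn sa])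
  qed
  define \<tau> where "\<tau> x = c * v x powr (-2 / K)" for x
  have "symb (K - 1) (\<lambda>x. v x powr (-2 / K)) (\<lambda>(i::'i) x. complex_of_real (v x powr (-2 / K)))"
    using C_times_mono[OF vC] by (intro symb_powr v_pos bd) auto
  from symb_scale[OF this, of "of_real c"]
  have \<tau>: "symb (K - 1) (wt 1) (\<lambda>(i::'i) x. of_real (\<tau> x))"
    by (simp add: wt_def[abs_def] \<tau>_def mult.commute)
  have \<tau>k: "symb (K - 1) (wt k) (\<lambda>(i::'i) x. of_real (\<tau> x) ^ k)" for k :: nat
    using symb_power[OF \<tau>, of k] by (simp add: wt_power)
  have "continuous_on UNIV \<tau>"
    unfolding \<tau>_def using v_continuous v_pos by (intro continuous_intros) (auto simp: less_imp_neq[symmetric])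
  then have \<tau>c: "continuous_on UNIV (\<lambda>x. complex_of_real (\<tau> x))" by (rule continuous_on_of_real)
  define \<theta> where "\<theta> x = Re (prim (\<lambda>x. of_real (\<tau> x)) x)" for x
  have \<theta>: "(\<theta> has_vector_derivative \<tau> x) (at x)" for x
    unfolding \<theta>_def[abs_def]
    using bounded_linear.has_vector_derivative[OF bounded_linear_Re prim_has_vector_derivative[OF \<tau>c]] by simp
  define E where "E x = exp (- \<i> * of_real (\<theta> x))" for x
  have E': "(E has_vector_derivative (- \<i> * of_real (\<tau> x) * E x)) (at x)" for x
  proof -
    have "((\<lambda>x. - \<i> * complex_of_real (\<theta> x)) has_vector_derivative - \<i> * of_real (\<tau> x)) (at x)"
      using has_vector_derivative_of_real[OF \<theta>[folded has_real_derivative_iff_has_vector_derivative]]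
      by (rule has_vector_derivative_mult_right)
    from field_vector_diff_chain_at[OF this DERIV_exp]
    show ?thesis by (simp add: E_def[abs_def] o_def)
  qed
  have normE: "cmod (E x) = 1" for x by (simp add: E_def)
  have E_cont: "continuous_on UNIV E"
    by (rule continuous_at_imp_continuous_on) (auto intro: has_vector_derivative_continuous[OF E'])
  define w where "w n x = \<phi> n x * E x" for n x
  define f where "f k r n x = (\<phi> n x * of_real (\<tau> x) ^ k + r n x :: complex)" for k r and n :: 'i and x
  have f_symb: "symb (K - k) (wt k) (f k r)" if "symb (K - k) (wt (real k - 1)) r" for k r
  proof -
    have "symb (K - k) (wt k) (\<lambda>n x. \<phi> n x * of_real (\<tau> x) ^ k)"
    proof (cases "k = 0")
      case True
      then show ?thesis using \<phi> by (simp add: wt0)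
    next
      case False
      then have "symb (K - k) (\<lambda>x. 1 * wt k x) (\<lambda>n x. \<phi> n x * of_real (\<tau> x) ^ k)"
        by (intro symb_mult symb_le[OF \<phi>] symb_le[OF \<tau>k]) auto
      then show ?thesis by simp
    qed
    moreover have "symb (K - k) (wt k) r" using that by (rule up) simp
    ultimately show ?thesis unfolding f_def[abs_def] by (rule symb_add)
  qed
  \<comment> \<open>One differentiation of \<open>(- \<i>)^k E (\<phi> \<tau>^k + r)\<close>: the derivative of \<open>E\<close> contributes a factor \<open>\<tau>\<close>, everything
      else goes into the new remainder.\<close>
  have step: "\<exists>r. symb (K - Suc k) (wt (real (Suc k) - 1)) r \<and>
       (\<forall>n x. ((\<lambda>x. (- \<i>) ^ k * E x * f k r0 n x) has_vector_derivative (- \<i>) ^ Suc k * E x * f (Suc k) r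
           n x) (at x))"
    if r0: "symb (K - k) (wt (real k - 1)) r0" and k: "k < K" for k r0
  proof -
    have "symb (Suc (K - Suc k)) (wt k) (f k r0)" using f_symb[OF r0] k by (simp add: Suc_diff_Suc)
    then obtain f' where f': "\<And>n x. (f k r0 n has_vector_derivative f' n x) (at x)" "symb (K - Suc k) (wt k) f'"
      by auto
    define r where "r n x = of_real (\<tau> x) * r0 n x + \<i> * f' n x" for n x
    have "symb (K - Suc k) (\<lambda>x. wt 1 x * wt (real k - 1) x) (\<lambda>n x. of_real (\<tau> x) * r0 n x)"
      by (intro symb_mult symb_le[OF \<tau>] symb_le[OF r0]) auto
    then have "symb (K - Suc k) (wt k) (\<lambda>n x. of_real (\<tau> x) * r0 n x)" by (simp add: wt_mult)
    moreover have "symb (K - Suc k) (wt k) (\<lambda>n x. \<i> * f' n x)"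
      using f'(2) by (rule symb_scale)
    ultimately have "symb (K - Suc k) (wt (real (Suc k) - 1)) r"
      unfolding r_def[abs_def] by (simp add: symb_add)
    moreover have "((\<lambda>x. (- \<i>) ^ k * E x * f k r0 n x) has_vector_derivative (- \<i>) ^ Suc k * E x * f (Suc
        k) r n x) (at x)" for n x
    proof -
      have "((\<lambda>x. (- \<i>) ^ k * E x * f k r0 n x) has_vector_derivative
          (- \<i>) ^ k * E x * f' n x + (- \<i>) ^ k * (- \<i> * of_real (\<tau> x) * E x) * f k r0 n x) (at x)"
        by (intro has_vector_derivative_mult has_vector_derivative_mult_right f' E')
      also have "(- \<i>) ^ k * E x * f' n x + (- \<i>) ^ k * (- \<i> * of_real (\<tau> x) * E x) * f k r0 n x
          = (- \<i>) ^ Suc k * E x * f (Suc k) r n x"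
      proof -
        have "f' n x = - \<i> * (\<i> * f' n x)" by (simp add: mult.assoc[symmetric])
        then have "(- \<i>) ^ k * E x * f' n x = (- \<i>) ^ Suc k * E x * (\<i> * f' n x)"
          by (simp add: mult_ac)
        then show ?thesis by (simp add: f_def r_def algebra_simps)
      qed
      finally show ?thesis .
    qed
    ultimately show ?thesis by blast
  qed
  have main: "\<exists>r. symb (K - k) (wt (real k - 1)) r \<and> (\<forall>n x. nth_vderiv k (w n) x = (- \<i>) ^ k * E x * f k r n x)"
    if "k \<le> K" for k
    using that
  proof (induction k)
    case 0
    have "symb K (wt (- 1)) (\<lambda>(n::'i) x. 0 :: complex)" by (rule symb_zero)
    then show ?case by (intro exI[of _ "\<lambda>n x. 0"]) (simp add: w_def f_def)
  next
    case (Suc k)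
    then obtain r0 where r0: "symb (K - k) (wt (real k - 1)) r0"
      "\<And>n x. nth_vderiv k (w n) x = (- \<i>) ^ k * E x * f k r0 n x" by auto
    then have eq: "nth_vderiv k (w n) = (\<lambda>x. (- \<i>) ^ k * E x * f k r0 n x)" for n by auto
    from step[OF r0(1)] Suc.prems obtain r where r: "symb (K - Suc k) (wt (real (Suc k) - 1)) r"
       "\<And>n x. ((\<lambda>x. (- \<i>) ^ k * E x * f k r0 n x) has_vector_derivative (- \<i>) ^ Suc k * E x * f (Suc k) r
           n x) (at x)"
      by auto
    have "nth_vderiv (Suc k) (w n) x = (- \<i>) ^ Suc k * E x * f (Suc k) r n x" for n x
      unfolding nth_vderiv_Suc eq by (rule vector_derivative_at[OF r(2)])
    then show ?case using r(1) by blast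
  qed
  then obtain r where r: "\<And>k. k \<le> K \<Longrightarrow> symb (K - k) (wt (real k - 1)) (r k)"
    "\<And>k n x. k \<le> K \<Longrightarrow> nth_vderiv k (w n) x = (- \<i>) ^ k * E x * f k (r k) n x"
    by metis
  then have eq: "k \<le> K \<Longrightarrow> nth_vderiv k (w n) = (\<lambda>x. (- \<i>) ^ k * E x * f k (r k) n x)" for k n by auto
  have C: "C_times K (w n)" for n
    unfolding C_times_def
  proof (intro conjI allI impI)
    fix k x assume "k < K"
    then show "nth_vderiv k (w n) differentiable at x"
      using step[OF r(1), of k] by (auto simp: eq intro: differentiableI_vector)
  next
    show "continuous_on UNIV (nth_vderiv K (w n))"
      using symb_continuous[OF f_symb[OF r(1)], of K n] E_cont by (auto simp: eq intro!: continuous_intros)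
  qed
  have norm: "cmod (w n x) = cmod (\<phi> n x)" for n x by (simp add: w_def norm_mult normE)
  define err where "err n x = (\<Sum>k<K. of_real (coeff Q k) * f k (r k) n x) + of_real (coeff Q K) * r K n x"
      for n x
  have "\<exists>B. \<forall>n x. cmod (err n x) \<le> B * wt (real K - 1) x"
  proof -
    have "\<exists>B. \<forall>n x. cmod (f k (r k) n x) \<le> B * wt (real K - 1) x" if "k < K" for k
    proof -
      have "symb (K - k) (wt (real K - 1)) (f k (r k))"
        using that by (intro up[OF f_symb[OF r(1)]]) auto
      then obtain D where "\<And>n x. cmod (f k (r k) n x) \<le> D * wt (real K - 1) x"
        by (rule symb_dominated[THEN dominatedE]) blast
      then show ?thesis by blast
    qed
    then obtain B where B: "\<And>k n x. k < K \<Longrightarrow> cmod (f k (r k) n x) \<le> B k * wt (real K - 1) x" by metis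
    obtain B' where B': "\<And>n x. cmod (r K n x) \<le> B' * wt (real K - 1) x"
      using symb_dominated[OF r(1)[OF order_refl]] by (rule dominatedE) blast
    have "cmod (err n x) \<le> ((\<Sum>k<K. \<bar>coeff Q k\<bar> * B k) + \<bar>coeff Q K\<bar> * B') * wt (real K - 1) x" for n x
    proof -
      have "cmod (err n x) \<le> (\<Sum>k<K. cmod (of_real (coeff Q k) * f k (r k) n x)) + cmod (of_real (coeff Q
          K) * r K n x)"
        unfolding err_def by (intro norm_triangle_le add_mono norm_sum) auto
      also have "\<dots> \<le> (\<Sum>k<K. \<bar>coeff Q k\<bar> * (B k * wt (real K - 1) x)) + \<bar>coeff Q K\<bar> * (B' * wt (real K - 1) x)"
        unfolding norm_mult norm_of_real by (intro add_mono sum_mono mult_left_mono B B') auto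
      finally show ?thesis by (simp add: sum_distrib_right distrib_right mult.assoc)
    qed
    then show ?thesis by blast
  qed
  then obtain B where B: "\<And>n x. cmod (err n x) \<le> B * wt (real K - 1) x" by blast
  have poly: "poly_D Q (w n) x = E x * (of_real (coeff Q K * \<tau> x ^ K) * \<phi> n x + err n x)" for n x
  proof -
    have i: "\<i> ^ k * (- \<i>) ^ k = 1" for k by (simp add: power_mult_distrib[symmetric])
    have "poly_D Q (w n) x = (\<Sum>k\<le>K. of_real (coeff Q k) * (\<i> ^ k * (- \<i>) ^ k) * E x * f k (r k) n x)"
      unfolding poly_D_def deg by (intro sum.cong refl) (simp add: eq mult_ac)
    also have "\<dots> = E x * ((\<Sum>k<K. of_real (coeff Q k) * f k (r k) n x) + of_real (coeff Q K) * f K (r K) n x)"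
      unfolding i by (simp add: lessThan_Suc_atMost[symmetric] sum_distrib_left algebra_simps)
    finally show ?thesis by (simp add: err_def f_def algebra_simps)
  qed
  have "cmod (of_real (v x) * poly_D Q (w n) x - of_real (coeff Q K * c ^ K) * (w n x / of_real (v x)))
       \<le> B * v x powr (-1 + 2 / K)" for n x
  proof -
    have "\<tau> x ^ K = c ^ K * v x powr (-2)"
      using K_pos v_pos[of x]
      by (simp add: \<tau>_def power_mult_distrib powr_realpow[symmetric] powr_powr)
    then have "v x * (coeff Q K * \<tau> x ^ K) = coeff Q K * c ^ K / v x"
      using v_pos[of x] by (simp add: powr_minus power2_eq_square field_simps)
    then have *: "complex_of_real (v x) * of_real (coeff Q K * \<tau> x ^ K) = of_real (coeff Q K * c ^ K / v x)"
      by (metis of_real_mult)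
    have "of_real (v x) * poly_D Q (w n) x - of_real (coeff Q K * c ^ K) * (w n x / of_real (v x))
      = E x * (of_real (v x) * err n x) + E x * \<phi> n x * (complex_of_real (v x) * of_real (coeff Q K * \<tau> x
          ^ K) - of_real (coeff Q K * c ^ K / v x))"
      unfolding poly w_def by (simp add: algebra_simps)
    then have "cmod (of_real (v x) * poly_D Q (w n) x - of_real (coeff Q K * c ^ K) * (w n x / of_real (v x)))
      = v x * cmod (err n x)"
      unfolding * using v_pos[of x] by (simp add: norm_mult normE)
    also have "\<dots> \<le> v x * (B * wt (real K - 1) x)"
      using v_pos[of x] by (intro mult_left_mono B) auto
    also have "\<dots> = B * (v x powr 1 * v x powr (-2 * (real K - 1) / K))"
      using v_pos[of x] by (simp add: wt_def)
    also have "\<dots> = B * v x powr (-1 + 2 / K)"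
      unfolding powr_add[symmetric] using K_pos by (simp add: field_simps)
    finally show ?thesis .
  qed
  with that C norm show thesis by blast
qed

text \<open>
  The two transition regions have length \<open>n \<delta>\<close>, so derivatives of the cutoffs are bounded uniformly
  in \<open>n\<close>. For \<open>n = 0\<close> the slope \<open>c n\<close> is \<open>0\<close> by the convention for division, and the cutoff vanishes.
\<close>

lemma cutoffs:
  fixes \<delta> :: real
  assumes "\<delta> > 0"
  obtains \<phi> :: "nat \<Rightarrow> real \<Rightarrow> complex" where
    "symb K (\<lambda>x. 1) \<phi>" "\<And>n x. n \<ge> 1 \<Longrightarrow> \<bar>x\<bar> \<le> real n \<Longrightarrow> \<phi> n x = 1"
    "\<And>n x. \<bar>x\<bar> > real n * (1 + \<delta>) \<Longrightarrow> \<phi> n x = 0"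
proof -
  obtain S :: "real \<Rightarrow> real" where S: "C_times K S" "\<And>t. t \<le> 0 \<Longrightarrow> S t = 0" "\<And>t. t \<ge> 1 \<Longrightarrow> S t = 1"
    "\<And>j. j \<le> K \<Longrightarrow> bounded (range (nth_vderiv j S))"
    using smooth_step[of K] by blast
  define c where "c n = inverse (real n * \<delta>)" for n
  define \<phi> where "\<phi> n x = complex_of_real (S (- c n * x + c n * (real n * (1 + \<delta>)))) *
      complex_of_real (S (c n * x + c n * (real n * (1 + \<delta>))))" for n x
  have c0: "c n \<ge> 0" for n using assms by (simp add: c_def)
  have c: "\<bar>c n\<bar> \<le> inverse \<delta>" for n
  proof (cases "n = 0")
    case False
    then have "\<delta> \<le> real n * \<delta>" using assms by simp
    from le_imp_inverse_le[OF this] show ?thesis using assms c0[of n] by (simp only: c_def) simp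
  qed (use assms in \<open>simp add: c_def\<close>)
  have "symb K (\<lambda>x. 1 * 1) \<phi>"
    unfolding \<phi>_def[abs_def]
    by (intro symb_mult symb_affine[OF S(1,4), where B="inverse \<delta>"]) (use c in auto)
  moreover have "\<phi> n x = 1" if n: "n \<ge> 1" and x: "\<bar>x\<bar> \<le> real n" for n x
  proof -
    have cp: "c n > 0" "c n * (real n * \<delta>) = 1" using n assms by (simp_all add: c_def field_simps)
    have "c n * (real n - x) \<ge> 0" "c n * (real n + x) \<ge> 0" using cp x by (intro mult_nonneg_nonneg; simp)+
    then have "- c n * x + c n * (real n * (1 + \<delta>)) \<ge> 1" "c n * x + c n * (real n * (1 + \<delta>)) \<ge> 1"
      using cp(2) by (simp_all add: algebra_simps)
    then show ?thesis using S(3) by (simp add: \<phi>_def)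
  qed
  moreover have "\<phi> n x = 0" if x: "\<bar>x\<bar> > real n * (1 + \<delta>)" for n x
  proof (cases "x > 0")
    case True
    then have "c n * (real n * (1 + \<delta>) - x) \<le> 0" using x c0[of n] by (intro mult_nonneg_nonpos) auto
    then have "- c n * x + c n * (real n * (1 + \<delta>)) \<le> 0" by (simp add: algebra_simps)
    then show ?thesis using S(2) by (simp add: \<phi>_def)
  next
    case False
    then have "c n * (real n * (1 + \<delta>) + x) \<le> 0" using x c0[of n] by (intro mult_nonneg_nonpos) auto
    then have "c n * x + c n * (real n * (1 + \<delta>)) \<le> 0" by (simp add: algebra_simps)
    then show ?thesis using S(2) by (simp add: \<phi>_def)
  qed
  ultimately show thesis using that[of \<phi>] by simp
qed

lemma v_powr_set_integrable: "set_integrable lborel {a..b} (\<lambda>\<xi>. v \<xi> powr p)"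
  using v_continuous v_pos
  by (intro borel_integrable_atLeastAtMost' continuous_intros)
    (auto simp: less_imp_neq[symmetric] intro: continuous_on_subset)

text \<open>
  The quasimodes \<open>g n = w n / v\<close> satisfy \<open>\<parallel>g n\<parallel>\<^sup>2 \<ge> J n\<close> and \<open>\<parallel>(A - \<lambda>) (g n)\<parallel>\<^sup>2 \<le> C\<^sup>2 (I n)\<close>, with \<open>J n\<close> and
  \<open>I n\<close> the denominator and the numerator of the quotient that tends to zero. A bounded inverse of
  \<open>A - \<lambda>\<close> would keep \<open>I n / J n\<close> away from zero.
\<close>

lemma in_spectrum:
  fixes c \<delta> :: real
  assumes bd: "\<And>k. 1 \<le> k \<Longrightarrow> k \<le> K - 1 \<Longrightarrow> bounded (range (\<lambda>\<xi>. nth_vderiv k v \<xi> / v \<xi>))"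
    and \<delta>: "\<delta> > 0"
    and lim: "(\<lambda>n::nat.
            (LBINT \<xi>:{- (real n * (1 + \<delta>))..real n * (1 + \<delta>)}. v \<xi> powr (- 2 + 4 / real K)) /
            (LBINT \<xi>:{- real n..real n}. v \<xi> powr (- 2))) \<longlonglongrightarrow> 0"
  shows "complex_of_real (coeff Q K * c ^ K) \<in> op_spectrum (A_op Q v)"
proof -
  let ?z = "complex_of_real (coeff Q K * c ^ K)"
  obtain \<phi> :: "nat \<Rightarrow> real \<Rightarrow> complex" where \<phi>:
    "symb K (\<lambda>x. 1) \<phi>" "\<And>n x. n \<ge> 1 \<Longrightarrow> \<bar>x\<bar> \<le> real n \<Longrightarrow> \<phi> n x = 1"
    "\<And>n x. \<bar>x\<bar> > real n * (1 + \<delta>) \<Longrightarrow> \<phi> n x = 0"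
    using cutoffs[OF \<delta>] by blast
  obtain w C where w: "\<And>n. C_times K (w n)" "\<And>n x. cmod (w n x) = cmod (\<phi> n x)"
    and C: "\<And>n x. cmod (of_real (v x) * poly_D Q (w n) x - ?z * (w n x / of_real (v x)))
       \<le> C * v x powr (-1 + 2 / K)"
    using quasimodes[OF bd \<phi>(1), of c] by blast
  define g where "g n x = w n x / complex_of_real (v x)" for n x
  define h where "h n x = complex_of_real (v x) * poly_D Q (w n) x" for n x
  have w0: "w n x = 0" if "\<bar>x\<bar> > real n * (1 + \<delta>)" for n x
    using w(2)[of n x] \<phi>(3)[OF that] by simp
  have A0: "(g n, h n) \<in> A0_op Q v" for n
    unfolding g_def h_def
  proof (rule A0_memI)
    show "w n \<in> C0_times K"
      unfolding C0_times_iff using w(1) w0 \<delta>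
      by (auto intro!: exI[of _ "real n * (1 + \<delta>)"])
  qed
  have "?z \<notin> resolvent_set (A_op Q v)"
  proof
    assume "?z \<in> resolvent_set (A_op Q v)"
    then obtain B where B: "\<And>g h. (g, h) \<in> A_op Q v \<Longrightarrow> L2norm g \<le> B * L2norm (\<lambda>x. h x - ?z * g x)"
      unfolding resolvent_set_def by blast
    \<comment> \<open>The numerator and the denominator of the quotient in the hypothesis.\<close>
    define I where "I n = (LBINT \<xi>:{- (real n * (1 + \<delta>))..real n * (1 + \<delta>)}. v \<xi> powr (- 2 + 4 / real K))" for n
    define J where "J n = (LBINT \<xi>:{- real n..real n}. v \<xi> powr (- 2))" for n
    have le: "J n \<le> B\<^sup>2 * C\<^sup>2 * I n" if n: "n \<ge> 1" for n
    proof -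
      have gh: "g n \<in> L2" "h n \<in> L2" using A0_L2[OF A0] by auto
      have "J n \<le> (L2norm (g n))\<^sup>2"
        unfolding J_def L2norm_sq set_lebesgue_integral_def
      proof (rule integral_mono)
        show "integrable lborel (\<lambda>\<xi>. indicator {- real n..real n} \<xi> *\<^sub>R v \<xi> powr - 2)"
          using v_powr_set_integrable unfolding set_integrable_def .
        show "integrable lborel (\<lambda>x. (cmod (g n x))\<^sup>2)" by (rule L2_integrable[OF gh(1)])
        fix \<xi>
        show "indicator {- real n..real n} \<xi> *\<^sub>R v \<xi> powr - 2 \<le> (cmod (g n \<xi>))\<^sup>2"
        proof (cases "\<bar>\<xi>\<bar> \<le> real n")
          case True
          then have "cmod (g n \<xi>) = 1 / v \<xi>"
            using \<phi>(2)[OF n True] v_pos[of \<xi>] by (simp add: g_def norm_divide w(2))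
          then show ?thesis using v_pos[of \<xi>]
            by (auto simp: indicator_def powr_minus power_divide inverse_eq_divide)
        qed (auto simp: indicator_def abs_le_iff)
      qed
      also have "\<dots> \<le> (B * L2norm (\<lambda>x. h n x - ?z * g n x))\<^sup>2"
        using B A0 A0_subset_A by (intro power_mono) auto
      also have "\<dots> = B\<^sup>2 * (L2norm (\<lambda>x. h n x - ?z * g n x))\<^sup>2" by (simp add: power_mult_distrib)
      also have "\<dots> \<le> B\<^sup>2 * (C\<^sup>2 * I n)"
      proof (rule mult_left_mono)
        let ?i = "\<lambda>\<xi>. indicator {- (real n * (1 + \<delta>))..real n * (1 + \<delta>)} \<xi> *\<^sub>R v \<xi> powr (- 2 + 4 / real K)"
        have "(L2norm (\<lambda>x. h n x - ?z * g n x))\<^sup>2 \<le>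
          (LBINT \<xi>. C\<^sup>2 * ?i \<xi>)"
          unfolding L2norm_sq
        proof (rule integral_mono)
          show "integrable lborel (\<lambda>x. (cmod (h n x - ?z * g n x))\<^sup>2)"
            by (intro L2_integrable L2_diff L2_scale gh)
          show "integrable lborel (\<lambda>\<xi>. C\<^sup>2 * ?i \<xi>)"
            using v_powr_set_integrable unfolding set_integrable_def by (rule integrable_mult_right)
          fix \<xi>
          show "(cmod (h n \<xi> - ?z * g n \<xi>))\<^sup>2 \<le>
            C\<^sup>2 * ?i \<xi>"
          proof (cases "\<bar>\<xi>\<bar> \<le> real n * (1 + \<delta>)")
            case True
            have "(cmod (h n \<xi> - ?z * g n \<xi>))\<^sup>2 \<le> (C * v \<xi> powr (-1 + 2 / K))\<^sup>2"
              unfolding h_def g_def by (intro power_mono C) auto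
            also have "\<dots> = C\<^sup>2 * v \<xi> powr (- 2 + 4 / real K)"
              by (simp add: power_mult_distrib power2_eq_square[of "v \<xi> powr _"] powr_add[symmetric])
            finally show ?thesis using True by (simp add: indicator_def abs_le_iff)
          next
            case False
            then have "h n \<xi> = 0" "g n \<xi> = 0"
              using w0[of n \<xi>] poly_D_eq_0_outside[of "real n * (1 + \<delta>)" "w n", OF w0, of \<xi>]
              by (simp_all add: h_def g_def)
            then show ?thesis by simp
          qed
        qed
        then show "(L2norm (\<lambda>x. h n x - ?z * g n x))\<^sup>2 \<le> C\<^sup>2 * I n"
          by (simp add: I_def set_lebesgue_integral_def)
      qed simp
      finally show ?thesis by (simp add: mult.assoc)
    qed
    have J_pos: "J n > 0" if n: "n \<ge> 1" for n
    proof -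
      obtain b where b: "\<And>x. v x \<le> b" using v_bdd by (auto simp: bounded_real dest: abs_le_D1)
      have b0: "b > 0" using v_pos[of 0] b[of 0] by linarith
      have "(LBINT \<xi>:{- real n..real n}. b powr - 2) \<le> J n"
        unfolding J_def
      proof (rule set_integral_mono)
        show "set_integrable lborel {- real n..real n} (\<lambda>x. b powr - 2)"
          by (intro borel_integrable_atLeastAtMost' continuous_intros)
        show "b powr - 2 \<le> v x powr - 2" for x
          using v_pos[of x] b[of x] b0 by (intro powr_mono2') auto
      qed (rule v_powr_set_integrable)
      moreover have "(LBINT \<xi>:{- real n..real n}. b powr - 2) = 2 * real n * b powr - 2"
        by (simp add: set_lebesgue_integral_def)
      ultimately show ?thesis using b0 n by (smt (verit) mult_pos_pos of_nat_1 of_nat_le_iff powr_gt_zero)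
    qed
    have "(\<lambda>n. B\<^sup>2 * C\<^sup>2 * (I n / J n)) \<longlonglongrightarrow> B\<^sup>2 * C\<^sup>2 * 0"
      using lim unfolding I_def J_def by (intro tendsto_intros)
    moreover have "1 \<le> B\<^sup>2 * C\<^sup>2 * (I n / J n)" if "n \<ge> 1" for n
      using le[OF that] J_pos[OF that] by (simp add: le_divide_eq)
    ultimately have "(1::real) \<le> B\<^sup>2 * C\<^sup>2 * 0"
      by (intro LIMSEQ_le_const[of _ _ 1]) (auto intro: exI[of _ 1])
    then show False by simp
  qed
  then show ?thesis by (simp add: op_spectrum_def)
qed

end

section \<open>Boundary form and symmetry\<close>

text \<open>
  The boundary form of \<open>Q(D)\<close>: the sesquilinear expression in derivatives of order less than \<open>K\<close> that
  arises when \<open>Q(D)\<close> is moved from one factor to the other. In each of its terms the orders of the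
  two derivatives add up to at most \<open>K - 1\<close>, which is what makes it controllable by \<open>L2\<close> norms.
\<close>

definition bform :: "real poly \<Rightarrow> (real \<Rightarrow> complex) \<Rightarrow> real \<Rightarrow> complex" where
  "bform Q w x = (\<Sum>k\<le>degree Q. of_real (coeff Q k) * \<i> ^ k *
     (\<Sum>j<k. (-1) ^ j * nth_vderiv (k - Suc j) w x * cnj (nth_vderiv j w x)))"

text \<open>
  For the monomial of degree \<open>k\<close> the sum telescopes, because the derivative of its \<open>j\<close>-th term is
  \<open>T j - T (j+1)\<close>; and \<open>\<i>^k\<close> compensates the sign \<open>(-1)^k\<close> under conjugation.
\<close>

lemma lagrange_identity:
  assumes w: "C_times (degree Q) w"
  shows "(bform Q w has_vector_derivative poly_D Q w x * cnj (w x) - w x * cnj (poly_D Q w x)) (at x)"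
proof -
  have 1: "((\<lambda>x. \<Sum>j<k. (-1) ^ j * nth_vderiv (k - Suc j) w x * cnj (nth_vderiv j w x))
     has_vector_derivative nth_vderiv k w x * cnj (w x) - (-1) ^ k * w x * cnj (nth_vderiv k w x)) (at x)"
    if k: "k \<le> degree Q" for k
  proof -
    define T where "T j = (-1) ^ j * nth_vderiv (k - j) w x * cnj (nth_vderiv j w x)" for j
    have "((\<lambda>x. \<Sum>j<k. (-1) ^ j * nth_vderiv (k - Suc j) w x * cnj (nth_vderiv j w x))
       has_vector_derivative (\<Sum>j<k. T j - T (Suc j))) (at x)"
    proof (rule has_vector_derivative_sum)
      fix j assume "j \<in> {..<k}"
      then have j: "j < k" by simp
      have d1: "(nth_vderiv (k - Suc j) w has_vector_derivative nth_vderiv (k - j) w x) (at x)"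
        using nth_vderiv_has_vector_derivative[OF w, of "k - Suc j" x] j k by (simp add: Suc_diff_Suc)
      have d2: "((\<lambda>x. cnj (nth_vderiv j w x)) has_vector_derivative cnj (nth_vderiv (Suc j) w x)) (at x)"
        by (intro bounded_linear.has_vector_derivative[OF bounded_linear_cnj]
            nth_vderiv_has_vector_derivative[OF w])
          (use j k in simp)
      have "((\<lambda>x. (-1) ^ j * nth_vderiv (k - Suc j) w x * cnj (nth_vderiv j w x)) has_vector_derivative
         (-1) ^ j * nth_vderiv (k - Suc j) w x * cnj (nth_vderiv (Suc j) w x) +
         (-1) ^ j * nth_vderiv (k - j) w x * cnj (nth_vderiv j w x)) (at x)"
        by (intro has_vector_derivative_mult has_vector_derivative_mult_right d1 d2)
      then show "((\<lambda>x. (-1) ^ j * nth_vderiv (k - Suc j) w x * cnj (nth_vderiv j w x)) has_vector_derivative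
         T j - T (Suc j)) (at x)"
        by (simp add: T_def add.commute)
    qed
    also have "(\<Sum>j<k. T j - T (Suc j)) = T 0 - T k" by (rule sum_lessThan_telescope')
    finally show ?thesis by (simp add: T_def)
  qed
  have "(bform Q w has_vector_derivative (\<Sum>k\<le>degree Q. of_real (coeff Q k) * \<i> ^ k *
      (nth_vderiv k w x * cnj (w x) - (-1) ^ k * w x * cnj (nth_vderiv k w x)))) (at x)"
    unfolding bform_def[abs_def]
    by (intro has_vector_derivative_sum has_vector_derivative_mult_right 1) auto
  also have "(\<Sum>k\<le>degree Q. of_real (coeff Q k) * \<i> ^ k *
      (nth_vderiv k w x * cnj (w x) - (-1) ^ k * w x * cnj (nth_vderiv k w x)))
     = poly_D Q w x * cnj (w x) - w x * cnj (poly_D Q w x)"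
  proof -
    have i: "cnj \<i> ^ k = \<i> ^ k * (-1) ^ k" for k
      by (simp add: power_mult_distrib[symmetric])
    show ?thesis
      unfolding poly_D_def cnj_sum sum_distrib_left sum_distrib_right sum_subtractf[symmetric]
      by (intro sum.cong refl) (simp only: complex_cnj_mult complex_cnj_power i
          complex_cnj_complex_of_real, simp add: algebra_simps)
  qed
  finally show ?thesis .
qed

lemma bform_eq_0_outside:
  assumes "\<And>x. \<bar>x\<bar> > R \<Longrightarrow> w x = 0" "\<bar>x\<bar> > R"
  shows "bform Q w x = 0"
  unfolding bform_def using nth_vderiv_eq_0_outside[OF assms] by simp

context weight begin

lemma A0_symmetric:
  assumes "(g, h) \<in> A0_op Q v"
  shows "Im (L2ip h g) = 0"
proof -
  obtain w where w: "w \<in> C0_times K" and gh: "g = (\<lambda>x. w x / of_real (v x))" "h = (\<lambda>x. of_real (v x) *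
      poly_D Q w x)"
    using A0_memE[OF assms] by metis
  obtain R where R: "R \<ge> 0" "\<And>x. \<bar>x\<bar> > R \<Longrightarrow> w x = 0" using w by (auto simp: C0_times_iff)
  have wC: "C_times (degree Q) w" using w deg by (simp add: C0_times_iff)
  have hg: "h x * cnj (g x) = poly_D Q w x * cnj (w x)" for x
    using v_pos[of x] by (simp add: gh)
  let ?F = "\<lambda>x. poly_D Q w x * cnj (w x) - w x * cnj (poly_D Q w x)"
  have L: "h \<in> L2" "g \<in> L2" using A0_L2[OF assms] by auto
  have "L2ip h g - L2ip g h = (LBINT x. h x * cnj (g x) - g x * cnj (h x))"
    unfolding L2ip_def using L2ip_integrable[OF L] L2ip_integrable[OF L(2,1)] by simp
  also have "\<dots> = (LBINT x. ?F x)"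
  proof (intro Bochner_Integration.integral_cong refl)
    fix x
    have "g x * cnj (h x) = cnj (h x * cnj (g x))" by simp
    then show "h x * cnj (g x) - g x * cnj (h x) = ?F x"
      unfolding hg by simp
  qed
  also have "\<dots> = (LBINT x. indicator {-(R+1)..R+1} x *\<^sub>R ?F x)"
    using R(2) by (intro Bochner_Integration.integral_cong refl) (force simp: indicator_def abs_if)
  also have "\<dots> = bform Q w (R+1) - bform Q w (-(R+1))"
  proof (rule integral_FTC_Icc)
    show "continuous_on {-(R+1)..R+1} ?F"
      using poly_D_continuous[OF wC] C_times_imp_continuous[OF wC]
      by (intro continuous_intros; blast intro: continuous_on_subset)
    fix x show "(bform Q w has_vector_derivative ?F x) (at x within {-(R+1)..R+1})"
      using lagrange_identity[OF wC] by (rule has_vector_derivative_at_within)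
  qed (use R in auto)
  also have "\<dots> = 0"
    using bform_eq_0_outside[of R w, OF R(2)] R(1) by simp
  finally have "L2ip h g = cnj (L2ip h g)" using L2ip_cnj[of g h] by simp
  then show ?thesis by (metis complex_eq_iff cnj.sel(2) neg_equal_zero)
qed

text \<open>
  Since \<open>A0\<close> is symmetric, the imaginary part of \<open>\<langle>(A - z) g, g\<rangle>\<close> is \<open>- Im z \<parallel>g\<parallel>\<^sup>2\<close>.
\<close>

lemma A0_lower_bound:
  assumes "(g, h) \<in> A0_op Q v"
  shows "\<bar>Im z\<bar> * L2norm g \<le> L2norm (\<lambda>x. h x - z * g x)"
proof (cases "L2norm g = 0")
  case False
  then have pos: "L2norm g > 0" using L2norm_nonneg[of g] by linarith
  have L: "h \<in> L2" "g \<in> L2" using A0_L2[OF assms] by auto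
  have "L2ip (\<lambda>x. h x + (-z) * g x) g = L2ip h g - z * of_real ((L2norm g)\<^sup>2)"
    using L by (subst L2ip_add_left) (auto simp: L2_scale[of g "-z", simplified] L2ip_scale_left[of "-z",
        simplified] L2ip_self)
  then have "\<bar>Im (L2ip (\<lambda>x. h x - z * g x) g)\<bar> = \<bar>Im z\<bar> * (L2norm g)\<^sup>2"
    using A0_symmetric[OF assms] by (simp add: abs_mult)
  then have "\<bar>Im z\<bar> * (L2norm g)\<^sup>2 \<le> cmod (L2ip (\<lambda>x. h x - z * g x) g)"
    using abs_Im_le_cmod by metis
  also have "\<dots> \<le> L2norm (\<lambda>x. h x - z * g x) * L2norm g"
    using L by (intro L2_Cauchy_Schwarz L2_diff L2_scale)
  finally have "(\<bar>Im z\<bar> * L2norm g) * L2norm g \<le> L2norm (\<lambda>x. h x - z * g x) * L2norm g"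
    by (simp add: power2_eq_square mult.assoc)
  then show ?thesis using pos by simp
qed simp

lemma A_lower_bound:
  assumes "(g, h) \<in> A_op Q v"
  shows "\<bar>Im z\<bar> * L2norm g \<le> L2norm (\<lambda>x. h x - z * g x)"
proof -
  obtain gs hs where gh: "\<And>n. (gs n, hs n) \<in> A0_op Q v" "L2_lim gs g" "L2_lim hs h"
    using assms unfolding A_op_def op_closure_def by blast
  show ?thesis
  proof (rule LIMSEQ_le)
    show "(\<lambda>n. \<bar>Im z\<bar> * L2norm (gs n)) \<longlonglongrightarrow> \<bar>Im z\<bar> * L2norm g"
      by (intro tendsto_intros L2_lim_norm gh)
    show "(\<lambda>n. L2norm (\<lambda>x. hs n x - z * gs n x)) \<longlonglongrightarrow> L2norm (\<lambda>x. h x - z * g x)"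
      by (intro L2_lim_norm L2_lim_diff L2_lim_scale gh)
  qed (use A0_lower_bound[OF gh(1)] in auto)
qed

end

section \<open>Interior estimates and deficiency spaces\<close>

text \<open>
  Somewhere in an interval the \<open>k\<close>-th derivative is as small as scaling suggests. In the induction
  step the interval is cut into thirds; two points with small \<open>k\<close>-th derivative in the outer thirds
  are at distance at least one third, and the mean value theorem gives a point between them. Only
  the existence and the scaling of the constant matter, so it is not optimized. The functions are
  real, as the mean value theorem in this form fails for complex ones.
\<close>

lemma small_deriv_point:
  fixes f :: "nat \<Rightarrow> real \<Rightarrow> real"
  assumes "\<And>j x. j < k \<Longrightarrow> (f j has_field_derivative f (Suc j) x) (at x)" "continuous_on UNIV (f 0)"
    and "a < b"
  shows "\<exists>s\<in>{a..b}. (f k s)\<^sup>2 \<le> 6 ^ (2*k) * 3 ^ (2*k*k) * integral {a..b} (\<lambda>x. (f 0 x)\<^sup>2) / (b - a) ^ (2*k+1)"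
  using assms
proof (induction k arbitrary: a b)
  case 0
  have cont: "continuous_on {a..b} (\<lambda>x. (f 0 x)\<^sup>2)"
    using 0(2) by (intro continuous_intros) (blast intro: continuous_on_subset)
  then obtain s where s: "s \<in> {a..b}" "\<And>x. x \<in> {a..b} \<Longrightarrow> (f 0 s)\<^sup>2 \<le> (f 0 x)\<^sup>2"
    using continuous_attains_inf[of "{a..b}" "\<lambda>x. (f 0 x)\<^sup>2"] 0(3) by auto
  have "integral {a..b} (\<lambda>x. (f 0 s)\<^sup>2) \<le> integral {a..b} (\<lambda>x. (f 0 x)\<^sup>2)"
    using s by (intro integral_le integrable_continuous_real cont continuous_on_const) auto
  then have "(f 0 s)\<^sup>2 \<le> integral {a..b} (\<lambda>x. (f 0 x)\<^sup>2) / (b - a)"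
    using 0(3) by (simp add: field_simps)
  then show ?case using s(1) by auto
next
  case (Suc k)
  define d where "d = (b - a) / 3"
  define I where "I = integral {a..b} (\<lambda>x. (f 0 x)\<^sup>2)"
  define c :: real where "c = 6 ^ (2*k) * 3 ^ (2*k*k)"
  have d: "d > 0" "b - a = 3 * d" using Suc.prems by (auto simp: d_def)
  have int: "(\<lambda>x. (f 0 x)\<^sup>2) integrable_on {p..q}" for p q
    using Suc.prems(2) by (intro integrable_continuous_real continuous_intros) (blast intro:
        continuous_on_subset)
  have sub: "\<exists>s\<in>{p..p+d}. (f k s)\<^sup>2 \<le> c * I / d ^ (2*k+1)" if "a \<le> p" "p + d \<le> b" for p
  proof -
    obtain s where s: "s \<in> {p..p+d}" "(f k s)\<^sup>2 \<le> c * integral {p..p+d} (\<lambda>x. (f 0 x)\<^sup>2) / d ^ (2*k+1)"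
      using Suc.IH[of p "p+d"] Suc.prems d by (auto simp: c_def)
    have "integral {p..p+d} (\<lambda>x. (f 0 x)\<^sup>2) \<le> I"
      unfolding I_def using that int by (intro integral_subset_le) auto
    then have "c * integral {p..p+d} (\<lambda>x. (f 0 x)\<^sup>2) / d ^ (2*k+1) \<le> c * I / d ^ (2*k+1)"
      using d by (intro divide_right_mono mult_left_mono) (auto simp: c_def)
    with s show ?thesis by force
  qed
  obtain s1 where s1: "s1 \<in> {a..a+d}" "(f k s1)\<^sup>2 \<le> c * I / d ^ (2*k+1)"
    using sub[of a] d by auto
  obtain s2 where s2: "s2 \<in> {a+2*d..a+3*d}" "(f k s2)\<^sup>2 \<le> c * I / d ^ (2*k+1)"
    using sub[of "a+2*d"] d by (auto simp: algebra_simps)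
  have lt: "s1 < s2" "s2 - s1 \<ge> d" using s1 s2 d by auto
  obtain s where s: "s1 < s" "s < s2" "f k s2 - f k s1 = (s2 - s1) * f (Suc k) s"
    using MVT2[OF lt(1), of "f k" "f (Suc k)"] Suc.prems(1) by auto
  have "d\<^sup>2 * (f (Suc k) s)\<^sup>2 \<le> (s2 - s1)\<^sup>2 * (f (Suc k) s)\<^sup>2"
    using lt d by (intro mult_right_mono power_mono) auto
  also have "\<dots> = (f k s2 - f k s1)\<^sup>2" using s(3) by (simp add: power_mult_distrib)
  also have "\<dots> \<le> 2 * (f k s2)\<^sup>2 + 2 * (f k s1)\<^sup>2"
    using zero_le_power2[of "f k s2 + f k s1"] by (simp add: power2_sum power2_diff)
  also have "\<dots> \<le> 4 * (c * I / d ^ (2*k+1))"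
  proof -
    have "2 * q + 2 * p \<le> 4 * r" if "p \<le> r" "q \<le> r" for p q r :: real using that by simp
    from this[OF s1(2) s2(2)] show ?thesis .
  qed
  finally have "(f (Suc k) s)\<^sup>2 \<le> 4 * (c * I / d ^ (2*k+1)) / d\<^sup>2"
    using d by (simp add: field_simps)
  also have "\<dots> = 4 * (c * I / d ^ (2*Suc k+1))"
    by (simp add: power2_eq_square)
  also have "\<dots> = 4 * c * 3 ^ (2*Suc k+1) * I / (b - a) ^ (2*Suc k+1)"
    unfolding d(2) power_mult_distrib using d by (simp add: field_simps)
  also have "4 * c * 3 ^ (2*Suc k+1) \<le> 6 ^ (2*Suc k) * 3 ^ (2*Suc k*Suc k)"
  proof -
    have "4 * c * 3 ^ (2*Suc k+1) = 6 ^ (2*k) * 108 * 3 ^ (2*k*k + 2*k)"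
      by (simp add: c_def power_add)
    also have "\<dots> \<le> 6 ^ (2*k) * 324 * 3 ^ (2*k*k + 4*k)"
      by (intro mult_mono power_increasing) auto
    also have "\<dots> = 6 ^ (2*Suc k) * 3 ^ (2*Suc k*Suc k)"
      by (simp add: power_add algebra_simps power2_eq_square)
    finally show ?thesis .
  qed
  finally have "(f (Suc k) s)\<^sup>2 \<le> 6 ^ (2*Suc k) * 3 ^ (2*Suc k*Suc k) * I / (b - a) ^ (2*Suc k+1)"
    if "I \<ge> 0" using that Suc.prems(3) by (simp add: divide_right_mono mult_right_mono)
  moreover have "I \<ge> 0" unfolding I_def by (intro integral_nonneg int) auto
  ultimately show ?case unfolding I_def
    using s s1 s2 d by (intro bexI[of _ s]) auto
qed

text \<open>
  An interior estimate for solutions of differential inequalities of order \<open>K\<close> at length scale \<open>h\<close>,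
  with a constant that depends only on \<open>K\<close> and \<open>M\<close>. On the shorter interval of length \<open>\<rho> h\<close> let \<open>N\<close> be the
  largest value of \<open>\<Sum> h^k \<bar>Y k\<bar>\<close>. Starting from points where the \<open>k\<close>-th derivative is controlled by
  the \<open>L2\<close> norm (\<open>small_deriv_point\<close>), each \<open>Y k\<close> grows at most by \<open>\<rho> h\<close> times a bound for \<open>Y (k+1)\<close>, that
  is by a multiple of \<open>\<rho> N\<close>. For small \<open>\<rho>\<close> these multiples of \<open>N\<close> are absorbed on the left.
\<close>

lemma local_derivative_bound:
  fixes K :: nat and M :: real
  assumes K: "K \<ge> 1" and M: "M \<ge> 0"
  obtains C where "C \<ge> 0"
    "\<And>(Y :: nat \<Rightarrow> real \<Rightarrow> complex) x h j.
      (\<And>j t. j < K \<Longrightarrow> (Y j has_vector_derivative Y (Suc j) t) (at t)) \<Longrightarrow> h > 0 \<Longrightarrow>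
      (\<And>t. t \<in> {x..x+h} \<Longrightarrow> h ^ K * cmod (Y K t) \<le> M * (\<Sum>k<K. h ^ k * cmod (Y k t))) \<Longrightarrow>
      j < K \<Longrightarrow> h ^ j * cmod (Y j x) \<le> C * sqrt (integral {x..x+h} (\<lambda>t. (cmod (Y 0 t))\<^sup>2) / h)"
proof -
  \<comment> \<open>Chosen so that the absorbed terms add up to \<open>N / 2\<close>.\<close>
  define \<rho> where "\<rho> = 1 / (4 * real K * (1 + M))"
  have \<rho>: "\<rho> > 0" "\<rho> \<le> 1"
  proof -
    have "1 * 1 \<le> real K * (1 + M)" using K M by (intro mult_mono) auto
    then have "1 \<le> 4 * real K * (1 + M)" by simp
    then show "\<rho> > 0" "\<rho> \<le> 1" unfolding \<rho>_def by (simp_all add: divide_le_eq_1)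
  qed
  define c :: "nat \<Rightarrow> real" where "c k = 6 ^ (2*k) * 3 ^ (2*k*k)" for k
  define B where "B k = 2 * sqrt (c k / \<rho> ^ (2*k+1))" for k
  define C where "C = 2 * (\<Sum>k<K. B k)"
  have B0: "B k \<ge> 0" for k using \<rho> by (simp add: B_def c_def)
  then have C0: "C \<ge> 0" by (simp add: C_def sum_nonneg)
  have "h ^ j * cmod (Y j x) \<le> C * sqrt (integral {x..x+h} (\<lambda>t. (cmod (Y 0 t))\<^sup>2) / h)"
    if Y: "\<And>j t. j < K \<Longrightarrow> (Y j has_vector_derivative Y (Suc j) t) (at t)" and h: "h > 0"
      and ode: "\<And>t. t \<in> {x..x+h} \<Longrightarrow> h ^ K * cmod (Y K t) \<le> M * (\<Sum>k<K. h ^ k * cmod (Y k t))"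
      and j: "j < K" for Y :: "nat \<Rightarrow> real \<Rightarrow> complex" and x h j
  proof -
    have cont: "continuous_on S (Y k)" if "k < K" for k S
      by (intro continuous_at_imp_continuous_on ballI has_vector_derivative_continuous[OF Y[OF that]])
    define d where "d = \<rho> * h"
    have d: "0 < d" "d \<le> h" using \<rho> h by (auto simp: d_def mult_le_cancel_right1)
    define J where "J = sqrt (integral {x..x+h} (\<lambda>t. (cmod (Y 0 t))\<^sup>2) / h)"
    define n where "n t = (\<Sum>k<K. h ^ k * cmod (Y k t))" for t
    have "continuous_on {x..x+d} n"
      unfolding n_def by (intro continuous_intros cont) auto
    then obtain t0 where t0: "t0 \<in> {x..x+d}" "\<And>t. t \<in> {x..x+d} \<Longrightarrow> n t \<le> n t0"
      using continuous_attains_sup[of "{x..x+d}" n] d by auto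
    define N where "N = n t0"
    have n0: "n t \<ge> 0" for t using h by (auto simp: n_def intro!: sum_nonneg)
    have up: "h ^ Suc k * cmod (Y (Suc k) t) \<le> (1 + M) * N" if k: "k < K" and t: "t \<in> {x..x+d}" for k t
    proof (cases "Suc k < K")
      case True
      have "h ^ Suc k * cmod (Y (Suc k) t) \<le> n t"
        unfolding n_def using True h by (intro member_le_sum) auto
      also have "\<dots> \<le> N" using t0 t by (simp add: N_def)
      also have "\<dots> \<le> (1 + M) * N" using M n0[of t0] by (simp add: N_def distrib_right)
      finally show ?thesis .
    next
      case False
      then have "Suc k = K" using k by simp
      then have "h ^ Suc k * cmod (Y (Suc k) t) \<le> M * n t"
        using ode[of t] t d by (simp add: n_def)
      also have "\<dots> \<le> M * N" using t0 t M by (simp add: N_def mult_left_mono)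
      also have "\<dots> \<le> (1 + M) * N" using n0[of t0] by (simp add: N_def distrib_right)
      finally show ?thesis .
    qed
    \<comment> \<open>Real and imaginary part are treated separately, \<open>T\<close> being either of them.\<close>
    have part: "h ^ k * \<bar>T (Y k t)\<bar> \<le> B k / 2 * J + \<rho> * (1 + M) * N"
      if T: "bounded_linear T" "\<And>z. \<bar>T z\<bar> \<le> cmod z" and k: "k < K" and t: "t \<in> {x..x+d}" for T :: "complex
          \<Rightarrow> real" and k t
    proof -
      have dT: "((\<lambda>t. T (Y j t)) has_field_derivative T (Y (Suc j) t)) (at t)" if "j < K" for j t
        using bounded_linear.has_vector_derivative[OF T(1) Y[OF that]]
        by (simp add: has_real_derivative_iff_has_vector_derivative)
      have contT: "continuous_on UNIV (\<lambda>t. T (Y 0 t))"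
        using K by (intro bounded_linear.continuous_on[OF T(1)] cont) simp
      obtain s where s: "s \<in> {x..x+d}"
        "(T (Y k s))\<^sup>2 \<le> c k * integral {x..x+d} (\<lambda>t. (T (Y 0 t))\<^sup>2) / d ^ (2*k+1)"
        using small_deriv_point[of k "\<lambda>j t. T (Y j t)" x "x+d"] dT contT k d by (auto simp: c_def)
      have "integral {x..x+d} (\<lambda>t. (T (Y 0 t))\<^sup>2) \<le> integral {x..x+d} (\<lambda>t. (cmod (Y 0 t))\<^sup>2)"
      proof (intro integral_le integrable_continuous_real)
        show "continuous_on {x..x+d} (\<lambda>t. (T (Y 0 t))\<^sup>2)"
          by (intro continuous_on_power continuous_on_subset[OF contT]) auto
        show "continuous_on {x..x+d} (\<lambda>t. (cmod (Y 0 t))\<^sup>2)"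
          using K by (intro continuous_intros cont) auto
        show "(T (Y 0 t))\<^sup>2 \<le> (cmod (Y 0 t))\<^sup>2" for t
          using power_mono[OF T(2), of "Y 0 t" 2] by simp
      qed
      also have "\<dots> \<le> integral {x..x+h} (\<lambda>t. (cmod (Y 0 t))\<^sup>2)"
        using d K by (intro integral_subset_le integrable_continuous_real continuous_intros cont) auto
      finally have le: "integral {x..x+d} (\<lambda>t. (T (Y 0 t))\<^sup>2) \<le> integral {x..x+h} (\<lambda>t. (cmod (Y 0 t))\<^sup>2)" .
      have I0: "0 \<le> integral {x..x+h} (\<lambda>t. (cmod (Y 0 t))\<^sup>2)"
        using K by (intro integral_nonneg integrable_continuous_real continuous_intros cont) auto
      have "(h ^ k * T (Y k s))\<^sup>2 = h ^ (2*k) * (T (Y k s))\<^sup>2"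
        by (simp add: power_mult_distrib power_mult mult.commute flip: power_mult)
      also have "\<dots> \<le> h ^ (2*k) * (c k * integral {x..x+h} (\<lambda>t. (cmod (Y 0 t))\<^sup>2) / d ^ (2*k+1))"
      proof (rule mult_left_mono)
        show "(T (Y k s))\<^sup>2 \<le> c k * integral {x..x+h} (\<lambda>t. (cmod (Y 0 t))\<^sup>2) / d ^ (2*k+1)"
          using s(2) by (rule order_trans) (use le d in \<open>auto intro!: divide_right_mono mult_left_mono
              simp: c_def\<close>)
      qed (use h in simp)
      also have "\<dots> = c k / \<rho> ^ (2*k+1) * (integral {x..x+h} (\<lambda>t. (cmod (Y 0 t))\<^sup>2) / h)"
        using h \<rho> by (simp add: d_def power_mult_distrib field_simps)
      also have "\<dots> = (B k / 2 * J)\<^sup>2"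
        using I0 h \<rho> by (simp add: B_def J_def power_mult_distrib c_def)
      finally have "\<bar>h ^ k * T (Y k s)\<bar>\<^sup>2 \<le> (B k / 2 * J)\<^sup>2" by (simp only: power2_abs)
      then have "\<bar>h ^ k * T (Y k s)\<bar> \<le> B k / 2 * J"
        by (rule power2_le_imp_le) (use B0[of k] I0 h in \<open>simp add: J_def\<close>)
      then have 1: "h ^ k * \<bar>T (Y k s)\<bar> \<le> B k / 2 * J" using h by (simp add: abs_mult)
      have "norm (T (Y k t) - T (Y k s)) \<le> ((1 + M) * N / h ^ Suc k) * norm (t - s)"
      proof (rule field_differentiable_bound[where S="{x..x+d}" and f'="\<lambda>t. T (Y (Suc k) t)"])
        fix r assume r: "r \<in> {x..x+d}"
        show "((\<lambda>t. T (Y k t)) has_field_derivative T (Y (Suc k) r)) (at r within {x..x+d})"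
          using dT[OF k] by (rule has_field_derivative_at_within)
        have "cmod (Y (Suc k) r) \<le> (1 + M) * N / h ^ Suc k"
          using up[OF k r] h by (simp add: field_simps)
        then show "norm (T (Y (Suc k) r)) \<le> (1 + M) * N / h ^ Suc k"
          using T(2)[of "Y (Suc k) r"] by simp
      qed (use s t in auto)
      also have "\<dots> \<le> ((1 + M) * N / h ^ Suc k) * d"
        using s t h M n0[of t0] by (intro mult_left_mono) (auto simp: N_def)
      finally have "h ^ k * \<bar>T (Y k t) - T (Y k s)\<bar> \<le> h ^ k * (((1 + M) * N / h ^ Suc k) * d)"
        using h by (intro mult_left_mono) auto
      also have "\<dots> = \<rho> * (1 + M) * N" using h by (simp add: d_def)
      finally have 2: "h ^ k * \<bar>T (Y k t) - T (Y k s)\<bar> \<le> \<rho> * (1 + M) * N" .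
      have "h ^ k * \<bar>T (Y k t)\<bar> \<le> h ^ k * (\<bar>T (Y k s)\<bar> + \<bar>T (Y k t) - T (Y k s)\<bar>)"
        using h by (intro mult_left_mono) auto
      then show ?thesis using 1 2 by (simp add: distrib_left)
    qed
    have "N \<le> (\<Sum>k<K. B k * J + 2 * \<rho> * (1 + M) * N)"
      unfolding N_def n_def
    proof (rule sum_mono)
      fix k assume "k \<in> {..<K}"
      then have k: "k < K" by simp
      have "h ^ k * cmod (Y k t0) \<le> h ^ k * (\<bar>Re (Y k t0)\<bar> + \<bar>Im (Y k t0)\<bar>)"
        using h by (intro mult_left_mono cmod_le) auto
      also have "\<dots> \<le> B k * J + 2 * \<rho> * (1 + M) * N"
        using part[OF bounded_linear_Re abs_Re_le_cmod k t0(1)] part[OF bounded_linear_Im abs_Im_le_cmod k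
            t0(1)]
        by (simp add: algebra_simps)
      finally show "h ^ k * cmod (Y k t0) \<le> B k * J + 2 * \<rho> * (1 + M) * (\<Sum>k<K. h ^ k * cmod (Y k t0))"
        by (simp add: N_def n_def)
    qed
    also have "\<dots> = (\<Sum>k<K. B k) * J + (2 * real K * \<rho> * (1 + M)) * N"
      by (simp add: sum.distrib sum_distrib_right)
    also have "2 * real K * \<rho> * (1 + M) = 1 / 2"
      using K M by (simp add: \<rho>_def)
    finally have N: "N \<le> C * J" by (simp add: C_def)
    have "h ^ j * cmod (Y j x) \<le> n x"
      unfolding n_def using j h by (intro member_le_sum) auto
    also have "\<dots> \<le> N" using t0(2)[of x] d by (simp add: N_def)
    finally show ?thesis using N unfolding J_def by simp
  qed
  with that C0 show thesis by blast
qed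

context weight begin

text \<open>
  The hypothesis bounds the derivative of \<open>ln v\<close>.
\<close>

lemma v_comparable:
  assumes L: "\<And>x. \<bar>nth_vderiv 1 v x\<bar> \<le> L * v x" and t: "\<bar>t - x\<bar> \<le> 1"
  shows "v t \<le> exp L * v x"
proof -
  have L0: "L \<ge> 0" using L[of 0] v_pos[of 0] by (meson abs_ge_zero order_trans zero_le_mult_iff less_le_not_le)
  have "((\<lambda>x. ln (v x)) has_field_derivative inverse (v y) * nth_vderiv 1 v y) (at y)" for y
  proof -
    have "(v has_field_derivative nth_vderiv 1 v y) (at y)"
      using nth_vderiv_has_vector_derivative[OF vC, of 0 y] K_pos
      by (simp add: has_real_derivative_iff_has_vector_derivative)
    then show ?thesis using v_pos[of y] by (intro DERIV_chain2[OF DERIV_ln]) auto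
  qed
  then have "norm (ln (v t) - ln (v x)) \<le> L * norm (t - x)"
  proof (intro field_differentiable_bound[where S=UNIV and f'="\<lambda>y. inverse (v y) * nth_vderiv 1 v y"])
    fix y show "norm (inverse (v y) * nth_vderiv 1 v y) \<le> L"
      using L[of y] v_pos[of y] by (simp add: abs_mult field_simps)
  qed auto
  also have "\<dots> \<le> L * 1" using t L0 by (intro mult_left_mono) auto
  finally have "ln (v t) \<le> L + ln (v x)" by simp
  then have "exp (ln (v t)) \<le> exp (L + ln (v x))" by simp
  then show ?thesis using v_pos by (simp add: exp_add)
qed

text \<open>
  The natural length scale at \<open>x\<close> for the equation \<open>Q(D) w = \<zeta> w / v\<^sup>2\<close> is \<open>h\<close> with \<open>h^K\<close> proportional to
  \<open>v\<^sup>2\<close>: after rescaling by \<open>h\<close> all coefficients are bounded, because \<open>v\<close> varies by at most a constant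
  factor over distances up to \<open>1\<close>. Up to constants, a product of two derivatives with orders
  \<open>a + j < K\<close> is therefore at most \<open>h powr (-(a+j+1))\<close>, and thus at most \<open>h powr (-K)\<close>, times the
  integral of \<open>\<bar>w\<bar>\<^sup>2\<close>; the factor \<open>h powr (-K)\<close> exactly converts \<open>\<bar>w\<bar>\<^sup>2\<close> into \<open>\<bar>w / v\<bar>\<^sup>2\<close>.
\<close>

lemma bform_bound:
  assumes L: "\<And>x. \<bar>nth_vderiv 1 v x\<bar> \<le> L * v x"
  shows "\<exists>C. \<forall>w x. C_times K w \<longrightarrow> (\<forall>t. poly_D Q w t = \<zeta> * w t / of_real ((v t)\<^sup>2)) \<longrightarrow>
    cmod (bform Q w x) \<le> C * integral {x..x+1} (\<lambda>t. (cmod (w t) / v t)\<^sup>2)"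
proof -
  obtain b where b: "\<And>x. v x \<le> b" using v_bdd by (auto simp: bounded_real dest: abs_le_D1)
  have b0: "b > 0" using v_pos[of 0] b[of 0] by linarith
  define qK where "qK = \<bar>coeff Q K\<bar>"
  have qK: "qK > 0" using coeff_K_nonzero by (simp add: qK_def)
  define M where "M = (cmod \<zeta> * exp (2*L) / b\<^sup>2 + (\<Sum>k<K. \<bar>coeff Q k\<bar>)) / qK"
  have M: "M \<ge> 0" using qK b0 by (auto simp: M_def intro!: divide_nonneg_nonneg add_nonneg_nonneg sum_nonneg)
  obtain C where C: "C \<ge> 0"
    "\<And>(Y :: nat \<Rightarrow> real \<Rightarrow> complex) x h j.
      (\<And>j t. j < K \<Longrightarrow> (Y j has_vector_derivative Y (Suc j) t) (at t)) \<Longrightarrow> h > 0 \<Longrightarrow>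
      (\<And>t. t \<in> {x..x+h} \<Longrightarrow> h ^ K * cmod (Y K t) \<le> M * (\<Sum>k<K. h ^ k * cmod (Y k t))) \<Longrightarrow>
      j < K \<Longrightarrow> h ^ j * cmod (Y j x) \<le> C * sqrt (integral {x..x+h} (\<lambda>t. (cmod (Y 0 t))\<^sup>2) / h)"
    using local_derivative_bound[OF K1 M] by blast
  define D where "D = (\<Sum>k\<le>K. \<bar>coeff Q k\<bar> * (real k * (C\<^sup>2 * b\<^sup>2 * exp (2*L))))"
  have "cmod (bform Q w x) \<le> D * integral {x..x+1} (\<lambda>t. (cmod (w t) / v t)\<^sup>2)"
    if w: "C_times K w" and ode: "\<And>t. poly_D Q w t = \<zeta> * w t / of_real ((v t)\<^sup>2)" for w x
  proof -
    \<comment> \<open>The upper bound \<open>b\<close> of \<open>v\<close> is included to have \<open>h \<le> 1\<close>, the range of the comparison of values of \<open>v\<close>.\<close>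
    define h where "h = (v x / b) powr (2 / K)"
    have vx: "0 < v x / b" "v x / b \<le> 1" using v_pos[of x] b[of x] b0 by auto
    have h: "0 < h" "h \<le> 1" using vx K_pos by (auto simp: h_def intro: powr_le1)
    have hK: "h ^ K = (v x)\<^sup>2 / b\<^sup>2"
    proof -
      have "h ^ K = h powr real K" using h by (simp add: powr_realpow)
      also have "\<dots> = (v x / b) powr 2" using K_pos by (simp add: h_def powr_powr)
      also have "\<dots> = (v x / b)\<^sup>2" using vx by simp
      finally show ?thesis by (simp add: power_divide)
    qed
    define I where "I = integral {x..x+h} (\<lambda>t. (cmod (w t))\<^sup>2)"
    define J where "J = integral {x..x+1} (\<lambda>t. (cmod (w t) / v t)\<^sup>2)"
    have contw: "continuous_on S w" for S
      using C_times_imp_continuous[OF w] continuous_on_subset by blast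
    have contv: "continuous_on S v" for S
      using v_continuous continuous_on_subset by blast
    have contu: "continuous_on S (\<lambda>t. (cmod (w t) / v t)\<^sup>2)" for S
      using contw contv v_pos by (intro continuous_intros) (auto simp: less_imp_neq[symmetric])
    have der: "h ^ j * cmod (nth_vderiv j w x) \<le> C * sqrt (I / h)" if "j < K" for j
      unfolding I_def
    proof (rule C(2)[of "\<lambda>j. nth_vderiv j w", simplified, OF _ h(1) _ that])
      show "\<And>j t. j < K \<Longrightarrow> (nth_vderiv j w has_vector_derivative nth_vderiv (Suc j) w t) (at t)"
        by (rule nth_vderiv_has_vector_derivative[OF w])
      fix t assume t': "x \<le> t \<and> t \<le> x + h"
      then have t: "t \<in> {x..x+h}" by simp
      let ?N = "\<Sum>k<K. h ^ k * cmod (nth_vderiv k w t)"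
      have vt: "v x \<le> exp L * v t" using v_comparable[OF L, of x t] t h by auto
      have "\<i> ^ K * of_real (coeff Q K) * nth_vderiv K w t =
          \<zeta> * w t / of_real ((v t)\<^sup>2) - (\<Sum>k<K. of_real (coeff Q k) * \<i> ^ k * nth_vderiv k w t)"
        using ode[of t] unfolding poly_D_def deg lessThan_Suc_atMost[symmetric] by (simp add: mult_ac
            eq_diff_eq add.commute)
      then have "cmod (\<i> ^ K * of_real (coeff Q K) * nth_vderiv K w t) \<le>
         cmod (\<zeta> * w t / of_real ((v t)\<^sup>2)) + cmod (\<Sum>k<K. of_real (coeff Q k) * \<i> ^ k * nth_vderiv k w t)"
        by (simp only: norm_triangle_ineq4)
      also have "\<dots> \<le> cmod \<zeta> * cmod (w t) / (v t)\<^sup>2 + (\<Sum>k<K. \<bar>coeff Q k\<bar> * cmod (nth_vderiv k w t))"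
        by (intro add_mono norm_sum[THEN order_trans] sum_mono) (auto simp: norm_mult norm_divide norm_power)
      finally have "qK * cmod (nth_vderiv K w t) \<le> cmod \<zeta> * cmod (w t) / (v t)\<^sup>2 + (\<Sum>k<K. \<bar>coeff Q k\<bar> *
          cmod (nth_vderiv k w t))"
        by (simp add: norm_mult norm_power qK_def)
      then have "h ^ K * (qK * cmod (nth_vderiv K w t)) \<le>
         h ^ K * (cmod \<zeta> * cmod (w t) / (v t)\<^sup>2 + (\<Sum>k<K. \<bar>coeff Q k\<bar> * cmod (nth_vderiv k w t)))"
        using h by (intro mult_left_mono) auto
      also have "\<dots> = cmod \<zeta> * cmod (w t) * (h ^ K / (v t)\<^sup>2) + (\<Sum>k<K. \<bar>coeff Q k\<bar> * (h ^ K * cmod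
          (nth_vderiv k w t)))"
        by (simp add: distrib_left sum_distrib_left mult_ac)
      also have "\<dots> \<le> cmod \<zeta> * cmod (w t) * (exp (2*L) / b\<^sup>2) + (\<Sum>k<K. \<bar>coeff Q k\<bar> * (h ^ k * cmod
          (nth_vderiv k w t)))"
      proof (intro add_mono mult_left_mono sum_mono mult_right_mono)
        have "(v x)\<^sup>2 \<le> (exp L * v t)\<^sup>2" using vt v_pos[of x] by (intro power_mono) auto
        then have "(v x)\<^sup>2 / (v t)\<^sup>2 \<le> exp (2*L)" using v_pos[of t]
          by (simp add: power_mult_distrib exp_double divide_le_eq)
        then have "(v x)\<^sup>2 / (v t)\<^sup>2 / b\<^sup>2 \<le> exp (2*L) / b\<^sup>2" by (rule divide_right_mono) simp
        then show "h ^ K / (v t)\<^sup>2 \<le> exp (2*L) / b\<^sup>2" by (simp add: hK mult.commute)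
        fix k assume "k \<in> {..<K}"
        then show "h ^ K \<le> h ^ k" using h by (intro power_decreasing) auto
      qed auto
      also have "\<dots> \<le> (cmod \<zeta> * exp (2*L) / b\<^sup>2) * ?N +
          (\<Sum>k<K. \<bar>coeff Q k\<bar>) * ?N"
      proof (rule add_mono)
        have "cmod (w t) \<le> ?N"
          using member_le_sum[of 0 "{..<K}" "\<lambda>k. h ^ k * cmod (nth_vderiv k w t)"] K_pos h by simp
        then have "(cmod \<zeta> * exp (2*L) / b\<^sup>2) * cmod (w t) \<le> (cmod \<zeta> * exp (2*L) / b\<^sup>2) * ?N"
          by (intro mult_left_mono) auto
        then show "cmod \<zeta> * cmod (w t) * (exp (2*L) / b\<^sup>2) \<le> (cmod \<zeta> * exp (2*L) / b\<^sup>2) * ?N"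
          by (simp add: mult_ac)
        show "(\<Sum>k<K. \<bar>coeff Q k\<bar> * (h ^ k * cmod (nth_vderiv k w t))) \<le> (\<Sum>k<K. \<bar>coeff Q k\<bar>) * ?N"
          unfolding sum_distrib_right
        proof (rule sum_mono)
          fix k assume "k \<in> {..<K}"
          then show "\<bar>coeff Q k\<bar> * (h ^ k * cmod (nth_vderiv k w t)) \<le> \<bar>coeff Q k\<bar> * ?N"
            using h by (intro mult_left_mono member_le_sum) auto
        qed
      qed
      also have "\<dots> = qK * (M * ?N)"
      proof -
        have "qK * M = cmod \<zeta> * exp (2*L) / b\<^sup>2 + (\<Sum>k<K. \<bar>coeff Q k\<bar>)" using qK by (simp add: M_def)
        then show ?thesis by (simp only: mult.assoc[symmetric] distrib_right)
      qed
      finally have "qK * (h ^ K * cmod (nth_vderiv K w t)) \<le> qK * (M * ?N)"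
        by (simp add: mult.left_commute)
      then show "h ^ K * cmod (nth_vderiv K w t) \<le> M * ?N"
        using qK by simp
    qed
    have I0: "I \<ge> 0"
      unfolding I_def by (intro integral_nonneg integrable_continuous_real continuous_intros contw) auto
    have IJ: "I \<le> exp (2*L) * (v x)\<^sup>2 * J"
    proof -
      have "I \<le> integral {x..x+h} (\<lambda>t. exp (2*L) * (v x)\<^sup>2 * (cmod (w t) / v t)\<^sup>2)"
        unfolding I_def
      proof (intro integral_le integrable_continuous_real continuous_on_mult continuous_on_const contu)
        show "continuous_on {x..x+h} (\<lambda>t. (cmod (w t))\<^sup>2)" by (intro continuous_intros contw)
        fix t assume t: "t \<in> {x..x+h}"
        have "v t \<le> exp L * v x" using v_comparable[OF L, of t x] t h by auto
        then have "(v t)\<^sup>2 \<le> (exp L * v x)\<^sup>2" using v_pos[of t] by (intro power_mono) auto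
        then have "(v t)\<^sup>2 * (cmod (w t) / v t)\<^sup>2 \<le> (exp L * v x)\<^sup>2 * (cmod (w t) / v t)\<^sup>2"
          by (intro mult_right_mono) auto
        then show "(cmod (w t))\<^sup>2 \<le> exp (2*L) * (v x)\<^sup>2 * (cmod (w t) / v t)\<^sup>2"
          using v_pos[of t] by (simp add: power_mult_distrib exp_double power_divide)
      qed
      also have "\<dots> = exp (2*L) * (v x)\<^sup>2 * integral {x..x+h} (\<lambda>t. (cmod (w t) / v t)\<^sup>2)"
        by simp
      also have "\<dots> \<le> exp (2*L) * (v x)\<^sup>2 * J"
        unfolding J_def using h
        by (intro mult_left_mono integral_subset_le integrable_continuous_real contu) auto
      finally show ?thesis .
    qed
    have prod: "cmod (nth_vderiv a w x) * cmod (nth_vderiv j w x) \<le> C\<^sup>2 * b\<^sup>2 * exp (2*L) * J"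
      if aj: "a + j < K" for a j
    proof -
      have "h ^ (a + j) * (cmod (nth_vderiv a w x) * cmod (nth_vderiv j w x)) =
          (h ^ a * cmod (nth_vderiv a w x)) * (h ^ j * cmod (nth_vderiv j w x))"
        by (simp add: power_add mult_ac)
      also have "\<dots> \<le> (C * sqrt (I / h)) * (C * sqrt (I / h))"
        using aj h C(1) I0 by (intro mult_mono der) auto
      also have "\<dots> = C\<^sup>2 * I / h"
      proof -
        have "sqrt (I / h) * sqrt (I / h) = I / h" using I0 h by simp
        then have "C * C * (sqrt (I / h) * sqrt (I / h)) = C * C * (I / h)" by (simp only:)
        then show ?thesis by (simp add: power2_eq_square mult_ac)
      qed
      finally have 1: "h ^ Suc (a + j) * (cmod (nth_vderiv a w x) * cmod (nth_vderiv j w x)) \<le> C\<^sup>2 * I"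
        using h by (simp add: field_simps)
      have "h ^ K * (cmod (nth_vderiv a w x) * cmod (nth_vderiv j w x)) \<le>
          h ^ Suc (a + j) * (cmod (nth_vderiv a w x) * cmod (nth_vderiv j w x))"
        using h aj by (intro mult_right_mono power_decreasing) auto
      also note 1
      also have "C\<^sup>2 * I \<le> C\<^sup>2 * (exp (2*L) * (v x)\<^sup>2 * J)" by (intro mult_left_mono IJ) auto
      finally have "(v x)\<^sup>2 * (cmod (nth_vderiv a w x) * cmod (nth_vderiv j w x)) \<le>
          (v x)\<^sup>2 * (C\<^sup>2 * b\<^sup>2 * exp (2*L) * J)"
        unfolding hK using b0 by (simp add: field_simps)
      then show ?thesis using v_pos[of x] by simp
    qed
    have "cmod (bform Q w x) \<le> (\<Sum>k\<le>K. \<bar>coeff Q k\<bar> * (\<Sum>j<k. cmod (nth_vderiv (k - Suc j) w x) * cmod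
        (nth_vderiv j w x)))"
      unfolding bform_def deg
      by (intro norm_sum[THEN order_trans] sum_mono)
        (auto simp: norm_mult norm_power intro!: mult_left_mono norm_sum[THEN order_trans] sum_mono)
    also have "\<dots> \<le> (\<Sum>k\<le>K. \<bar>coeff Q k\<bar> * (\<Sum>j<k. C\<^sup>2 * b\<^sup>2 * exp (2*L) * J))"
      by (intro sum_mono mult_left_mono prod) auto
    also have "\<dots> = D * J"
      by (simp add: D_def sum_distrib_left sum_distrib_right mult_ac)
    finally show ?thesis by (simp add: J_def)
  qed
  then show ?thesis by blast
qed

text \<open>
  The deficiency equation has no nonzero solution with \<open>w / v\<close> square integrable. By the Lagrange
  identity, \<open>2 \<bar>Im \<zeta>\<bar>\<close> times the integral of \<open>\<bar>w / v\<bar>\<^sup>2\<close> over \<open>{-n..n}\<close> is a difference of boundary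
  terms, and these tend to zero since \<open>bform_bound\<close> dominates them by tails of a convergent
  integral.
\<close>

lemma deficiency_classical:
  assumes L: "\<And>x. \<bar>nth_vderiv 1 v x\<bar> \<le> L * v x"
    and w: "C_times K w" and ode: "\<And>t. poly_D Q w t = \<zeta> * w t / of_real ((v t)\<^sup>2)"
    and \<zeta>: "Im \<zeta> \<noteq> 0"
    and L2: "integrable lborel (\<lambda>t. (cmod (w t) / v t)\<^sup>2)"
  shows "w x = 0"
proof -
  let ?U = "\<lambda>t. (cmod (w t) / v t)\<^sup>2"
  have contU: "continuous_on S ?U" for S
  proof -
    have "continuous_on UNIV ?U"
      using C_times_imp_continuous[OF w] v_continuous v_pos
      by (intro continuous_intros) (auto simp: less_imp_neq[symmetric])
    then show ?thesis by (rule continuous_on_subset) simp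
  qed
  have intU: "?U integrable_on {a..b}" for a b
    by (intro integrable_continuous_real contU)
  obtain C where C: "\<And>x. cmod (bform Q w x) \<le> C * integral {x..x+1} ?U"
    using bform_bound[OF L, of \<zeta>] w ode by metis
  have tail: "(\<lambda>n. integral {f n..f n+1} ?U) \<longlonglongrightarrow> 0" if f: "filterlim (\<lambda>n. \<bar>f n\<bar>) at_top sequentially" for f
      :: "nat \<Rightarrow> real"
  proof -
    have eq: "integral {a..b} ?U = (LBINT t. indicator {a..b} t * ?U t)" for a b
      using set_borel_integral_eq_integral(2)[of "{a..b}" ?U] borel_integrable_atLeastAtMost'[OF contU, of a b]
      by (simp add: set_lebesgue_integral_def set_integrable_def)
    have "(\<lambda>n. LBINT t. indicator {f n..f n+1} t * ?U t) \<longlonglongrightarrow> integral\<^sup>L lborel (\<lambda>t::real. 0)"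
    proof (rule integral_dominated_convergence[where w="?U"])
      have "?U \<in> borel_measurable lborel" using L2 by (rule borel_measurable_integrable)
      then show "(\<lambda>t. indicator {f n..f n+1} t * ?U t) \<in> borel_measurable lborel" for n by measurable
      show "AE t in lborel. (\<lambda>n. indicator {f n..f n+1} t * ?U t) \<longlonglongrightarrow> 0"
      proof (rule AE_I2)
        fix t :: real
        have "\<forall>\<^sub>F n in sequentially. \<bar>f n\<bar> > \<bar>t\<bar> + 1"
          using f by (simp add: filterlim_at_top_dense)
        then have "\<forall>\<^sub>F n in sequentially. indicator {f n..f n+1} t * ?U t = 0"
          by eventually_elim (auto simp: indicator_def)
        then show "(\<lambda>n. indicator {f n..f n+1} t * ?U t) \<longlonglongrightarrow> 0"
          by (rule tendsto_eventually)
      qed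
      show "AE t in lborel. norm (indicator {f n..f n+1} t * ?U t) \<le> ?U t" for n
        by (auto simp: indicator_def)
    qed (use L2 in auto)
    then show ?thesis by (simp add: eq)
  qed
  have b0: "(\<lambda>n. bform Q w (f n)) \<longlonglongrightarrow> 0" if f: "filterlim (\<lambda>n. \<bar>f n\<bar>) at_top sequentially" for f :: "nat \<Rightarrow> real"
  proof (rule Lim_null_comparison)
    show "\<forall>\<^sub>F n in sequentially. norm (bform Q w (f n)) \<le> C * integral {f n..f n+1} ?U" using C by simp
    show "(\<lambda>n. C * integral {f n..f n+1} ?U) \<longlonglongrightarrow> 0" using tendsto_mult_right_zero[OF tail[OF f]] .
  qed
  have ftc: "cmod (bform Q w b - bform Q w a) = 2 * \<bar>Im \<zeta>\<bar> * integral {a..b} ?U" if "a \<le> b" for a b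
  proof -
    have pt: "poly_D Q w t * cnj (w t) - w t * cnj (poly_D Q w t) = (2 * \<i> * of_real (Im \<zeta>)) * of_real (?U
        t)" for t
    proof -
      have "w t * cnj (w t) = of_real ((cmod (w t))\<^sup>2)" by (rule complex_norm_square[symmetric])
      moreover have "poly_D Q w t * cnj (w t) - w t * cnj (poly_D Q w t) = (\<zeta> - cnj \<zeta>) * (w t * cnj (w t))
          / of_real ((v t)\<^sup>2)"
        unfolding ode by (simp add: algebra_simps diff_divide_distrib)
      moreover have "\<zeta> - cnj \<zeta> = 2 * \<i> * of_real (Im \<zeta>)" by (simp add: complex_eq_iff)
      ultimately show ?thesis by (simp add: power_divide)
    qed
    have "((\<lambda>t. (2 * \<i> * of_real (Im \<zeta>)) * of_real (?U t)) has_integral bform Q w b - bform Q w a) {a..b}"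
      unfolding pt[symmetric] using w deg
      by (intro fundamental_theorem_of_calculus[OF that] has_vector_derivative_at_within[OF
          lagrange_identity]) simp
    moreover have "((\<lambda>t. (2 * \<i> * of_real (Im \<zeta>)) * of_real (?U t)) has_integral (2 * \<i> * of_real (Im \<zeta>))
        * of_real (integral {a..b} ?U)) {a..b}"
      by (intro has_integral_mult_right has_integral_of_real integrable_integral intU)
    ultimately have "bform Q w b - bform Q w a = (2 * \<i> * of_real (Im \<zeta>)) * of_real (integral {a..b} ?U)"
      by (rule has_integral_unique)
    then show ?thesis
      by (simp add: norm_mult abs_of_nonneg integral_nonneg[OF intU])
  qed
  have "(\<lambda>n. bform Q w (real n) - bform Q w (- real n)) \<longlonglongrightarrow> 0 - 0"
    by (intro tendsto_diff b0) (auto simp: filterlim_real_sequentially)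
  then have lim: "(\<lambda>n. cmod (bform Q w (real n) - bform Q w (- real n))) \<longlonglongrightarrow> 0"
    by (auto dest: tendsto_norm_zero)
  have zero: "integral {-r..r} ?U = 0" if "r \<ge> 0" for r :: real
  proof -
    have "2 * \<bar>Im \<zeta>\<bar> * integral {-r..r} ?U \<le> 0"
    proof (rule LIMSEQ_le_const[OF lim], intro exI allI impI)
      fix n assume n: "n \<ge> nat \<lceil>r\<rceil>"
      then have "r \<le> real n" by linarith
      then have "integral {-r..r} ?U \<le> integral {- real n..real n} ?U"
        by (intro integral_subset_le intU) auto
      then show "2 * \<bar>Im \<zeta>\<bar> * integral {-r..r} ?U \<le> cmod (bform Q w (real n) - bform Q w (- real n))"
        by (simp add: ftc mult_left_mono)
    qed
    then have "integral {-r..r} ?U \<le> 0" using \<zeta> by (simp add: mult_le_0_iff)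
    moreover have "integral {-r..r} ?U \<ge> 0" by (intro integral_nonneg intU) simp
    ultimately show ?thesis by simp
  qed
  have "?U x = 0"
  proof -
    have "(?U has_integral 0) (cbox (-(\<bar>x\<bar>+1)) (\<bar>x\<bar>+1))"
      using zero[of "\<bar>x\<bar>+1"] intU integrable_integral by (metis abs_ge_zero add_nonneg_nonneg
          cbox_interval zero_le_one)
    then show ?thesis
      by (rule has_integral_0_cbox_imp_0[rotated 2]) (use contU in auto)
  qed
  then show ?thesis using v_pos[of x] by simp
qed

lemma v_times_L2_loc_int:
  assumes u: "u \<in> L2"
  shows "loc_int (\<lambda>x. of_real (v x) * cnj (u x))"
proof -
  have [measurable]: "u \<in> borel_measurable borel" using u by measurable
  have "loc_int (\<lambda>x. cnj (u x))"
    unfolding loc_int_def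
  proof (intro conjI allI)
    show m: "(\<lambda>x. cnj (u x)) \<in> borel_measurable borel"
      by (rule borel_measurable_continuous_on[OF continuous_on_cnj[OF continuous_on_id]]) measurable
    fix a b :: real
    have "integrable lborel (\<lambda>x. indicator {a..b} x *\<^sub>R (1::real))"
      using borel_integrable_atLeastAtMost'[of a b "\<lambda>_. 1::real"] by (simp add: set_integrable_def)
    then have "integrable lborel (\<lambda>x. indicator {a..b} x *\<^sub>R (1::real) + (cmod (u x))\<^sup>2)"
      using L2_integrable[OF u] by (rule Bochner_Integration.integrable_add)
    then show "set_integrable lborel {a..b} (\<lambda>x. cnj (u x))"
      unfolding set_integrable_def
    proof (rule Bochner_Integration.integrable_bound)
      show "(\<lambda>x. indicat_real {a..b} x *\<^sub>R cnj (u x)) \<in> borel_measurable lborel"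
        using m by simp
      have "cmod z \<le> 1 + (cmod z)\<^sup>2" for z
      proof -
        have "2 * cmod z \<le> 1 + (cmod z)\<^sup>2" using sum_squares_bound[of 1 "cmod z"] by simp
        then show ?thesis using norm_ge_zero[of z] by linarith
      qed
      then show "AE x in lborel. norm (indicat_real {a..b} x *\<^sub>R cnj (u x)) \<le> norm (indicator {a..b} x *\<^sub>R
          (1::real) + (cmod (u x))\<^sup>2)"
        by (intro AE_I2) (auto simp: indicator_def)
    qed
  qed
  then show ?thesis
    by (intro loc_int_mult_continuous continuous_on_of_real v_continuous)
qed

text \<open>
  In terms of \<open>\<psi> = v g\<close>, orthogonality to the range of \<open>A0 - z\<close> says that \<open>W = v (cnj u)\<close> is a
  distributional solution of \<open>Q(- D) W = z W / v\<^sup>2\<close>. By regularity it is a classical one, and the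
  conjugate function solves the equation of \<open>deficiency_classical\<close>.
\<close>

lemma orthogonal_to_range_zero:
  assumes L: "\<And>x. \<bar>nth_vderiv 1 v x\<bar> \<le> L * v x" and z: "Im z \<noteq> 0" and u: "u \<in> L2"
    and orth: "\<And>g h. (g, h) \<in> A0_op Q v \<Longrightarrow> L2ip (\<lambda>x. h x - z * g x) u = 0"
  shows "AE x in lborel. u x = 0"
proof -
  define W where "W x = complex_of_real (v x) * cnj (u x)" for x
  define p where "p x = z * complex_of_real (inverse (v x) * inverse (v x))" for x
  define c where "c k = complex_of_real (coeff Q k) * \<i> ^ k" for k
  have W: "loc_int W" unfolding W_def[abs_def] by (rule v_times_L2_loc_int[OF u])
  have pC: "C_times K p" unfolding p_def[abs_def]
    by (intro C_times_mult C_times_const C_times_of_real inverse_v_C_times)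
  have cK: "c K \<noteq> 0" using coeff_K_nonzero by (simp add: c_def)
  have weak: "(\<Sum>k\<le>K. LBINT x. nth_vderiv k \<psi> x * (c k * W x)) = (LBINT x. \<psi> x * (p x * W x))"
    if \<psi>: "\<psi> \<in> C0_times K" for \<psi>
  proof -
    obtain R where R: "\<And>x. \<bar>x\<bar> > R \<Longrightarrow> \<psi> x = 0" and C: "C_times K \<psi>" using \<psi> by (auto simp: C0_times_iff)
    have t: "integrable lborel (\<lambda>x. nth_vderiv k \<psi> x * F x)" if "k \<le> K" "loc_int F" for k F
    proof (rule test_function_times_loc_int_integrable[OF _ _ that(2)])
      show "continuous_on UNIV (nth_vderiv k \<psi>)"
        using C_times_nth_vderiv[OF C that(1)] C_times_imp_continuous by blast
      show "\<And>x. \<bar>x\<bar> > R \<Longrightarrow> nth_vderiv k \<psi> x = 0" by (rule nth_vderiv_eq_0_outside[OF R])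
    qed
    have lW: "loc_int (\<lambda>x. c k * W x)" for k by (rule loc_int_mult_continuous[OF continuous_on_const W])
    have lp: "loc_int (\<lambda>x. p x * W x)" by (rule loc_int_mult_continuous[OF C_times_imp_continuous[OF pC] W])
    have "0 = (LBINT x. (of_real (v x) * poly_D Q \<psi> x - z * (\<psi> x / of_real (v x))) * cnj (u x))"
      using orth[OF A0_memI[OF \<psi>]] by (simp add: L2ip_def)
    also have "\<dots> = (LBINT x. (\<Sum>k\<le>K. nth_vderiv k \<psi> x * (c k * W x)) - \<psi> x * (p x * W x))"
    proof (intro Bochner_Integration.integral_cong refl)
      fix x
      have 1: "of_real (v x) * poly_D Q \<psi> x * cnj (u x) = (\<Sum>k\<le>K. nth_vderiv k \<psi> x * (c k * W x))"
        unfolding poly_D_def deg sum_distrib_left sum_distrib_right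
        by (intro sum.cong refl) (simp add: c_def W_def mult_ac)
      have 2: "z * (\<psi> x / of_real (v x)) * cnj (u x) = \<psi> x * (p x * W x)"
        using v_pos[of x] by (simp add: p_def W_def field_simps)
      show "(of_real (v x) * poly_D Q \<psi> x - z * (\<psi> x / of_real (v x))) * cnj (u x) =
         (\<Sum>k\<le>K. nth_vderiv k \<psi> x * (c k * W x)) - \<psi> x * (p x * W x)"
        unfolding left_diff_distrib 1 2 ..
    qed
    also have "\<dots> = (\<Sum>k\<le>K. LBINT x. nth_vderiv k \<psi> x * (c k * W x)) - (LBINT x. \<psi> x * (p x * W x))"
    proof -
      have i: "integrable lborel (\<lambda>x. nth_vderiv k \<psi> x * (c k * W x))" if "k \<in> {..K}" for k
        using t[OF _ lW] that by simp
      have "(LBINT x. (\<Sum>k\<le>K. nth_vderiv k \<psi> x * (c k * W x)) - \<psi> x * (p x * W x)) =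
          (LBINT x. \<Sum>k\<le>K. nth_vderiv k \<psi> x * (c k * W x)) - (LBINT x. \<psi> x * (p x * W x))"
        using t[of 0, OF _ lp] i by (intro Bochner_Integration.integral_diff
            Bochner_Integration.integrable_sum) auto
      also have "(LBINT x. \<Sum>k\<le>K. nth_vderiv k \<psi> x * (c k * W x)) = (\<Sum>k\<le>K. LBINT x. nth_vderiv k \<psi> x * (c k
          * W x))"
        by (rule Bochner_Integration.integral_sum) (rule i)
      finally show ?thesis .
    qed
    finally show ?thesis by simp
  qed
  obtain W' where W': "C_times K W'" "AE x in lborel. W x = W' x"
    "\<And>x. (\<Sum>k\<le>K. (-1) ^ k * c k * nth_vderiv k W' x) = p x * W' x"
    using weak_regularity[OF K1 cK pC W weak] by blast
  define w where "w x = cnj (W' x)" for x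
  have wC: "C_times K w" unfolding w_def[abs_def] by (rule C_times_linear[OF bounded_linear_cnj W'(1)])
  have ode: "poly_D Q w t = cnj z * w t / of_real ((v t)\<^sup>2)" for t
  proof -
    have "poly_D Q w t = cnj (\<Sum>k\<le>K. (-1) ^ k * c k * nth_vderiv k W' t)"
      unfolding poly_D_def deg cnj_sum
    proof (intro sum.cong refl)
      fix k assume "k \<in> {..K}"
      then have "nth_vderiv k w t = cnj (nth_vderiv k W' t)"
        unfolding w_def[abs_def] using nth_vderiv_linear[OF bounded_linear_cnj W'(1), of k] by simp
      moreover have "cnj ((-1) ^ k * \<i> ^ k) = \<i> ^ k" by (simp add: power_mult_distrib[symmetric])
      ultimately show "of_real (coeff Q k) * \<i> ^ k * nth_vderiv k w t = cnj ((-1) ^ k * c k * nth_vderiv k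
          W' t)"
        by (simp add: c_def mult_ac)
    qed
    then show ?thesis unfolding W'(3) using v_pos[of t] by (simp add: p_def w_def power2_eq_square field_simps)
  qed
  have meas[measurable]: "u \<in> borel_measurable borel" using u by measurable
  have eq: "AE x in lborel. (cmod (u x))\<^sup>2 = (cmod (w x) / v x)\<^sup>2"
    using W'(2)
  proof eventually_elim
    case (elim x)
    have "cmod (w x) = cmod (W x)" using elim by (simp add: w_def)
    then show ?case using v_pos[of x] by (simp add: W_def norm_mult)
  qed
  have "integrable lborel (\<lambda>t. (cmod (w t) / v t)\<^sup>2)"
  proof (rule integrable_cong_AE_imp[OF L2_integrable[OF u]])
    have "continuous_on UNIV (\<lambda>t. (cmod (w t) / v t)\<^sup>2)"
      using C_times_imp_continuous[OF wC] v_continuous v_pos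
      by (intro continuous_intros) (auto simp: less_imp_neq[symmetric])
    then show "(\<lambda>t. (cmod (w t) / v t)\<^sup>2) \<in> borel_measurable lborel"
      by (simp add: borel_measurable_continuous_onI)
    show "AE x in lborel. (cmod (u x))\<^sup>2 = (cmod (w x) / v x)\<^sup>2" by (rule eq)
  qed
  then have w0: "w x = 0" for x
    using z by (intro deficiency_classical[OF L wC ode]) auto
  show ?thesis using eq by eventually_elim (simp add: w0)
qed

section \<open>Spectrum\<close>

text \<open>
  The lower bound gives injectivity and the bounded inverse. Since the range of \<open>A0 - z\<close> is dense,
  there are \<open>gs n\<close> with \<open>(A0 - z) (gs n) \<rightarrow> f\<close>; by the lower bound \<open>gs\<close> is Cauchy, and its limit is
  mapped to \<open>f\<close> by the closure.
\<close>

lemma nonreal_in_resolvent: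
  assumes L: "\<And>x. \<bar>nth_vderiv 1 v x\<bar> \<le> L * v x" and z: "Im z \<noteq> 0"
  shows "z \<in> resolvent_set (A_op Q v)"
  unfolding resolvent_set_def mem_Collect_eq
proof (intro conjI)
  have bound: "L2norm g \<le> (1 / \<bar>Im z\<bar>) * L2norm (\<lambda>x. h x - z * g x)" if "(g, h) \<in> A_op Q v" for g h
    using A_lower_bound[OF that, of z] z by (simp add: field_simps)
  then show "\<exists>C. \<forall>(g, h)\<in>A_op Q v. L2norm g \<le> C * L2norm (\<lambda>x. h x - z * g x)" by blast
  have A_L2: "g \<in> L2" "h \<in> L2" if "(g, h) \<in> A_op Q v" for g h
    using that unfolding A_op_def op_closure_def L2_lim_def by auto
  have "AE x in lborel. g x = 0"
    if gh: "(g, h) \<in> A_op Q v" and 0: "AE x in lborel. h x - z * g x = 0" for g h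
  proof -
    have "L2norm (\<lambda>x. h x - z * g x) = 0"
      using 0 A_L2[OF gh] by (subst L2norm_eq_0_iff) (auto intro: L2_diff L2_scale)
    then have "L2norm g = 0" using bound[OF gh] L2norm_nonneg[of g] by simp
    then show ?thesis using L2norm_eq_0_iff A_L2[OF gh] by blast
  qed
  then show "\<forall>(g, h)\<in>A_op Q v. (AE x in lborel. h x - z * g x = 0) \<longrightarrow> (AE x in lborel. g x = 0)"
    by blast
  show "\<forall>f\<in>L2. \<exists>(g, h)\<in>A_op Q v. AE x in lborel. h x - z * g x = f x"
  proof
    fix f assume f: "f \<in> L2"
    define R where "R = {(\<lambda>x. h x - z * g x) | g h. (g, h) \<in> A0_op Q v}"
    have RI: "r \<in> R" if "(g, h) \<in> A0_op Q v" "r = (\<lambda>x. h x - z * g x)" for r g h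
      unfolding R_def using that by blast
    obtain rs where rs: "\<And>n. rs n \<in> R" "L2_lim rs f"
    proof (rule L2_dense_subspace[of R f])
      show "R \<subseteq> L2" unfolding R_def using A0_L2 by (auto intro!: L2_diff L2_scale)
      show "(\<lambda>x. 0) \<in> R"
        by (rule RI[OF A0_zero]) simp
      show "(\<lambda>x. r x + s x) \<in> R" if "r \<in> R" "s \<in> R" for r s
      proof -
        from that obtain g h g' h' where gh: "(g, h) \<in> A0_op Q v" "(g', h') \<in> A0_op Q v"
          and r: "r = (\<lambda>x. h x - z * g x)" and s: "s = (\<lambda>x. h' x - z * g' x)" unfolding R_def by blast
        have "(\<lambda>x. r x + s x) = (\<lambda>x. (1 * h x + h' x) - z * (1 * g x + g' x))"
          by (simp add: r s algebra_simps)
        then show ?thesis by (rule RI[OF A0_linear[OF gh, of 1]])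
      qed
      show "(\<lambda>x. c * r x) \<in> R" if "r \<in> R" for c r
      proof -
        from that obtain g h where gh: "(g, h) \<in> A0_op Q v" and r: "r = (\<lambda>x. h x - z * g x)" unfolding
            R_def by blast
        have "(\<lambda>x. c * r x) = (\<lambda>x. (c * h x + 0) - z * (c * g x + 0))"
          by (simp add: r algebra_simps)
        then show ?thesis by (rule RI[OF A0_linear[OF gh A0_zero, of c]])
      qed
      show "AE x in lborel. u x = 0" if "u \<in> L2" "\<And>r. r \<in> R \<Longrightarrow> L2ip r u = 0" for u
        by (rule orthogonal_to_range_zero[OF L z that(1)]) (rule that(2)[OF RI[OF _ refl]])
    qed (use f in auto)
    have "\<exists>g h. (g, h) \<in> A0_op Q v \<and> rs n = (\<lambda>x. h x - z * g x)" for n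
      using rs(1)[of n] unfolding R_def by blast
    then obtain gs hs where gh: "\<And>n. (gs n, hs n) \<in> A0_op Q v" "\<And>n. rs n = (\<lambda>x. hs n x - z * gs n x)"
      by metis
    have gL: "gs n \<in> L2" "hs n \<in> L2" for n using A0_L2[OF gh(1)] by auto
    have fr: "f \<in> L2" "rs n \<in> L2" for n using rs(2) by (auto simp: L2_lim_def)
    obtain g where g: "L2_lim gs g"
    proof (rule L2_complete[of gs])
      fix e :: real assume e: "e > 0"
      define e' where "e' = \<bar>Im z\<bar> * e / 2"
      have e': "e' > 0" using e z by (simp add: e'_def)
      obtain N where N: "\<And>n. n \<ge> N \<Longrightarrow> L2norm (\<lambda>x. rs n x - f x) < e'"
        using rs(2) LIMSEQ_D[of "\<lambda>n. L2norm (\<lambda>x. rs n x - f x)" 0 e'] e' unfolding L2_lim_def by auto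
      have "L2norm (\<lambda>x. gs m x - gs n x) < e" if "m \<ge> N" "n \<ge> N" for m n
      proof -
        have A: "(\<lambda>x. - 1 * gs n x + gs m x, \<lambda>x. - 1 * hs n x + hs m x) \<in> A0_op Q v"
          by (rule A0_linear[OF gh(1) gh(1)])
        have "\<bar>Im z\<bar> * L2norm (\<lambda>x. gs m x - gs n x) \<le> L2norm (\<lambda>x. rs m x - rs n x)"
          using A0_lower_bound[OF A, of z] by (simp add: gh(2) algebra_simps)
        also have "\<dots> \<le> L2norm (\<lambda>x. rs m x - f x) + L2norm (\<lambda>x. f x - rs n x)"
          by (rule L2norm_diff_triangle[OF fr(2,1,2)])
        also have "L2norm (\<lambda>x. f x - rs n x) = L2norm (\<lambda>x. rs n x - f x)"
          by (rule L2norm_minus_commute)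
        also have "L2norm (\<lambda>x. rs m x - f x) + \<dots> < \<bar>Im z\<bar> * e"
          using N[OF that(1)] N[OF that(2)] by (simp add: e'_def)
        finally show ?thesis using z by simp
      qed
      then show "\<exists>N. \<forall>m\<ge>N. \<forall>n\<ge>N. L2norm (\<lambda>x. gs m x - gs n x) < e" by blast
    qed (use gL in auto)
    have "L2_lim (\<lambda>n x. rs n x + z * gs n x) (\<lambda>x. f x + z * g x)"
      by (intro L2_lim_add L2_lim_scale rs g)
    then have "L2_lim hs (\<lambda>x. f x + z * g x)" by (simp add: gh(2))
    then have "(g, \<lambda>x. f x + z * g x) \<in> A_op Q v"
      unfolding A_op_def op_closure_def using gh(1) g by blast
    then show "\<exists>(g, h)\<in>A_op Q v. AE x in lborel. h x - z * g x = f x"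
      by (intro bexI[of _ "(g, \<lambda>x. f x + z * g x)"]) auto
  qed
qed

end

theorem theorem4p1:
  fixes K :: nat and Q :: "real poly" and v :: "real \<Rightarrow> real" and \<delta> :: real
  assumes "K \<ge> 1"
    and "degree Q = K"
    and "C_times K v"
    and "bounded (range v)"
    and "\<And>\<xi>. v \<xi> > 0"
    and "\<exists>C. \<forall>\<xi>. \<bar>nth_vderiv 1 v \<xi>\<bar> \<le> C * v \<xi>"
    and "\<And>k. 1 \<le> k \<Longrightarrow> k \<le> K - 1 \<Longrightarrow> bounded (range (\<lambda>\<xi>. nth_vderiv k v \<xi> / v \<xi>))"
    and "\<delta> > 0"
    and "(\<lambda>n::nat.
            (LBINT \<xi>:{- (real n * (1 + \<delta>))..real n * (1 + \<delta>)}. v \<xi> powr (- 2 + 4 / real K)) /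
            (LBINT \<xi>:{- real n..real n}. v \<xi> powr (- 2))) \<longlonglongrightarrow> 0"
  shows "(odd K \<longrightarrow> op_spectrum (A_op Q v) = (\<real> :: complex set)) \<and>
         (even K \<and> coeff Q K > 0 \<longrightarrow> complex_of_real ` {0..} \<subseteq> op_spectrum (A_op Q v))"
proof -
  interpret weight K Q v by unfold_locales (use assms in auto)
  have spec: "complex_of_real \<mu> \<in> op_spectrum (A_op Q v)" if "coeff Q K * c ^ K = \<mu>" for c \<mu>
    using in_spectrum[OF assms(7,8,9), of c] that by simp
  obtain L where L: "\<And>x. \<bar>nth_vderiv 1 v x\<bar> \<le> L * v x" using assms(6) by blast
  show ?thesis
  proof (intro conjI impI)
    assume odd: "odd K"
    show "op_spectrum (A_op Q v) = (\<real> :: complex set)"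
    proof (intro equalityI subsetI)
      fix z assume "z \<in> op_spectrum (A_op Q v)"
      then have "Im z = 0" using nonreal_in_resolvent[OF L, of z] by (auto simp: op_spectrum_def)
      then show "z \<in> \<real>" by (simp add: complex_is_Real_iff)
    next
      fix z :: complex assume "z \<in> \<real>"
      then obtain \<mu> where \<mu>: "z = complex_of_real \<mu>" by (auto elim: Reals_cases)
      have "coeff Q K * root K (\<mu> / coeff Q K) ^ K = \<mu>"
        using odd coeff_K_nonzero by (simp add: odd_real_root_pow)
      then show "z \<in> op_spectrum (A_op Q v)" unfolding \<mu> by (rule spec)
    qed
  next
    assume "even K \<and> coeff Q K > 0"
    then have "coeff Q K * root K (\<mu> / coeff Q K) ^ K = \<mu>" if "\<mu> \<ge> 0" for \<mu>
      using K_pos that by simp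
    from spec[OF this] show "complex_of_real ` {0..} \<subseteq> op_spectrum (A_op Q v)" by auto
  qed
qed

end
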